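(* Let $X=X_1\times X_2\times\cdots\times X_r$ be a product of locally compact Hadamard spaces and let $\Gamma<\mathrm{Is}(X_1)\times\cdots\times\mathrm{Is}(X_r)$ be a group which acts properly discontinuously on $X$ and contains two independent regular axial isometries. Then the critical exponent $\delta(\Gamma)$ of $\Gamma$ is strictly positive, and there exists a unique $\theta^*\in E$ such that $\delta_{\theta^*}(\Gamma)=\delta(\Gamma)$.
   Context: A Hadamard space is a complete CAT(0) metric space. Let $(X_i,d_i)$, $i=1,\ldots,r$, be locally compact Hadamard spaces, and let $X=X_1\times\cdots\times X_r$ carry the product distance $d=\sqrt{d_1^2+\cdots+d_r^2}$. An isometry $h$ of a Hadamard space $Y$ is axial if there are $l(h)>0$ and a geodesic line $\sigma:\mathbb{R}\to Y$ (an axis) with $h(\sigma(t))=\sigma(t+l(h))$ for all $t$; set $h^+=\sigma(\infty)$, $h^-=\sigma(-\infty)$. It is rank one if it has an axis which does not bound a flat half-plane (a closed convex subset of $Y$ isometric to $[0,\infty)\times\mathbb{R}$ whose boundary line is the axis). Two rank one isometries $g,h$ are independent if $\{g^+,g^-\}\cap\{h^+,h^-\}=\emptyset$. An element $h=(h_1,\ldots,h_r)\in\mathrm{Is}(X_1)\times\cdots\times\mathrm{Is}(X_r)$ is regular axial if each $h_i$ is a rank one isometry of $X_i$; two regular axial isometries $g,h$ are independent if $g_i,h_i$ are independent for all $i$. Let $E=\{\theta\in\mathbb{R}_{\ge0}^r:\Vert\theta\Vert=1\}$ and fix a base point $o=(o_1,\ldots,o_r)\in X$. For $x\ne z$ in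 $X$ let $\widehat H(x,z)=\frac1{d(x,z)}(d_1(x_1,z_1),\ldots,d_r(x_r,z_r))\in E$. For $\theta\in E$, $\varepsilon>0$ let $\Gamma(o,o;\theta,\varepsilon)=\{\gamma\in\Gamma:\gamma o\ne o,\ \Vert\widehat H(o,\gamma o)-\theta\Vert<\varepsilon\}$, and let $\delta_\theta^\varepsilon(o,o)$ be the critical exponent of the series $\sum_{\gamma\in\Gamma(o,o;\theta,\varepsilon)}e^{-s\,d(o,\gamma o)}$, i.e. the unique real number such that the series converges for larger $s\in\mathbb{R}$ and diverges for smaller $s$; it is set to be $-\infty$ if the series converges for all $s\in\mathbb{R}$. Put $\delta_\theta(\Gamma)=\lim_{\varepsilon\to0}\delta_\theta^\varepsilon(o,o)$ (independent of $o$). The critical exponent $\delta(\Gamma)$ is that of the full Poincaré series $\sum_{\gamma\in\Gamma}e^{-s\,d(o,\gamma o)}$.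
   Formalization: The Poincaré series may diverge for every s, in which case δ(Γ) is not a real number; the formal version then sets δ(Γ)=+∞, proves positivity and existence of θ* in all cases, and claims uniqueness of θ* only when δ(Γ) is finite. *)

theory Defs
  imports "HOL-Analysis.Analysis" "HOL-Algebra.Bij" "HOL-Algebra.Product_Groups"
begin

section \<open>Geodesics and Hadamard spaces\<close>

text \<open>Unit speed geodesics on a real interval \<open>I\<close>: segments (\<open>I = {0..l}\<close>), rays
  (\<open>I = {0..}\<close>) and lines (\<open>I = UNIV\<close>). The values of \<open>c\<close> outside \<open>I\<close> are irrelevant.\<close>

definition geodesic_on :: "'a metric \<Rightarrow> real set \<Rightarrow> (real \<Rightarrow> 'a) \<Rightarrow> bool" where
  "geodesic_on Y I c \<longleftrightarrow>
     c ` I \<subseteq> mspace Y \<and> (\<forall>s\<in>I. \<forall>t\<in>I. mdist Y (c s) (c t) = \<bar>s - t\<bar>)"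

definition geodesic_between :: "'a metric \<Rightarrow> 'a \<Rightarrow> 'a \<Rightarrow> (real \<Rightarrow> 'a) \<Rightarrow> bool" where
  "geodesic_between Y x y c \<longleftrightarrow>
     geodesic_on Y {0..mdist Y x y} c \<and> c 0 = x \<and> c (mdist Y x y) = y"

text \<open>Comparison with Euclidean triangles. Two points on a geodesic triangle lie on two sides with
  a common vertex, called \<open>x\<close> here; primed points are the comparison points in the plane.\<close>

definition cat0 :: "'a metric \<Rightarrow> bool" where
  "cat0 Y \<longleftrightarrow>
     (\<forall>x\<in>mspace Y. \<forall>y\<in>mspace Y. \<exists>c. geodesic_between Y x y c) \<and>
     (\<forall>x\<in>mspace Y. \<forall>y\<in>mspace Y. \<forall>z\<in>mspace Y. \<forall>b c.
        geodesic_between Y x y b \<and> geodesic_between Y x z c \<longrightarrow>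
        (\<forall>x' y' z' :: real^2.
           dist x' y' = mdist Y x y \<and> dist y' z' = mdist Y y z \<and> dist x' z' = mdist Y x z \<longrightarrow>
           (\<forall>s\<in>{0..mdist Y x y}. \<forall>t\<in>{0..mdist Y x z}.
            \<forall>p'\<in>closed_segment x' y'. \<forall>q'\<in>closed_segment x' z'.
              dist x' p' = s \<and> dist x' q' = t \<longrightarrow> mdist Y (b s) (c t) \<le> dist p' q')))"

definition hadamard_space :: "'a metric \<Rightarrow> bool" where
  "hadamard_space Y \<longleftrightarrow> cat0 Y \<and> mcomplete_of Y"

definition geodesically_convex :: "'a metric \<Rightarrow> 'a set \<Rightarrow> bool" where
  "geodesically_convex Y F \<longleftrightarrow>
     F \<subseteq> mspace Y \<and>
     (\<forall>x\<in>F. \<forall>y\<in>F. \<forall>c. geodesic_between Y x y c \<longrightarrow> c ` {0..mdist Y x y} \<subseteq> F)"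

text \<open>\<open>real \<times> real\<close> carries the Euclidean metric.\<close>

definition bounds_flat_half_plane :: "'a metric \<Rightarrow> (real \<Rightarrow> 'a) \<Rightarrow> bool" where
  "bounds_flat_half_plane Y \<sigma> \<longleftrightarrow>
     (\<exists>F. closedin (mtopology_of Y) F \<and> geodesically_convex Y F \<and>
        (\<exists>\<phi> :: real \<times> real \<Rightarrow> 'a.
           \<phi> ` ({0..} \<times> UNIV) = F \<and>
           (\<forall>p\<in>{0..} \<times> UNIV. \<forall>q\<in>{0..} \<times> UNIV. mdist Y (\<phi> p) (\<phi> q) = dist p q) \<and>
           \<phi> ` ({0} \<times> UNIV) = range \<sigma>))"

text \<open>A point of the geometric boundary is represented by the class of all geodesic rays
  asymptotic to a given one.\<close>

definition boundary_point :: "'a metric \<Rightarrow> (real \<Rightarrow> 'a) \<Rightarrow> (real \<Rightarrow> 'a) set" where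
  "boundary_point Y \<sigma> =
     {\<rho>. geodesic_on Y {0..} \<rho> \<and> (\<exists>C. \<forall>t\<ge>0. mdist Y (\<sigma> t) (\<rho> t) \<le> C)}"


section \<open>Isometries\<close>

text \<open>As in \<^const>\<open>BijGroup\<close>, isometries are extensional, so that they are determined by their
  values on the space.\<close>

definition isometry_group :: "'a metric \<Rightarrow> ('a \<Rightarrow> 'a) monoid" where
  "isometry_group Y = (BijGroup (mspace Y))
     \<lparr>carrier := {f \<in> Bij (mspace Y).
        \<forall>x\<in>mspace Y. \<forall>y\<in>mspace Y. mdist Y (f x) (f y) = mdist Y x y}\<rparr>"

lemma group_isometry_group: "group (isometry_group Y)"
proof -
  let ?I = "{f \<in> Bij (mspace Y).
        \<forall>x\<in>mspace Y. \<forall>y\<in>mspace Y. mdist Y (f x) (f y) = mdist Y x y}"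
  have bij: "bij_betw f (mspace Y) (mspace Y)" if "f \<in> Bij (mspace Y)" for f
    using that by (simp add: Bij_def)
  have "subgroup ?I (BijGroup (mspace Y))"
  proof (rule group.subgroupI[OF group_BijGroup])
    show "?I \<subseteq> carrier (BijGroup (mspace Y))" by (auto simp: BijGroup_def)
    show "?I \<noteq> {}" using id_Bij[of "mspace Y"] by force
  next
    fix f assume f: "f \<in> ?I"
    then have *: "inv_into (mspace Y) f x \<in> mspace Y" "f (inv_into (mspace Y) f x) = x"
      if "x \<in> mspace Y" for x
      using that bij[of f] by (auto simp: Bij_inv_into_mem bij_betw_inv_into_right)
    have "mdist Y (inv_into (mspace Y) f x) (inv_into (mspace Y) f y) = mdist Y x y"
      if "x \<in> mspace Y" "y \<in> mspace Y" for x y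
      using f *[OF that(1)] *[OF that(2)] by force
    then show "inv\<^bsub>BijGroup (mspace Y)\<^esub> f \<in> ?I"
      using f by (auto simp: inv_BijGroup restrict_inv_into_Bij)
  next
    fix f g assume fg: "f \<in> ?I" "g \<in> ?I"
    then have "g x \<in> mspace Y" if "x \<in> mspace Y" for x
      using that Bij_imp_funcset by fastforce
    moreover have "compose (mspace Y) f g \<in> Bij (mspace Y)"
      using fg by (simp add: compose_Bij)
    ultimately show "f \<otimes>\<^bsub>BijGroup (mspace Y)\<^esub> g \<in> ?I"
      using fg by (auto simp: BijGroup_def compose_eq)
  qed
  from group.subgroup_imp_group[OF group_BijGroup this] show ?thesis
    by (simp add: isometry_group_def)
qed

definition is_axis :: "'a metric \<Rightarrow> ('a \<Rightarrow> 'a) \<Rightarrow> (real \<Rightarrow> 'a) \<Rightarrow> bool" where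
  "is_axis Y h \<sigma> \<longleftrightarrow> geodesic_on Y UNIV \<sigma> \<and> (\<exists>l>0. \<forall>t. h (\<sigma> t) = \<sigma> (t + l))"

definition axial :: "'a metric \<Rightarrow> ('a \<Rightarrow> 'a) \<Rightarrow> bool" where
  "axial Y h \<longleftrightarrow> h \<in> carrier (isometry_group Y) \<and> (\<exists>\<sigma>. is_axis Y h \<sigma>)"

text \<open>The points \<open>h\<^sup>+\<close> and \<open>h\<^sup>-\<close> of an axial isometry; all axes of \<open>h\<close> are parallel, so they
  do not depend on the axis.\<close>

definition attracting_point :: "'a metric \<Rightarrow> ('a \<Rightarrow> 'a) \<Rightarrow> (real \<Rightarrow> 'a) set" where
  "attracting_point Y h = (THE \<xi>. \<exists>\<sigma>. is_axis Y h \<sigma> \<and> \<xi> = boundary_point Y \<sigma>)"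

definition repelling_point :: "'a metric \<Rightarrow> ('a \<Rightarrow> 'a) \<Rightarrow> (real \<Rightarrow> 'a) set" where
  "repelling_point Y h = (THE \<xi>. \<exists>\<sigma>. is_axis Y h \<sigma> \<and> \<xi> = boundary_point Y (\<lambda>t. \<sigma> (- t)))"

definition rank_one :: "'a metric \<Rightarrow> ('a \<Rightarrow> 'a) \<Rightarrow> bool" where
  "rank_one Y h \<longleftrightarrow> axial Y h \<and> (\<exists>\<sigma>. is_axis Y h \<sigma> \<and> \<not> bounds_flat_half_plane Y \<sigma>)"

definition independent_rank_one :: "'a metric \<Rightarrow> ('a \<Rightarrow> 'a) \<Rightarrow> ('a \<Rightarrow> 'a) \<Rightarrow> bool" where
  "independent_rank_one Y g h \<longleftrightarrow>
     rank_one Y g \<and> rank_one Y h \<and>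
     {attracting_point Y g, repelling_point Y g} \<inter> {attracting_point Y h, repelling_point Y h} = {}"


section \<open>Products\<close>

text \<open>The factors are \<open>X i\<close> for \<open>i\<close> in a finite type \<open>'i\<close> of cardinality \<open>r\<close>. Letting them live on
  one common point type \<open>'a\<close> is no restriction.\<close>

definition product_metric :: "('i::finite \<Rightarrow> 'a metric) \<Rightarrow> ('i \<Rightarrow> 'a) metric" where
  "product_metric X = metric
     ({x. \<forall>i. x i \<in> mspace (X i)}, \<lambda>x z. sqrt (\<Sum>i\<in>UNIV. (mdist (X i) (x i) (z i))\<^sup>2))"

lemma Metric_space_product_metric:
  fixes X :: "'i::finite \<Rightarrow> 'a metric"
  shows "Metric_space {x. \<forall>i. x i \<in> mspace (X i)}
           (\<lambda>x z. sqrt (\<Sum>i\<in>UNIV. (mdist (X i) (x i) (z i))\<^sup>2))"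
proof
  fix x y :: "'i \<Rightarrow> 'a"
  show "0 \<le> sqrt (\<Sum>i\<in>UNIV. (mdist (X i) (x i) (y i))\<^sup>2)"
    by (simp add: sum_nonneg)
  show "sqrt (\<Sum>i\<in>UNIV. (mdist (X i) (x i) (y i))\<^sup>2) = sqrt (\<Sum>i\<in>UNIV. (mdist (X i) (y i) (x i))\<^sup>2)"
    by (simp add: mdist_commute)
next
  fix x y assume "x \<in> {x. \<forall>i. x i \<in> mspace (X i)}" "y \<in> {x. \<forall>i. x i \<in> mspace (X i)}"
  then show "sqrt (\<Sum>i\<in>UNIV. (mdist (X i) (x i) (y i))\<^sup>2) = 0 \<longleftrightarrow> x = y"
    by (auto simp: sum_nonneg_eq_0_iff fun_eq_iff)
next
  fix x y z assume *: "x \<in> {x. \<forall>i. x i \<in> mspace (X i)}" "y \<in> {x. \<forall>i. x i \<in> mspace (X i)}"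
    "z \<in> {x. \<forall>i. x i \<in> mspace (X i)}"
  have "L2_set (\<lambda>i. mdist (X i) (x i) (z i)) UNIV
      \<le> L2_set (\<lambda>i. mdist (X i) (x i) (y i) + mdist (X i) (y i) (z i)) UNIV"
    using * by (intro L2_set_mono) (auto intro: mdist_triangle)
  also note L2_set_triangle_ineq
  finally show "sqrt (\<Sum>i\<in>UNIV. (mdist (X i) (x i) (z i))\<^sup>2)
     \<le> sqrt (\<Sum>i\<in>UNIV. (mdist (X i) (x i) (y i))\<^sup>2) + sqrt (\<Sum>i\<in>UNIV. (mdist (X i) (y i) (z i))\<^sup>2)"
    by (simp add: L2_set_def)
qed

lemma mspace_product_metric: "mspace (product_metric X) = {x. \<forall>i. x i \<in> mspace (X i)}"
  by (simp add: product_metric_def Metric_space.mspace_metric[OF Metric_space_product_metric])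

lemma mdist_product_metric:
  "mdist (product_metric X) x z = sqrt (\<Sum>i\<in>UNIV. (mdist (X i) (x i) (z i))\<^sup>2)"
  by (simp add: product_metric_def Metric_space.mdist_metric[OF Metric_space_product_metric])

definition act :: "('i \<Rightarrow> 'a \<Rightarrow> 'a) \<Rightarrow> ('i \<Rightarrow> 'a) \<Rightarrow> 'i \<Rightarrow> 'a" where
  "act \<gamma> x = (\<lambda>i. \<gamma> i (x i))"

definition properly_discontinuous ::
    "('i::finite \<Rightarrow> 'a metric) \<Rightarrow> ('i \<Rightarrow> 'a \<Rightarrow> 'a) set \<Rightarrow> bool" where
  "properly_discontinuous X \<Gamma> \<longleftrightarrow>
     (\<forall>K. compactin (mtopology_of (product_metric X)) K \<longrightarrow>
        finite {\<gamma>\<in>\<Gamma>. act \<gamma> ` K \<inter> K \<noteq> {}})"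

definition regular_axial :: "('i \<Rightarrow> 'a metric) \<Rightarrow> ('i \<Rightarrow> 'a \<Rightarrow> 'a) \<Rightarrow> bool" where
  "regular_axial X h \<longleftrightarrow> (\<forall>i. rank_one (X i) (h i))"

definition independent_regular_axial ::
    "('i \<Rightarrow> 'a metric) \<Rightarrow> ('i \<Rightarrow> 'a \<Rightarrow> 'a) \<Rightarrow> ('i \<Rightarrow> 'a \<Rightarrow> 'a) \<Rightarrow> bool" where
  "independent_regular_axial X g h \<longleftrightarrow>
     regular_axial X g \<and> regular_axial X h \<and> (\<forall>i. independent_rank_one (X i) (g i) (h i))"


section \<open>Critical exponents\<close>

text \<open>The exponent of \<open>\<Sum>g\<in>A. e\<^bsup>-s f(g)\<^esup>\<close>, with values in \<open>[-\<infinity>,\<infinity>]\<close>: it is \<open>-\<infinity>\<close> if the series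
  converges for all real \<open>s\<close>, and \<open>\<infinity>\<close> if it diverges for all real \<open>s\<close>. The last case does occur
  for groups acting properly discontinuously on a locally compact Hadamard space.\<close>

definition critical_exponent :: "('g \<Rightarrow> real) \<Rightarrow> 'g set \<Rightarrow> ereal" where
  "critical_exponent f A = (THE e. \<forall>s::real.
     (ereal s > e \<longrightarrow> (\<lambda>g. exp (- s * f g)) summable_on A) \<and>
     (ereal s < e \<longrightarrow> \<not> (\<lambda>g. exp (- s * f g)) summable_on A))"

lemma critical_exponent_eq_Inf:
  assumes nonneg: "\<And>g. g \<in> A \<Longrightarrow> 0 \<le> f g"
  shows "critical_exponent f A = Inf {ereal s | s. (\<lambda>g. exp (- s * f g)) summable_on A}"
proof -
  let ?S = "\<lambda>s. (\<lambda>g. exp (- s * f g)) summable_on A"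
  have mono: "?S t" if "?S s" "s \<le> t" for s t
    using that(1)
    by (rule summable_on_comparison_test) (use nonneg that(2) in \<open>auto intro: mult_right_mono\<close>)
  show ?thesis
    unfolding critical_exponent_def
  proof (rule the_equality, intro allI conjI impI)
    fix s assume "ereal s > Inf {ereal s | s. ?S s}"
    then show "?S s" using mono by (force simp: Inf_less_iff)
  next
    fix s assume "ereal s < Inf {ereal s | s. ?S s}"
    then show "\<not> ?S s" using Inf_lower[of "ereal s" "{ereal s | s. ?S s}"] by (auto simp: not_less)
  next
    fix e :: ereal assume e: "\<forall>s::real. (ereal s > e \<longrightarrow> ?S s) \<and> (ereal s < e \<longrightarrow> \<not> ?S s)"
    show "e = Inf {ereal s | s. ?S s}"
    proof (rule antisym)
      show "e \<le> Inf {ereal s | s. ?S s}" using e by (force intro!: Inf_greatest simp: not_less[symmetric])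
      show "Inf {ereal s | s. ?S s} \<le> e"
      proof (rule ccontr)
        assume "\<not> ?thesis"
        then obtain s where "e < ereal s" "ereal s < Inf {ereal s | s. ?S s}"
          using ereal_dense2[of e] by (auto simp: not_le)
        then show False using e Inf_lower[of "ereal s" "{ereal s | s. ?S s}"] by (auto simp: not_less)
      qed
    qed
  qed
qed

definition directions :: "(real^'i) set" where
  "directions = {\<theta>. (\<forall>i. \<theta> $ i \<ge> 0) \<and> norm \<theta> = 1}"

definition direction :: "('i::finite \<Rightarrow> 'a metric) \<Rightarrow> ('i \<Rightarrow> 'a) \<Rightarrow> ('i \<Rightarrow> 'a) \<Rightarrow> real^'i" where
  "direction X x z =
     (1 / mdist (product_metric X) x z) *\<^sub>R (\<chi> i. mdist (X i) (x i) (z i))"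

definition elements_in_direction ::
    "('i::finite \<Rightarrow> 'a metric) \<Rightarrow> ('i \<Rightarrow> 'a \<Rightarrow> 'a) set \<Rightarrow> ('i \<Rightarrow> 'a) \<Rightarrow> real^'i \<Rightarrow> real
      \<Rightarrow> ('i \<Rightarrow> 'a \<Rightarrow> 'a) set" where
  "elements_in_direction X \<Gamma> p \<theta> \<epsilon> =
     {\<gamma>\<in>\<Gamma>. act \<gamma> p \<noteq> p \<and> norm (direction X p (act \<gamma> p) - \<theta>) < \<epsilon>}"

definition delta :: "('i::finite \<Rightarrow> 'a metric) \<Rightarrow> ('i \<Rightarrow> 'a \<Rightarrow> 'a) set \<Rightarrow> ('i \<Rightarrow> 'a) \<Rightarrow> ereal" where
  "delta X \<Gamma> p = critical_exponent (\<lambda>\<gamma>. mdist (product_metric X) p (act \<gamma> p)) \<Gamma>"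

definition delta_dir_eps ::
    "('i::finite \<Rightarrow> 'a metric) \<Rightarrow> ('i \<Rightarrow> 'a \<Rightarrow> 'a) set \<Rightarrow> ('i \<Rightarrow> 'a) \<Rightarrow> real^'i \<Rightarrow> real \<Rightarrow> ereal" where
  "delta_dir_eps X \<Gamma> p \<theta> \<epsilon> = critical_exponent
     (\<lambda>\<gamma>. mdist (product_metric X) p (act \<gamma> p)) (elements_in_direction X \<Gamma> p \<theta> \<epsilon>)"

definition delta_dir ::
    "('i::finite \<Rightarrow> 'a metric) \<Rightarrow> ('i \<Rightarrow> 'a \<Rightarrow> 'a) set \<Rightarrow> ('i \<Rightarrow> 'a) \<Rightarrow> real^'i \<Rightarrow> ereal" where
  "delta_dir X \<Gamma> p \<theta> = Lim (at_right 0) (delta_dir_eps X \<Gamma> p \<theta>)"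

lemma delta_dir_eps_mono:
  assumes "\<epsilon> \<le> \<epsilon>'"
  shows "delta_dir_eps X \<Gamma> p \<theta> \<epsilon> \<le> delta_dir_eps X \<Gamma> p \<theta> \<epsilon>'"
proof -
  have "elements_in_direction X \<Gamma> p \<theta> \<epsilon> \<subseteq> elements_in_direction X \<Gamma> p \<theta> \<epsilon>'"
    using assms by (auto simp: elements_in_direction_def)
  then show ?thesis
    unfolding delta_dir_eps_def
    by (subst (1 2) critical_exponent_eq_Inf)
       (auto intro!: Inf_superset_mono intro: summable_on_subset_banach)
qed

lemma delta_dir_eq_INF: "delta_dir X \<Gamma> p \<theta> = (INF \<epsilon>\<in>{0<..}. delta_dir_eps X \<Gamma> p \<theta> \<epsilon>)"
  unfolding delta_dir_def
proof (rule tendsto_Lim[OF trivial_limit_at_right_real decreasing_tendsto])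
  show "\<forall>\<^sub>F \<epsilon> in at_right 0.
      (INF \<epsilon>\<in>{0<..}. delta_dir_eps X \<Gamma> p \<theta> \<epsilon>) \<le> delta_dir_eps X \<Gamma> p \<theta> \<epsilon>"
    by (auto simp: eventually_at_right_field intro!: exI[of _ 1] INF_lower)
next
  fix e assume "(INF \<epsilon>\<in>{0<..}. delta_dir_eps X \<Gamma> p \<theta> \<epsilon>) < e"
  then obtain \<epsilon> where "\<epsilon> > 0" "delta_dir_eps X \<Gamma> p \<theta> \<epsilon> < e"
    by (auto simp: INF_less_iff)
  then show "\<forall>\<^sub>F \<epsilon> in at_right 0. delta_dir_eps X \<Gamma> p \<theta> \<epsilon> < e"
    unfolding eventually_at_right_field
    by (meson delta_dir_eps_mono le_less_trans less_imp_le)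
qed

end

theory Submission
  imports Defs
begin

text \<open>
  A rank one axis bounds no flat half-plane, and by a limiting argument no large almost flat
  rectangle either; hence it is contracting: a geodesic whose end points project far apart on the
  axis passes close to the axis in between. Conjugating one of the two given elements by powers of
  the other yields arbitrarily many elements whose axes project boundedly on each other in every
  factor. A geodesic starting at the base point can follow at most one of these axes for long, so
  powers of finitely many of them can be inserted between any two elements \<open>\<gamma>\<^sub>1\<close>, \<open>\<gamma>\<^sub>2\<close> of the group such
  that all displacements \<open>d\<^sub>i(o\<^sub>i, \<gamma> o\<^sub>i)\<close> add up to a bounded error, while \<open>\<gamma>\<^sub>1 o\<close> stays close to the
  geodesics from \<open>o\<^sub>i\<close> to the image under the product. So \<open>\<gamma>\<^sub>1\<close> is recovered from the product up to bounded
  multiplicity, and iterated products are counted from below. This gives exponential growth,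
  hence \<open>\<delta> > 0\<close>. If two directions \<open>\<theta>\<^sub>1 \<noteq> \<theta>\<^sub>2\<close> both had exponent \<open>\<delta>\<close>, products of equally long
  elements in the two directions would grow with exponent \<open>2 \<delta> / \<parallel>\<theta>\<^sub>1 + \<theta>\<^sub>2\<parallel> > \<delta>\<close>. Existence is
  compactness of the set of directions.
\<close>

section \<open>CAT(0) inequalities\<close>

text \<open>One group element has to serve all factors at once, although the geodesics in different
  factors are unrelated. This is why more than two independent axes are used, and why each product
  costs a factor \<open>card A\<close> in number and an additive \<open>err\<close> in length, both
  independent of the elements multiplied. A fixed loss is harmless only against large pieces. For
  positivity the pieces outnumber \<open>card A\<close>; for the directions they come from far
  shells, where \<open>err\<close> is small against the length and the loss is small against the
  exponential count. Only lower bounds of counts enter, and divergence guarantees rich shells only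
  at sizes that cannot be prescribed. Pieces in two directions therefore have unrelated sizes, and
  the numbers of copies must balance them. Uniqueness is stated for a finite exponent: the
  contradiction rests on \<open>2 * \<delta> / w > \<delta>\<close> for \<open>w < 2\<close>, which
  says nothing at infinity.\<close>

definition geo_pt :: "'a metric \<Rightarrow> 'a \<Rightarrow> 'a \<Rightarrow> real \<Rightarrow> 'a" where
  "geo_pt Y x y \<tau> = (SOME c. geodesic_between Y x y c) (\<tau> * mdist Y x y)"

lemma comparison_triangle_exists:
  fixes a b c :: real
  assumes "0 \<le> a" "0 \<le> b" "0 \<le> c" "c \<le> a + b" "a \<le> b + c" "b \<le> a + c"
  shows "\<exists>x y z::real^2. dist x y = a \<and> dist y z = c \<and> dist x z = b"
proof (cases "a = 0")
  case True
  then have "b = c" using assms by auto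
  obtain z :: "real^2" where "dist 0 z = b" using vector_choose_dist[OF assms(2)] by metis
  then have "dist 0 (0::real^2) = a \<and> dist 0 z = c \<and> dist 0 z = b" using True \<open>b = c\<close> by simp
  then show ?thesis by blast
next
  case False
  then have a: "a > 0" using assms by auto
  \<comment> \<open>Law of cosines: with \<open>x\<close> at the origin and \<open>y\<close> at
    \<open>(a, 0)\<close> this is the first coordinate of \<open>z\<close>.\<close>
  define u where "u = (a\<^sup>2 + b\<^sup>2 - c\<^sup>2) / (2 * a)"
  have ua: "2 * a * u = a\<^sup>2 + b\<^sup>2 - c\<^sup>2" using a by (simp add: u_def)
  have "(a - b)\<^sup>2 \<le> c\<^sup>2" using assms by (intro abs_le_square_iff[THEN iffD1]) auto
  then have 1: "a * u \<le> a * b" using ua by (simp add: power2_eq_square algebra_simps)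
  have "c\<^sup>2 \<le> (a + b)\<^sup>2" using assms by (intro power_mono) auto
  then have 2: "a * (- b) \<le> a * u" using ua by (simp add: power2_eq_square algebra_simps)
  have "\<bar>u\<bar> \<le> \<bar>b\<bar>" using 1 2 a assms by (simp only: mult_le_cancel_left_pos abs_le_iff) auto
  then have v: "0 \<le> b\<^sup>2 - u\<^sup>2" by (simp add: abs_le_square_iff)
  let ?x = "vector [0, 0] :: real^2" and ?y = "vector [a, 0] :: real^2"
    and ?z = "vector [u, sqrt (b\<^sup>2 - u\<^sup>2)] :: real^2"
  have "dist ?x ?y = a" "dist ?x ?z = b"
    using v assms by (auto simp: dist_vec_def L2_set_def sum_2 dist_real_def)
  moreover have "(a - u)\<^sup>2 + (b\<^sup>2 - u\<^sup>2) = c\<^sup>2" using ua by (simp add: power2_eq_square algebra_simps)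
  then have "dist ?y ?z = c"
    using v assms by (auto simp: dist_vec_def L2_set_def sum_2 dist_real_def)
  ultimately show ?thesis by blast
qed

text \<open>Stewart's theorem for the comparison triangle; its right-hand side becomes that of
  \<open>CN\<close>.\<close>

lemma dist_segment_point_eq:
  fixes x y z :: "'b::real_inner"
  shows "(dist ((1 - \<tau>) *\<^sub>R x + \<tau> *\<^sub>R y) z)\<^sup>2
     = (1 - \<tau>) * (dist x z)\<^sup>2 + \<tau> * (dist y z)\<^sup>2 - \<tau> * (1 - \<tau>) * (dist x y)\<^sup>2"
  by (simp add: dist_norm power2_norm_eq_inner inner_diff_left inner_diff_right inner_add_left
      inner_add_right inner_commute algebra_simps)

lemma mdist_self [simp]: "x \<in> mspace Y \<Longrightarrow> mdist Y x x = 0"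
  by simp

locale hadamard =
  fixes Y :: "'a metric"
  assumes had: "hadamard_space Y"
begin

abbreviation "M \<equiv> mspace Y"
abbreviation "d \<equiv> mdist Y"
abbreviation "pt \<equiv> geo_pt Y"

lemma geo_pt_geodesic:
  assumes "x \<in> M" "y \<in> M"
  obtains c where "geodesic_between Y x y c" "\<And>\<tau>. pt x y \<tau> = c (\<tau> * d x y)"
proof -
  have "\<exists>c. geodesic_between Y x y c" using had assms by (auto simp: hadamard_space_def cat0_def)
  then have "geodesic_between Y x y (SOME c. geodesic_between Y x y c)" by (rule someI_ex)
  then show thesis using that by (auto simp: geo_pt_def)
qed

lemma pt_dist:
  assumes "x \<in> M" "y \<in> M" "\<tau> \<in> {0..1}" "\<tau>' \<in> {0..1}"
  shows "d (pt x y \<tau>) (pt x y \<tau>') = \<bar>\<tau> - \<tau>'\<bar> * d x y"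
proof -
  obtain c where c: "geodesic_between Y x y c" "\<And>\<tau>. pt x y \<tau> = c (\<tau> * d x y)"
    using geo_pt_geodesic assms by blast
  have "\<tau> * d x y \<in> {0..d x y}" "\<tau>' * d x y \<in> {0..d x y}"
    using assms by (auto simp: mult_left_le_one_le)
  then have "d (pt x y \<tau>) (pt x y \<tau>') = \<bar>\<tau> * d x y - \<tau>' * d x y\<bar>"
    using c by (simp add: geodesic_between_def geodesic_on_def)
  also have "\<dots> = \<bar>\<tau> - \<tau>'\<bar> * d x y"
    by (metis abs_mult abs_of_nonneg left_diff_distrib mdist_nonneg)
  finally show ?thesis .
qed

lemma pt_0 [simp]: "x \<in> M \<Longrightarrow> y \<in> M \<Longrightarrow> pt x y 0 = x"
  by (rule geo_pt_geodesic[of x y]) (auto simp: geodesic_between_def)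

lemma pt_1 [simp]: "x \<in> M \<Longrightarrow> y \<in> M \<Longrightarrow> pt x y 1 = y"
  by (rule geo_pt_geodesic[of x y]) (auto simp: geodesic_between_def)

lemma pt_in [simp, intro]:
  assumes "x \<in> M" "y \<in> M" "0 \<le> \<tau>" "\<tau> \<le> 1"
  shows "pt x y \<tau> \<in> M"
proof -
  obtain c where c: "geodesic_between Y x y c" "\<And>\<tau>. pt x y \<tau> = c (\<tau> * d x y)"
    using geo_pt_geodesic assms by blast
  have "\<tau> * d x y \<in> {0..d x y}" using assms by (auto simp: mult_left_le_one_le)
  then show ?thesis using c by (auto simp: geodesic_between_def geodesic_on_def)
qed

lemma pt_dist_left: "x \<in> M \<Longrightarrow> y \<in> M \<Longrightarrow> 0 \<le> \<tau> \<Longrightarrow> \<tau> \<le> 1 \<Longrightarrow> d x (pt x y \<tau>) = \<tau> * d x y"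
  using pt_dist[of x y 0 \<tau>] by simp

lemma pt_dist_right: "x \<in> M \<Longrightarrow> y \<in> M \<Longrightarrow> 0 \<le> \<tau> \<Longrightarrow> \<tau> \<le> 1 \<Longrightarrow> d (pt x y \<tau>) y = (1 - \<tau>) * d x y"
  using pt_dist[of x y \<tau> 1] by simp

text \<open>The Bruhat-Tits inequality with arbitrary ratio: one of the two compared points is the
  vertex \<open>p\<close>, seen as the far end of the side from \<open>x\<close> to
  \<open>p\<close>. All later use of CAT(0) comparison goes through this inequality.\<close>

lemma CN:
  assumes M: "x \<in> M" "y \<in> M" "p \<in> M" and t: "0 \<le> \<tau>" "\<tau> \<le> 1"
  shows "(d p (pt x y \<tau>))\<^sup>2 \<le> (1 - \<tau>) * (d p x)\<^sup>2 + \<tau> * (d p y)\<^sup>2 - \<tau> * (1 - \<tau>) * (d x y)\<^sup>2"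
proof -
  obtain b where b: "geodesic_between Y x y b" "\<And>\<tau>. pt x y \<tau> = b (\<tau> * d x y)"
    using geo_pt_geodesic M by blast
  obtain c where c: "geodesic_between Y x p c" "\<And>\<tau>. pt x p \<tau> = c (\<tau> * d x p)"
    using geo_pt_geodesic M by blast
  obtain x' y' z' :: "real^2" where e: "dist x' y' = d x y" "dist y' z' = d y p" "dist x' z' = d x p"
    using comparison_triangle_exists[of "d x y" "d x p" "d y p"]
      mdist_triangle[of x Y p y] mdist_triangle[of y Y x p] mdist_triangle[of x Y y p] M
    by (auto simp: mdist_commute)
  let ?p' = "(1 - \<tau>) *\<^sub>R x' + \<tau> *\<^sub>R y'"
  have seg: "?p' \<in> closed_segment x' y'" using t by (auto simp: closed_segment_def)
  have dp: "dist x' ?p' = \<tau> * d x y"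
  proof -
    have "x' - ?p' = \<tau> *\<^sub>R (x' - y')" by (simp add: algebra_simps)
    then show ?thesis using t e by (simp add: dist_norm)
  qed
  have "\<tau> * d x y \<in> {0..d x y}" using t by (auto simp: mult_left_le_one_le)
  moreover have "d x p \<in> {0..d x p}" by simp
  ultimately have "d (b (\<tau> * d x y)) (c (d x p)) \<le> dist ?p' z'"
    using had e M b(1) c(1) seg dp unfolding hadamard_space_def cat0_def
    by (meson ends_in_segment(2))
  moreover have "c (d x p) = p" using c by (simp add: geodesic_between_def)
  ultimately have "d p (pt x y \<tau>) \<le> dist ?p' z'" by (simp add: b mdist_commute)
  then have "(d p (pt x y \<tau>))\<^sup>2 \<le> (dist ?p' z')\<^sup>2" by (intro power_mono) auto
  also have "\<dots> = (1 - \<tau>) * (d p x)\<^sup>2 + \<tau> * (d p y)\<^sup>2 - \<tau> * (1 - \<tau>) * (d x y)\<^sup>2"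
    unfolding dist_segment_point_eq using e by (simp add: mdist_commute)
  finally show ?thesis .
qed

text \<open>The two bounds make the right-hand side of \<open>CN\<close> vanish. This is uniqueness
  of geodesics and makes the choice in \<open>geo_pt\<close> immaterial; identities between points
  of segments reduce to two distance estimates.\<close>

lemma pt_unique:
  assumes M: "x \<in> M" "y \<in> M" "z \<in> M" and t: "0 \<le> \<tau>" "\<tau> \<le> 1"
    and z: "d x z \<le> \<tau> * d x y" "d z y \<le> (1 - \<tau>) * d x y"
  shows "z = pt x y \<tau>"
proof -
  have "(d z x)\<^sup>2 \<le> (\<tau> * d x y)\<^sup>2" "(d z y)\<^sup>2 \<le> ((1 - \<tau>) * d x y)\<^sup>2"
    using z by (auto intro!: power_mono simp: mdist_commute)
  then have "(d z (pt x y \<tau>))\<^sup>2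
      \<le> (1 - \<tau>) * (\<tau> * d x y)\<^sup>2 + \<tau> * ((1 - \<tau>) * d x y)\<^sup>2 - \<tau> * (1 - \<tau>) * (d x y)\<^sup>2"
    using t by (intro order_trans[OF CN[OF M t]] diff_mono add_mono mult_left_mono) auto
  also have "\<dots> = 0" by (simp add: power2_eq_square algebra_simps)
  finally have "d z (pt x y \<tau>) = 0" by simp
  then show ?thesis using M t by simp
qed

lemma pt_swap:
  assumes "x \<in> M" "y \<in> M" "0 \<le> \<tau>" "\<tau> \<le> 1"
  shows "pt y x (1 - \<tau>) = pt x y \<tau>"
proof (rule pt_unique)
  show "d x (pt y x (1 - \<tau>)) \<le> \<tau> * d x y"
    using pt_dist_right[of y x "1 - \<tau>"] assms by (simp add: mdist_commute)
  show "d (pt y x (1 - \<tau>)) y \<le> (1 - \<tau>) * d x y"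
    using pt_dist_left[of y x "1 - \<tau>"] assms by (simp add: mdist_commute)
qed (use assms in auto)

text \<open>\<open>CN\<close> is applied to the side from \<open>x\<close> to \<open>z\<close> and
  then to the side from \<open>x\<close> to \<open>y\<close>; the squares of these sides
  cancel.\<close>

lemma pt_convex_vertex:
  assumes M: "x \<in> M" "y \<in> M" "z \<in> M" and t: "0 \<le> \<tau>" "\<tau> \<le> 1"
  shows "d (pt x y \<tau>) (pt x z \<tau>) \<le> \<tau> * d y z"
proof (rule power2_le_imp_le)
  let ?u = "pt x y \<tau>"
  have u: "?u \<in> M" using M t by auto
  have "(d ?u (pt x z \<tau>))\<^sup>2 \<le> (1 - \<tau>) * (d ?u x)\<^sup>2 + \<tau> * (d ?u z)\<^sup>2 - \<tau> * (1 - \<tau>) * (d x z)\<^sup>2"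
    using CN[OF M(1) M(3) u t] .
  also have "\<dots> \<le> (1 - \<tau>) * (\<tau> * d x y)\<^sup>2
      + \<tau> * ((1 - \<tau>) * (d z x)\<^sup>2 + \<tau> * (d z y)\<^sup>2 - \<tau> * (1 - \<tau>) * (d x y)\<^sup>2) - \<tau> * (1 - \<tau>) * (d x z)\<^sup>2"
    using CN[OF M t] pt_dist_left[OF M(1,2) t] t
    by (intro diff_mono add_mono mult_left_mono) (auto simp: mdist_commute)
  also have "\<dots> = (\<tau> * d y z)\<^sup>2" by (simp add: power2_eq_square algebra_simps mdist_commute)
  finally show "(d ?u (pt x z \<tau>))\<^sup>2 \<le> (\<tau> * d y z)\<^sup>2" .
qed (use t in auto)

text \<open>Convexity of the metric: the quadrilateral is cut along the diagonal from
  \<open>x\<close> to \<open>y'\<close> into two triangles.\<close>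

lemma pt_convex:
  assumes M: "x \<in> M" "y \<in> M" "x' \<in> M" "y' \<in> M" and t: "0 \<le> \<tau>" "\<tau> \<le> 1"
  shows "d (pt x y \<tau>) (pt x' y' \<tau>) \<le> (1 - \<tau>) * d x x' + \<tau> * d y y'"
proof -
  have "d (pt x y \<tau>) (pt x' y' \<tau>) \<le> d (pt x y \<tau>) (pt x y' \<tau>) + d (pt x y' \<tau>) (pt x' y' \<tau>)"
    using M t by (intro mdist_triangle) auto
  also have "d (pt x y \<tau>) (pt x y' \<tau>) \<le> \<tau> * d y y'"
    using pt_convex_vertex M t by auto
  also have "d (pt x y' \<tau>) (pt x' y' \<tau>) \<le> (1 - \<tau>) * d x x'"
    using pt_convex_vertex[of y' x x' "1 - \<tau>"] M t by (simp add: pt_swap)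
  finally show ?thesis by simp
qed

text \<open>\<open>CN\<close> bounds the distances of \<open>b\<close> and \<open>e\<close> to the
  midpoint of the other diagonal, and these two distances add up to at least
  \<open>d b e\<close>.\<close>

lemma quadrilateral:
  assumes M: "a \<in> M" "b \<in> M" "c \<in> M" "e \<in> M"
  shows "(d a c)\<^sup>2 + (d b e)\<^sup>2 \<le> (d a b)\<^sup>2 + (d b c)\<^sup>2 + (d c e)\<^sup>2 + (d e a)\<^sup>2"
proof -
  let ?m = "pt a c (1/2)"
  have m: "?m \<in> M" using M by auto
  have 1: "(d b ?m)\<^sup>2 \<le> (1/2) * (d b a)\<^sup>2 + (1/2) * (d b c)\<^sup>2 - (1/4) * (d a c)\<^sup>2"
    using CN[of a c b "1/2"] M by simp
  have 2: "(d e ?m)\<^sup>2 \<le> (1/2) * (d e a)\<^sup>2 + (1/2) * (d e c)\<^sup>2 - (1/4) * (d a c)\<^sup>2"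
    using CN[of a c e "1/2"] M by simp
  have "d b e \<le> d b ?m + d e ?m" using mdist_triangle[of b Y ?m e] M m by (simp add: mdist_commute)
  then have "(d b e)\<^sup>2 \<le> (d b ?m + d e ?m)\<^sup>2" by (intro power_mono) auto
  also have "\<dots> \<le> 2 * (d b ?m)\<^sup>2 + 2 * (d e ?m)\<^sup>2"
    using sum_squares_bound[of "d b ?m" "d e ?m"] by (simp add: power2_eq_square algebra_simps)
  also have "\<dots> \<le> (d b a)\<^sup>2 + (d b c)\<^sup>2 + (d e a)\<^sup>2 + (d e c)\<^sup>2 - (d a c)\<^sup>2" using 1 2 by simp
  finally show ?thesis by (simp add: mdist_commute)
qed

lemma pt_geodesic:
  assumes "x \<in> M" "y \<in> M" "geodesic_between Y x y c" "0 \<le> \<tau>" "\<tau> \<le> 1"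
  shows "c (\<tau> * d x y) = pt x y \<tau>"
proof (rule pt_unique)
  have t: "\<tau> * d x y \<in> {0..d x y}" using assms by (auto simp: mult_left_le_one_le)
  have 0: "0 \<in> {0..d x y}" "d x y \<in> {0..d x y}" by auto
  have g: "\<And>s t. s \<in> {0..d x y} \<Longrightarrow> t \<in> {0..d x y} \<Longrightarrow> d (c s) (c t) = \<bar>s - t\<bar>"
    and im: "c ` {0..d x y} \<subseteq> M" and e: "c 0 = x" "c (d x y) = y"
    using assms(3) by (auto simp: geodesic_between_def geodesic_on_def)
  show "c (\<tau> * d x y) \<in> M" using im t by blast
  show "d x (c (\<tau> * d x y)) \<le> \<tau> * d x y" using g[OF 0(1) t] e assms by simp
  show "d (c (\<tau> * d x y)) y \<le> (1 - \<tau>) * d x y" using g[OF t 0(2)] e t by (simp add: algebra_simps)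
qed (use assms in auto)

lemma pt_reparam:
  assumes "x \<in> M" "y \<in> M" "\<alpha> \<in> {0..1}" "\<beta> \<in> {0..1}" "\<alpha> \<le> \<beta>" "0 \<le> \<tau>" "\<tau> \<le> 1"
  shows "pt (pt x y \<alpha>) (pt x y \<beta>) \<tau> = pt x y ((1 - \<tau>) * \<alpha> + \<tau> * \<beta>)"
proof (rule sym, rule pt_unique)
  let ?g = "(1 - \<tau>) * \<alpha> + \<tau> * \<beta>"
  have g: "?g \<in> {0..1}"
  proof -
    have "?g \<le> (1 - \<tau>) * 1 + \<tau> * 1" using assms by (intro add_mono mult_left_mono) auto
    then show ?thesis using assms by auto
  qed
  show "pt x y ?g \<in> M" using g assms by auto
  have a: "?g - \<alpha> = \<tau> * (\<beta> - \<alpha>)" and b: "\<beta> - ?g = (1 - \<tau>) * (\<beta> - \<alpha>)" by (auto simp: algebra_simps)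
  have pos: "0 \<le> \<tau> * (\<beta> - \<alpha>)" "0 \<le> (1 - \<tau>) * (\<beta> - \<alpha>)" using assms by auto
  have ab: "d (pt x y \<alpha>) (pt x y \<beta>) = (\<beta> - \<alpha>) * d x y"
    using pt_dist[of x y \<alpha> \<beta>] assms by simp
  have "d (pt x y \<alpha>) (pt x y ?g) = (?g - \<alpha>) * d x y"
    using pt_dist[of x y \<alpha> ?g] assms g pos a by (smt (verit))
  then show "d (pt x y \<alpha>) (pt x y ?g) \<le> \<tau> * d (pt x y \<alpha>) (pt x y \<beta>)"
    unfolding ab a by simp
  have "d (pt x y ?g) (pt x y \<beta>) = (\<beta> - ?g) * d x y"
    using pt_dist[of x y ?g \<beta>] assms g pos b by (smt (verit))
  then show "d (pt x y ?g) (pt x y \<beta>) \<le> (1 - \<tau>) * d (pt x y \<alpha>) (pt x y \<beta>)"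
    unfolding ab b by simp
qed (use assms in auto)

end

section \<open>Nearest points on a geodesic line\<close>

text \<open>The nearest point is recorded by its parameter on the line, so that projections are
  compared as real numbers.\<close>

definition foot :: "'a metric \<Rightarrow> (real \<Rightarrow> 'a) \<Rightarrow> 'a \<Rightarrow> real" where
  "foot Y \<sigma> x = (SOME t. \<forall>s. mdist Y x (\<sigma> t) \<le> mdist Y x (\<sigma> s))"

definition height :: "'a metric \<Rightarrow> (real \<Rightarrow> 'a) \<Rightarrow> 'a \<Rightarrow> real" where
  "height Y \<sigma> x = mdist Y x (\<sigma> (foot Y \<sigma> x))"

lemma continuous_on_of_abs_diff_le:
  fixes f :: "real \<Rightarrow> real"
  assumes "\<And>s t. s \<in> A \<Longrightarrow> t \<in> A \<Longrightarrow> \<bar>f s - f t\<bar> \<le> L * \<bar>s - t\<bar>" "0 \<le> L"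
  shows "continuous_on A f"
  by (rule lipschitz_on_continuous_on[of L]) (use assms in \<open>auto simp: lipschitz_on_def dist_real_def\<close>)

locale gline = hadamard +
  fixes \<sigma> :: "real \<Rightarrow> 'a"
  assumes line: "geodesic_on Y UNIV \<sigma>"
begin

abbreviation "q \<equiv> foot Y \<sigma>"
abbreviation "h \<equiv> height Y \<sigma>"

lemma line_in [simp, intro]: "\<sigma> t \<in> M"
  using line by (auto simp: geodesic_on_def)

lemma line_dist: "d (\<sigma> s) (\<sigma> t) = \<bar>s - t\<bar>"
  using line by (auto simp: geodesic_on_def)

lemma dist_line_lipschitz:
  assumes "x \<in> M" shows "\<bar>d x (\<sigma> s) - d x (\<sigma> t)\<bar> \<le> \<bar>s - t\<bar>"
  using mdist_triangle[of x Y "\<sigma> s" "\<sigma> t"] mdist_triangle[of x Y "\<sigma> t" "\<sigma> s"] assms line_dist[of s t] line_dist[of t s]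
  by (simp add: abs_if split: if_splits)

lemma foot_le:
  assumes x: "x \<in> M" shows "h x \<le> d x (\<sigma> s)"
proof -
  \<comment> \<open>Beyond this parameter the line is farther from \<open>x\<close> than
    \<open>\<sigma> 0\<close> is, so the minimum is attained on a compact interval.\<close>
  define r where "r = 2 * d x (\<sigma> 0)"
  have r: "0 \<le> r" by (simp add: r_def)
  have "continuous_on {-r..r} (\<lambda>t. d x (\<sigma> t))"
    using dist_line_lipschitz[OF x] by (intro continuous_on_of_abs_diff_le[of _ _ 1]) auto
  then obtain t where t: "t \<in> {-r..r}" "\<forall>s\<in>{-r..r}. d x (\<sigma> t) \<le> d x (\<sigma> s)"
    using continuous_attains_inf[of "{-r..r}" "\<lambda>t. d x (\<sigma> t)"] r by fastforce
  have "d x (\<sigma> t) \<le> d x (\<sigma> s)" for s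
  proof (cases "s \<in> {-r..r}")
    case False
    have "\<bar>s\<bar> \<le> d x (\<sigma> s) + d x (\<sigma> 0)"
      using mdist_triangle[of "\<sigma> s" Y x "\<sigma> 0"] x line_dist[of s 0] by (simp add: mdist_commute)
    then have "d x (\<sigma> 0) \<le> d x (\<sigma> s)" using False r_def by auto
    then show ?thesis using t(2) r by (meson atLeastAtMost_iff neg_le_0_iff_le order_trans)
  qed (use t in auto)
  then have "\<exists>t. \<forall>s. d x (\<sigma> t) \<le> d x (\<sigma> s)" by blast
  then show ?thesis unfolding height_def foot_def by (rule someI2_ex) blast
qed

lemma height_nonneg [simp]: "0 \<le> h x"
  by (simp add: height_def)

lemma pt_line:
  assumes "0 \<le> \<tau>" "\<tau> \<le> 1" shows "pt (\<sigma> a) (\<sigma> b) \<tau> = \<sigma> ((1 - \<tau>) * a + \<tau> * b)"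
proof (rule sym, rule pt_unique)
  have "\<bar>a - ((1 - \<tau>) * a + \<tau> * b)\<bar> = \<bar>\<tau> * (a - b)\<bar>" "\<bar>((1 - \<tau>) * a + \<tau> * b) - b\<bar> = \<bar>(1 - \<tau>) * (a - b)\<bar>"
    by (auto simp: algebra_simps)
  then show "d (\<sigma> a) (\<sigma> ((1 - \<tau>) * a + \<tau> * b)) \<le> \<tau> * d (\<sigma> a) (\<sigma> b)"
    "d (\<sigma> ((1 - \<tau>) * a + \<tau> * b)) (\<sigma> b) \<le> (1 - \<tau>) * d (\<sigma> a) (\<sigma> b)"
    using assms by (auto simp: line_dist abs_mult)
qed (use assms in auto)

text \<open>The angle at the nearest point is at least a right angle. Minimality of the foot is
  tested by \<open>CN\<close> at points of the line close to it; this gives the inequality with a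
  factor \<open>z < 1\<close>, and \<open>z\<close> tends to 1.\<close>

lemma pythagoras:
  assumes x: "x \<in> M" shows "(h x)\<^sup>2 + (s - q x)\<^sup>2 \<le> (d x (\<sigma> s))\<^sup>2"
proof -
  have "z * (s - q x)\<^sup>2 \<le> (d x (\<sigma> s))\<^sup>2 - (h x)\<^sup>2" if z: "0 < z" "z < 1" for z
  proof -
    define \<tau> where "\<tau> = 1 - z"
    have t: "0 < \<tau>" "\<tau> < 1" using z by (auto simp: \<tau>_def)
    have "(h x)\<^sup>2 \<le> (d x (pt (\<sigma> (q x)) (\<sigma> s) \<tau>))\<^sup>2"
      using t foot_le[OF x] by (intro power_mono) (auto simp: pt_line)
    also have "\<dots> \<le> (1 - \<tau>) * (h x)\<^sup>2 + \<tau> * (d x (\<sigma> s))\<^sup>2 - \<tau> * (1 - \<tau>) * (s - q x)\<^sup>2"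
      using CN[of "\<sigma> (q x)" "\<sigma> s" x \<tau>] t x by (simp add: height_def line_dist power2_commute)
    finally have "\<tau> * ((h x)\<^sup>2 + z * (s - q x)\<^sup>2) \<le> \<tau> * (d x (\<sigma> s))\<^sup>2"
      by (simp add: \<tau>_def algebra_simps)
    then show ?thesis using t by auto
  qed
  then have "(s - q x)\<^sup>2 \<le> (d x (\<sigma> s))\<^sup>2 - (h x)\<^sup>2" by (rule field_le_mult_one_interval)
  then show ?thesis by simp
qed

lemma foot_dist_le:
  assumes x: "x \<in> M" shows "\<bar>s - q x\<bar> \<le> d x (\<sigma> s)"
proof (rule power2_le_imp_le)
  show "\<bar>s - q x\<bar>\<^sup>2 \<le> (d x (\<sigma> s))\<^sup>2"
    using pythagoras[OF x, of s] zero_le_power2[of "h x"] unfolding power2_abs by linarith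
qed auto

lemma foot_eqI:
  assumes "x \<in> M" "\<And>s. d x (\<sigma> t) \<le> d x (\<sigma> s)" shows "q x = t"
proof -
  have "(d x (\<sigma> t))\<^sup>2 \<le> (h x)\<^sup>2" unfolding height_def using assms by (intro power_mono) auto
  then have "(t - q x)\<^sup>2 \<le> 0" using pythagoras[OF assms(1), of t] by linarith
  then show ?thesis by simp
qed

lemma foot_line [simp]: "q (\<sigma> t) = t"
  by (rule foot_eqI) (auto simp: line_dist)

lemma height_line [simp]: "h (\<sigma> t) = 0"
  by (simp add: height_def)

text \<open>In the quadrilateral formed by \<open>x\<close>, \<open>y\<close> and their nearest
  points, \<open>pythagoras\<close> bounds both diagonals from below. Against
  \<open>quadrilateral\<close> the squared heights and one copy of the squared difference of the
  feet cancel.\<close>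

lemma foot_lipschitz:
  assumes "x \<in> M" "y \<in> M" shows "\<bar>q x - q y\<bar> \<le> d x y"
proof (rule power2_le_imp_le)
  have "(d x (\<sigma> (q y)))\<^sup>2 + (d y (\<sigma> (q x)))\<^sup>2
     \<le> (d x y)\<^sup>2 + (d y (\<sigma> (q y)))\<^sup>2 + (d (\<sigma> (q y)) (\<sigma> (q x)))\<^sup>2 + (d (\<sigma> (q x)) x)\<^sup>2"
    using quadrilateral[of x y "\<sigma> (q y)" "\<sigma> (q x)"] assms by simp
  then show "\<bar>q x - q y\<bar>\<^sup>2 \<le> (d x y)\<^sup>2"
    using pythagoras[OF assms(1), of "q y"] pythagoras[OF assms(2), of "q x"]
    by (simp add: line_dist height_def mdist_commute power2_commute)
qed auto

lemma height_lipschitz: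
  assumes "x \<in> M" "y \<in> M" shows "\<bar>h x - h y\<bar> \<le> d x y"
  using foot_le[OF assms(1), of "q y"] foot_le[OF assms(2), of "q x"]
    mdist_triangle[of x Y y "\<sigma> (q y)"] mdist_triangle[of y Y x "\<sigma> (q x)"] assms
  by (simp add: height_def mdist_commute)

lemma foot_perp:
  assumes x: "x \<in> M" and t: "0 \<le> \<tau>" "\<tau> \<le> 1"
  shows "q (pt (\<sigma> (q x)) x \<tau>) = q x" "h (pt (\<sigma> (q x)) x \<tau>) = \<tau> * h x"
proof -
  let ?z = "pt (\<sigma> (q x)) x \<tau>"
  have z: "?z \<in> M" using x t by auto
  have 1: "d ?z (\<sigma> (q x)) = \<tau> * h x"
    using pt_dist_left[of "\<sigma> (q x)" x \<tau>] x t by (simp add: height_def mdist_commute)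
  have 2: "d ?z x = (1 - \<tau>) * h x"
    using pt_dist_right[of "\<sigma> (q x)" x \<tau>] x t by (simp add: height_def mdist_commute)
  have "d ?z (\<sigma> (q x)) \<le> d ?z (\<sigma> s)" for s
    using mdist_triangle[of x Y ?z "\<sigma> s"] x z foot_le[OF x, of s] 1 2
    by (simp add: mdist_commute algebra_simps)
  then show *: "q ?z = q x" by (rule foot_eqI[OF z])
  show "h ?z = \<tau> * h x" using 1 by (simp add: height_def *)
qed

lemma dist_line_ge:
  assumes x: "x \<in> M" shows "d x (\<sigma> s) \<le> h x + \<bar>s - q x\<bar>"
  using mdist_triangle[of x Y "\<sigma> (q x)" "\<sigma> s"] x by (simp add: height_def line_dist abs_minus_commute)

lemma gline_reverse: "gline Y (\<lambda>t. \<sigma> (- t))"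
  by unfold_locales (auto simp: geodesic_on_def line_dist)

lemma foot_reverse:
  assumes "x \<in> M" shows "foot Y (\<lambda>t. \<sigma> (- t)) x = - q x"
  by (rule gline.foot_eqI[OF gline_reverse]) (use assms foot_le[of x] in \<open>auto simp: height_def\<close>)

lemma height_reverse:
  assumes "x \<in> M" shows "height Y (\<lambda>t. \<sigma> (- t)) x = h x"
  using foot_reverse[OF assms] by (simp add: height_def)

lemma dist_line_convex:
  assumes "x \<in> M" "0 \<le> \<tau>" "\<tau> \<le> 1"
  shows "d x (\<sigma> ((1 - \<tau>) * a + \<tau> * b)) \<le> (1 - \<tau>) * d x (\<sigma> a) + \<tau> * d x (\<sigma> b)"
proof -
  have "x = pt x x \<tau>" using assms by (intro pt_unique) simp_all
  then show ?thesis
    using pt_convex[of "\<sigma> a" "\<sigma> b" x x \<tau>] assms by (simp add: pt_line mdist_commute)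
qed

lemma dist_line_convex_on:
  assumes "x \<in> M" shows "convex_on UNIV (\<lambda>t. d x (\<sigma> t))"
proof (rule convex_onI)
  fix t a b :: real assume "0 < t" "t < 1"
  then show "d x (\<sigma> ((1 - t) *\<^sub>R a + t *\<^sub>R b)) \<le> (1 - t) * d x (\<sigma> a) + t * d x (\<sigma> b)"
    using dist_line_convex[OF assms, of t a b] by simp
qed auto

end

section \<open>Contracting lines\<close>

text \<open>The single constant \<open>C\<close> serves both as the separation of the feet from
  which the property applies and as the distance at which the segment passes every point between
  them.\<close>

definition contracting :: "'a metric \<Rightarrow> (real \<Rightarrow> 'a) \<Rightarrow> real \<Rightarrow> bool" where
  "contracting Y \<sigma> C \<longleftrightarrow> 0 < C \<and> (\<forall>x\<in>mspace Y. \<forall>y\<in>mspace Y. \<forall>t.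
     C \<le> \<bar>foot Y \<sigma> x - foot Y \<sigma> y\<bar> \<and> t \<in> closed_segment (foot Y \<sigma> x) (foot Y \<sigma> y) \<longrightarrow>
     (\<exists>\<tau>\<in>{0..1}. mdist Y (geo_pt Y x y \<tau>) (\<sigma> t) \<le> C))"

text \<open>Chord slopes of a convex function increase, so one steep chord makes everything to its
  right steep.\<close>

lemma convex_chord_slopes:
  fixes f :: "real \<Rightarrow> real"
  assumes f: "convex_on UNIV f" and st: "s < t" "t \<le> u" "u \<le> v" and m: "m * (t - s) \<le> f t - f s"
  shows "m * (v - u) \<le> f v - f u"
proof (cases "u = v")
  case False
  then have uv: "u < v" using st by auto
  have le: "(f y - f x) / (y - x) \<le> (f z - f y) / (z - y)" if "x < y" "y < z" for x y z
    using convex_on_slope_le[OF f, of x z y] that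
    by (simp add: closed_segment_eq_real_ivl) (metis minus_diff_eq minus_divide_divide order_trans)
  have 1: "m \<le> (f t - f s) / (t - s)" using m st by (simp add: field_simps)
  have "(f t - f s) / (t - s) \<le> (f v - f u) / (v - u)"
  proof (cases "t = u")
    case True then show ?thesis using le[of s t v] st uv by auto
  next
    case False
    then show ?thesis using le[of s t u] le[of t u v] st uv by auto
  qed
  with 1 have "m \<le> (f v - f u) / (v - u)" by simp
  then show ?thesis using uv by (simp add: field_simps)
qed auto

text \<open>Quantitative absence of a flat half-plane: far from the line, moving by \<open>D\<close> moves the nearest
  point by at most \<open>D - \<kappa>\<close>.\<close>

locale nf_line = gline +
  fixes R D \<kappa> :: real
  assumes R: "0 < R" and D: "0 < D" and \<kappa>: "0 < \<kappa>"
    and nf: "\<lbrakk>w \<in> M; w' \<in> M; R \<le> h w; R \<le> h w'; d w w' \<le> D\<rbrakk> \<Longrightarrow> \<bar>q w - q w'\<bar> \<le> D - \<kappa>"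
begin

text \<open>The path is cut into steps of length \<open>D\<close>, each of which loses
  \<open>\<kappa>\<close>; the incomplete last step is only \<open>1\<close>-Lipschitz, whence the
  \<open>- 1\<close>.\<close>

lemma nf_path:
  assumes T: "0 \<le> T" and c: "\<And>s. s \<in> {0..T} \<Longrightarrow> c s \<in> M" "\<And>s. s \<in> {0..T} \<Longrightarrow> R \<le> h (c s)"
    and lip: "\<And>s t. s \<in> {0..T} \<Longrightarrow> t \<in> {0..T} \<Longrightarrow> d (c s) (c t) \<le> \<bar>s - t\<bar>"
  shows "\<bar>q (c 0) - q (c T)\<bar> \<le> T - \<kappa> * (T / D - 1)"
proof -
  have step: "real n * D \<le> T \<Longrightarrow> \<bar>q (c 0) - q (c (real n * D))\<bar> \<le> real n * (D - \<kappa>)" for n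
  proof (induction n)
    case (Suc n)
    have n: "real n * D \<in> {0..T}" "real (Suc n) * D \<in> {0..T}"
      using Suc.prems D by (auto simp: algebra_simps)
    have "d (c (real n * D)) (c (real (Suc n) * D)) \<le> D"
      using lip[OF n] D by (simp add: algebra_simps)
    then have "\<bar>q (c (real n * D)) - q (c (real (Suc n) * D))\<bar> \<le> D - \<kappa>"
      using c n by (intro nf) auto
    moreover have "\<bar>q (c 0) - q (c (real n * D))\<bar> \<le> real n * (D - \<kappa>)"
      using Suc n by auto
    ultimately show ?case by (simp add: algebra_simps)
  qed simp
  define n where "n = nat \<lfloor>T / D\<rfloor>"
  have n: "real n \<le> T / D" "T / D < real n + 1" using T D by (auto simp: n_def)
  then have nD: "real n * D \<le> T" "0 \<le> real n * D" using D by (auto simp: field_simps)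
  have "\<bar>q (c (real n * D)) - q (c T)\<bar> \<le> T - real n * D"
    using foot_lipschitz[of "c (real n * D)" "c T"] c lip[of "real n * D" T] nD T by fastforce
  then have "\<bar>q (c 0) - q (c T)\<bar> \<le> T - real n * \<kappa>"
    using step[OF nD(1)] by (simp add: algebra_simps)
  also have "\<dots> \<le> T - \<kappa> * (T / D - 1)" using n \<kappa> by (simp add: mult.commute)
  finally show ?thesis .
qed

lemma nf_line_reverse: "nf_line Y (\<lambda>t. \<sigma> (- t)) R D \<kappa>"
proof (intro nf_line.intro gline_reverse nf_line_axioms.intro R D \<kappa>)
  fix w w' assume "w \<in> M" "w' \<in> M" "R \<le> height Y (\<lambda>t. \<sigma> (- t)) w" "R \<le> height Y (\<lambda>t. \<sigma> (- t)) w'"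
    "d w w' \<le> D"
  then show "\<bar>foot Y (\<lambda>t. \<sigma> (- t)) w - foot Y (\<lambda>t. \<sigma> (- t)) w'\<bar> \<le> D - \<kappa>"
    using nf[of w w'] by (simp add: foot_reverse height_reverse)
qed

text \<open>If the distance to \<open>x\<close> had small slope along a long piece of the line, the points at distance
  \<open>R / \<epsilon>\<close> from the line on the geodesics towards \<open>x\<close> would form a path that is no longer than that
  piece, runs far from the line and projects almost onto the whole piece.\<close>

lemma not_small_slope:
  assumes e: "0 < \<epsilon>" "\<epsilon> \<le> 1" and x: "x \<in> M"
    and N: "2 * (R / \<epsilon>) \<le> N" "2 * (R / \<epsilon>) < \<kappa> * ((N - 2 * (R / \<epsilon>)) / D - 1)"
    and far: "\<And>s. s \<in> {a..a+N} \<Longrightarrow> R / \<epsilon> \<le> d x (\<sigma> s)"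
    and slope: "\<And>s t. s \<in> {a..a+N} \<Longrightarrow> t \<in> {a..a+N} \<Longrightarrow> \<bar>d x (\<sigma> s) - d x (\<sigma> t)\<bar> \<le> (1 - \<epsilon>) * \<bar>s - t\<bar>"
  shows False
proof -
  \<comment> \<open>Going the distance \<open>\<rho>\<close> towards \<open>x\<close> gains
    \<open>\<rho>\<close>, while moving the foot by at most \<open>\<rho>\<close> along the line
    loses at most \<open>(1 - \<epsilon>) * \<rho>\<close>; the difference
    \<open>\<epsilon> * \<rho> = R\<close> is a lower bound for the height.\<close>
  define \<rho> where "\<rho> = R / \<epsilon>"
  have rho: "0 < \<rho>" "\<epsilon> * \<rho> = R" using e R by (auto simp: \<rho>_def)
  define f where "f s = d x (\<sigma> s)" for s
  define w where "w s = pt (\<sigma> s) x (\<rho> / f s)" for s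
  have f: "\<rho> \<le> f s" "0 < f s" if "s \<in> {a..a+N}" for s
    using far[OF that] rho by (auto simp: f_def \<rho>_def)
  have tau: "0 \<le> \<rho> / f s" "\<rho> / f s \<le> 1" if "s \<in> {a..a+N}" for s
    using f[OF that] rho by auto
  have wM: "w s \<in> M" if "s \<in> {a..a+N}" for s using tau[OF that] x by (auto simp: w_def)
  have ws: "d (\<sigma> s) (w s) = \<rho>" "d (w s) x = f s - \<rho>" if "s \<in> {a..a+N}" for s
  proof -
    have F: "d (\<sigma> s) x = f s" by (simp add: f_def mdist_commute)
    show "d (\<sigma> s) (w s) = \<rho>"
      unfolding w_def using pt_dist_left[of "\<sigma> s" x "\<rho> / f s", unfolded F] tau[OF that] x f[OF that] by simp
    show "d (w s) x = f s - \<rho>"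
      unfolding w_def using pt_dist_right[of "\<sigma> s" x "\<rho> / f s", unfolded F] tau[OF that] x f[OF that]
      by (simp add: left_diff_distrib)
  qed
  have qw: "\<bar>q (w s) - s\<bar> \<le> \<rho>" if "s \<in> {a..a+N}" for s
    using foot_lipschitz[of "w s" "\<sigma> s"] wM[OF that] ws[OF that] by (simp add: mdist_commute)
  have hw: "R \<le> h (w s)" if s: "s \<in> {a+\<rho>..a+N-\<rho>}" for s
  proof -
    have s': "s \<in> {a..a+N}" using s rho by auto
    have t: "q (w s) \<in> {a..a+N}" using qw[OF s'] s by auto
    have "f (q (w s)) \<le> h (w s) + (f s - \<rho>)"
      using mdist_triangle[of x Y "w s" "\<sigma> (q (w s))"] x wM[OF s'] ws[OF s']
      by (simp add: f_def height_def mdist_commute)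
    moreover have "f s - f (q (w s)) \<le> (1 - \<epsilon>) * \<rho>"
    proof -
      have "\<bar>f s - f (q (w s))\<bar> \<le> (1 - \<epsilon>) * \<bar>s - q (w s)\<bar>" unfolding f_def using slope s' t by blast
      also have "\<dots> \<le> (1 - \<epsilon>) * \<rho>"
        using e qw[OF s'] by (intro mult_left_mono) (auto simp: abs_minus_commute)
      finally show ?thesis by simp
    qed
    ultimately show ?thesis using rho by (simp add: algebra_simps)
  qed
  \<comment> \<open>Convexity at equal ratio costs
    \<open>(1 - \<rho> / f s) * \<bar>s - t\<bar>\<close>, and the change of ratio needed to keep
    the distance \<open>\<rho>\<close> costs at most the remaining share.\<close>
  have lip: "d (w s) (w t) \<le> \<bar>s - t\<bar>" if s: "s \<in> {a..a+N}" and t: "t \<in> {a..a+N}" for s t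
  proof -
    have "d (w s) (w t) \<le> d (w s) (pt (\<sigma> t) x (\<rho> / f s)) + d (pt (\<sigma> t) x (\<rho> / f s)) (w t)"
      using wM s t tau x by (intro mdist_triangle) auto
    also have "d (w s) (pt (\<sigma> t) x (\<rho> / f s)) \<le> (1 - \<rho> / f s) * \<bar>s - t\<bar>"
      unfolding w_def using pt_convex[of "\<sigma> s" x "\<sigma> t" x "\<rho> / f s"] tau[OF s] x by (simp add: line_dist)
    also have "d (pt (\<sigma> t) x (\<rho> / f s)) (w t) = \<bar>\<rho> / f s - \<rho> / f t\<bar> * f t"
      unfolding w_def using pt_dist[of "\<sigma> t" x "\<rho> / f s" "\<rho> / f t"] tau[OF s] tau[OF t] x
      by (simp add: f_def mdist_commute)
    also have "\<dots> = \<bar>(\<rho> / f s - \<rho> / f t) * f t\<bar>" using f[OF t] by (simp add: abs_mult)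
    also have "(\<rho> / f s - \<rho> / f t) * f t = (\<rho> / f s) * (f t - f s)"
      using f[OF s] f[OF t] by (simp add: field_simps)
    also have "\<bar>\<dots>\<bar> = (\<rho> / f s) * \<bar>f s - f t\<bar>" using rho f[OF s] by (simp add: abs_mult abs_minus_commute)
    also have "\<dots> \<le> (\<rho> / f s) * (1 * \<bar>s - t\<bar>)"
      using tau[OF s] slope[OF s t] e
      by (intro mult_left_mono order_trans[OF slope[OF s t, folded f_def]] mult_right_mono) auto
    finally show ?thesis by (simp add: algebra_simps)
  qed
  \<comment> \<open>Both ends are trimmed by \<open>\<rho>\<close>, so that the feet of the path
    stay inside the interval where the slope is controlled.\<close>
  define T where "T = N - 2 * \<rho>"
  have T: "0 \<le> T" using N by (simp add: T_def \<rho>_def)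
  have "\<bar>q (w (a + \<rho> + 0)) - q (w (a + \<rho> + T))\<bar> \<le> T - \<kappa> * (T / D - 1)"
  proof (rule nf_path[OF T, of "\<lambda>u. w (a + \<rho> + u)"])
    fix s t assume "s \<in> {0..T}" "t \<in> {0..T}"
    then have *: "a + \<rho> + s \<in> {a..a+N}" "a + \<rho> + t \<in> {a..a+N}"
      using rho T_def by auto
    then show "d (w (a + \<rho> + s)) (w (a + \<rho> + t)) \<le> \<bar>s - t\<bar>" using lip[OF *] by simp
  next
    fix s assume s: "s \<in> {0..T}"
    then show "R \<le> h (w (a + \<rho> + s))" using hw[of "a + \<rho> + s"] T_def by auto
    show "w (a + \<rho> + s) \<in> M" using wM[of "a + \<rho> + s"] s T_def rho by auto
  qed
  moreover have "\<bar>q (w (a + \<rho> + T)) - (a + \<rho> + T)\<bar> \<le> \<rho>" "\<bar>q (w (a + \<rho>)) - (a + \<rho>)\<bar> \<le> \<rho>"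
    using qw T rho T_def by auto
  ultimately have "\<kappa> * (T / D - 1) \<le> 2 * \<rho>" by simp
  then show False using N by (simp add: T_def \<rho>_def)
qed

text \<open>Far from the foot \<open>not_small_slope\<close> provides one steep chord in a window of
  fixed length, and convexity carries its slope to the right. The window starts
  \<open>\<rho>\<close> beyond the foot, which makes the line far enough from
  \<open>x\<close>.\<close>

lemma eventually_steep:
  assumes e: "0 < \<epsilon>" "\<epsilon> \<le> 1"
  shows "\<exists>N>0. \<forall>x\<in>M. \<forall>u v. q x + N \<le> u \<and> u \<le> v \<longrightarrow> (1 - \<epsilon>) * (v - u) \<le> d x (\<sigma> v) - d x (\<sigma> u)"
proof -
  define \<rho> where "\<rho> = R / \<epsilon>"
  have rho: "0 < \<rho>" using e R by (auto simp: \<rho>_def)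
  \<comment> \<open>With this window length the loss
    \<open>\<kappa> * ((N - 2 * \<rho>) / D - 1)\<close> equals
    \<open>2 * \<rho> + 1\<close>.\<close>
  define N where "N = 2 * \<rho> + D * ((2 * \<rho> + 1) / \<kappa> + 1)"
  have N: "2 * \<rho> \<le> N" "2 * \<rho> < \<kappa> * ((N - 2 * \<rho>) / D - 1)"
    using rho D \<kappa> by (auto simp: N_def field_simps)
  have "(1 - \<epsilon>) * (v - u) \<le> d x (\<sigma> v) - d x (\<sigma> u)"
    if x: "x \<in> M" and uv: "q x + (\<rho> + N) \<le> u" "u \<le> v" for x u v
  proof -
    let ?f = "\<lambda>t. d x (\<sigma> t)"
    let ?I = "{q x + \<rho>..q x + \<rho> + N}"
    have "\<exists>s\<in>?I. \<exists>t\<in>?I. \<not> \<bar>?f s - ?f t\<bar> \<le> (1 - \<epsilon>) * \<bar>s - t\<bar>"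
    proof (rule ccontr)
      assume "\<not> ?thesis"
      then show False
        using foot_dist_le[OF x] rho
        by (intro not_small_slope[OF e x N[unfolded \<rho>_def], of "q x + \<rho>"])
           (force simp: \<rho>_def[symmetric] abs_le_iff intro: order_trans[OF _ foot_dist_le[OF x]])+
    qed
    then obtain s t where st: "s \<in> ?I" "t \<in> ?I" "s < t" "\<bar>?f s - ?f t\<bar> > (1 - \<epsilon>) * \<bar>s - t\<bar>"
      by (metis abs_minus_commute diff_self linorder_neqE_linordered_idom mult_zero_right not_le abs_zero order_refl)
    have cv: "convex_on UNIV ?f" using dist_line_convex_on[OF x] .
    have qs: "q x < s" using st rho by auto
    have "0 * (t - s) \<le> ?f t - ?f s"
      by (rule convex_chord_slopes[OF cv qs order_refl less_imp_le[OF st(3)]])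
        (use foot_le[OF x, of s] in \<open>auto simp: height_def\<close>)
    then have steep: "(1 - \<epsilon>) * (t - s) \<le> ?f t - ?f s" using st(3,4) by simp
    have "t \<le> u" using uv(1) st(2) by simp
    then show ?thesis by (rule convex_chord_slopes[OF cv st(3) _ uv(2) steep])
  qed
  then show ?thesis using rho N(1) by (intro exI[of _ "\<rho> + N"]) auto
qed

text \<open>Otherwise, by \<open>eventually_steep\<close>, the geodesic from the nearest point of \<open>z\<close> to \<open>x\<close> starts
  almost along the line, and so does the one from \<open>z\<close>; its foot then moves with full speed, which
  \<open>nf_path\<close> forbids.\<close>

lemma foot_diff_le_of_high_segment_aux:
  "\<exists>C>0. \<forall>x\<in>M. \<forall>z\<in>M. h z = R \<and> (\<forall>\<tau>\<in>{0..1}. R \<le> h (pt z x \<tau>)) \<longrightarrow> q z - q x \<le> C"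
proof -
  \<comment> \<open>A walk of length \<open>m\<close> at height at least \<open>R\<close> loses more
    than \<open>2 * R + 1\<close> of foot movement, which is the error that arises below.\<close>
  define m where "m = D * ((2 * R + 2) / \<kappa> + 1) + 1"
  have m1: "1 \<le> m" using D R \<kappa> by (simp add: m_def)
  have m2: "2 * R + 1 < \<kappa> * (m / D - 1)"
  proof -
    have "\<kappa> * ((D * ((2 * R + 2) / \<kappa> + 1)) / D - 1) = 2 * R + 2" using D \<kappa> by (simp add: field_simps)
    moreover have "(D * ((2 * R + 2) / \<kappa> + 1)) / D \<le> m / D" using D by (intro divide_right_mono) (simp_all add: m_def)
    ultimately show ?thesis using \<kappa> by (smt (verit) mult_left_mono)
  qed
  \<comment> \<open>With this value \<open>CN\<close> puts the point at distance \<open>m\<close>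
    from \<open>\<sigma> (q z)\<close> on the way to \<open>x\<close> within distance 1 of
    \<open>\<sigma> (q z - m)\<close>.\<close>
  define \<epsilon> where "\<epsilon> = 1 / (2 * m\<^sup>2)"
  have mm: "1 \<le> m\<^sup>2" using m1 by simp
  have e: "0 < \<epsilon>" "\<epsilon> \<le> 1" "2 * \<epsilon> * m\<^sup>2 = 1"
  proof -
    have pos: "1 \<le> 2 * m\<^sup>2" "m \<noteq> 0" using mm m1 by linarith+
    then show "0 < \<epsilon>" "2 * \<epsilon> * m\<^sup>2 = 1" by (auto simp: \<epsilon>_def)
    show "\<epsilon> \<le> 1" unfolding \<epsilon>_def using pos(1) by (subst divide_le_eq_1_pos) auto
  qed
  obtain N where N: "N > 0" "\<And>x u v. x \<in> M \<Longrightarrow> q x + N \<le> u \<Longrightarrow> u \<le> v \<Longrightarrow>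
      (1 - \<epsilon>) * (v - u) \<le> d x (\<sigma> v) - d x (\<sigma> u)"
    using eventually_steep[OF e(1,2)] by blast
  have "q z - q x \<le> N + m"
    if x: "x \<in> M" and z: "z \<in> M" "h z = R" and hi: "\<And>\<tau>. \<tau> \<in> {0..1} \<Longrightarrow> R \<le> h (pt z x \<tau>)" for x z
  proof (rule ccontr)
    assume "\<not> ?thesis"
    then have far: "N + m < q z - q x" by simp
    define F where "F = d x (\<sigma> (q z))"
    define G where "G = d x (\<sigma> (q z - m))"
    have FG: "(1 - \<epsilon>) * m \<le> F - G"
      using N(2)[OF x, of "q z - m" "q z"] far m1 by (simp add: F_def G_def)
    have F: "m \<le> F" using foot_dist_le[OF x, of "q z"] far N(1) by (simp add: F_def)
    have dzx: "m \<le> d z x" using foot_lipschitz[OF z(1) x] far N(1) by simp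
    define \<tau> where "\<tau> = m / F"
    have t: "0 \<le> \<tau>" "\<tau> \<le> 1" "\<tau> * F = m" using F m1 by (auto simp: \<tau>_def)
    define v where "v = pt (\<sigma> (q z)) x \<tau>"
    have vM: "v \<in> M" using x t by (auto simp: v_def)
    have "(d (\<sigma> (q z - m)) v)\<^sup>2 \<le> (1 - \<tau>) * m\<^sup>2 + \<tau> * G\<^sup>2 - \<tau> * (1 - \<tau>) * F\<^sup>2"
      using CN[of "\<sigma> (q z)" x "\<sigma> (q z - m)" \<tau>] x t
      by (simp add: v_def F_def G_def line_dist mdist_commute)
    also have "\<dots> \<le> (1 - \<tau>) * m\<^sup>2 + \<tau> * (F - (1 - \<epsilon>) * m)\<^sup>2 - \<tau> * (1 - \<tau>) * F\<^sup>2"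
      using t(1,2) FG by (intro diff_mono add_mono mult_left_mono power_mono order_refl) (simp_all add: G_def)
    also have "\<dots> = (1 - \<tau>) * m\<^sup>2 - 2 * (1 - \<epsilon>) * m * (\<tau> * F) + \<tau> * ((1 - \<epsilon>)\<^sup>2 * m\<^sup>2) + (\<tau> * F)\<^sup>2"
      by (simp add: power2_eq_square algebra_simps)
    also have "\<dots> = 2 * \<epsilon> * m\<^sup>2 - \<tau> * ((1 - (1 - \<epsilon>)\<^sup>2) * m\<^sup>2)"
      unfolding t by (simp add: power2_eq_square algebra_simps)
    also have "\<dots> \<le> 1\<^sup>2"
    proof -
      have "(1 - \<epsilon>)\<^sup>2 \<le> 1" using e by (simp add: power_le_one)
      then have "0 \<le> \<tau> * ((1 - (1 - \<epsilon>)\<^sup>2) * m\<^sup>2)" using t by simp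
      then show ?thesis using e(3) by simp
    qed
    finally have dv: "d (\<sigma> (q z - m)) v \<le> 1" by (rule power2_le_imp_le) simp
    define \<tau>' where "\<tau>' = m / d z x"
    have t': "0 \<le> \<tau>'" "\<tau>' \<le> 1" "\<tau>' * d z x = m" using dzx m1 by (auto simp: \<tau>'_def)
    define w where "w = pt z x \<tau>'"
    have wM: "w \<in> M" using x z t' by (auto simp: w_def)
    \<comment> \<open>Changing the ratio from \<open>\<tau>'\<close> to \<open>\<tau>\<close>, and
      then the starting point from \<open>z\<close> to its nearest point, costs at most
      \<open>R\<close> each.\<close>
    have "d w v \<le> d w (pt z x \<tau>) + d (pt z x \<tau>) v"
      using wM vM x z t by (intro mdist_triangle) auto
    also have "d w (pt z x \<tau>) \<le> R"
    proof -
      have "d w (pt z x \<tau>) = \<bar>\<tau>' - \<tau>\<bar> * d z x" unfolding w_def using pt_dist x z t t' by auto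
      also have "\<dots> = \<bar>(\<tau>' - \<tau>) * d z x\<bar>" by (simp add: abs_mult)
      also have "(\<tau>' - \<tau>) * d z x = \<tau> * (F - d z x)" using t' t by (simp add: algebra_simps)
      also have "\<bar>\<dots>\<bar> = \<tau> * \<bar>F - d z x\<bar>" using t by (simp add: abs_mult)
      also have "\<dots> \<le> 1 * R"
      proof (intro mult_mono)
        show "\<bar>F - d z x\<bar> \<le> R"
          using mdist_triangle[of x Y z "\<sigma> (q z)"] mdist_triangle[of x Y "\<sigma> (q z)" z] x z
          by (simp add: F_def height_def mdist_commute)
      qed (use t in auto)
      finally show ?thesis by simp
    qed
    also have "d (pt z x \<tau>) v \<le> R"
    proof -
      have "d (pt z x \<tau>) v \<le> (1 - \<tau>) * R + \<tau> * d x x"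
        unfolding v_def using pt_convex[of z x "\<sigma> (q z)" x \<tau>] x z t by (simp add: height_def)
      also have "\<dots> \<le> 1 * R" using x t R by (simp add: mult_left_le_one_le)
      finally show ?thesis by simp
    qed
    finally have "d w (\<sigma> (q z - m)) \<le> 2 * R + 1"
      using mdist_triangle[of w Y v "\<sigma> (q z - m)"] wM vM dv by (simp add: mdist_commute)
    then have qw: "q w \<le> q z - m + 2 * R + 1"
      using foot_lipschitz[OF wM, of "\<sigma> (q z - m)"] by simp
    have dpos: "0 < d z x" using dzx m1 by simp
    have "\<bar>q (pt z x (0 / d z x)) - q (pt z x (m / d z x))\<bar> \<le> m - \<kappa> * (m / D - 1)"
    proof (rule nf_path[of m "\<lambda>s. pt z x (s / d z x)"])
      fix s t assume s: "s \<in> {0..m}" and t: "t \<in> {0..m}"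
      then have "d (pt z x (s / d z x)) (pt z x (t / d z x)) = \<bar>s / d z x - t / d z x\<bar> * d z x"
        using dzx m1 dpos x z by (intro pt_dist) auto
      also have "\<dots> = \<bar>(s / d z x - t / d z x) * d z x\<bar>" by (simp add: abs_mult)
      also have "\<dots> = \<bar>s - t\<bar>" using dpos by (simp add: left_diff_distrib)
      finally show "d (pt z x (s / d z x)) (pt z x (t / d z x)) \<le> \<bar>s - t\<bar>" by simp
    next
      fix s assume s: "s \<in> {0..m}"
      then have "s / d z x \<in> {0..1}" using dzx dpos by auto
      then show "pt z x (s / d z x) \<in> M" "R \<le> h (pt z x (s / d z x))" using x z hi by auto
    qed (use m1 in auto)
    then have "q z - q w \<le> m - \<kappa> * (m / D - 1)" using x z by (simp add: w_def \<tau>'_def)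
    then show False using qw m2 by simp
  qed
  then show ?thesis using N(1) m1 by (intro exI[of _ "N + m"]) auto
qed

lemma foot_diff_le_of_high_segment:
  "\<exists>C>0. \<forall>x\<in>M. \<forall>z\<in>M. h z = R \<and> (\<forall>\<tau>\<in>{0..1}. R \<le> h (pt z x \<tau>)) \<longrightarrow> \<bar>q z - q x\<bar> \<le> C"
proof -
  obtain C where C: "C > 0" "\<And>x z. x \<in> M \<Longrightarrow> z \<in> M \<Longrightarrow> h z = R \<Longrightarrow> (\<forall>\<tau>\<in>{0..1}. R \<le> h (pt z x \<tau>)) \<Longrightarrow> q z - q x \<le> C"
    using foot_diff_le_of_high_segment_aux by blast
  obtain C' where C': "C' > 0" "\<And>x z. x \<in> M \<Longrightarrow> z \<in> M \<Longrightarrow> h z = R \<Longrightarrow> (\<forall>\<tau>\<in>{0..1}. R \<le> h (pt z x \<tau>)) \<Longrightarrow> q x - q z \<le> C'"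
    using nf_line.foot_diff_le_of_high_segment_aux[OF nf_line_reverse]
    by (auto simp: foot_reverse height_reverse)
  show ?thesis using C C' by (intro exI[of _ "max C C'"]) (auto simp: abs_le_iff le_max_iff_disj)
qed

text \<open>A continuity argument: move \<open>x\<close> and \<open>y\<close> down to their nearest points and stop at the last moment
  at which the segment between them comes down to height \<open>R\<close>; at that moment \<open>R\<close> is its minimal height.\<close>

lemma low_point_exists:
  assumes C: "\<And>x z. x \<in> M \<Longrightarrow> z \<in> M \<Longrightarrow> h z = R \<Longrightarrow> (\<forall>\<tau>\<in>{0..1}. R \<le> h (pt z x \<tau>)) \<Longrightarrow> \<bar>q z - q x\<bar> \<le> C"
    and xy: "x \<in> M" "y \<in> M" and far: "2 * C < \<bar>q x - q y\<bar>"
  shows "\<exists>\<tau>\<in>{0..1}. h (pt x y \<tau>) < R"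
proof (rule ccontr)
  assume "\<not> ?thesis"
  then have high: "\<And>\<tau>. \<tau> \<in> {0..1} \<Longrightarrow> R \<le> h (pt x y \<tau>)" by force
  define X where "X s = pt (\<sigma> (q x)) x s" for s
  define W where "W s = pt (\<sigma> (q y)) y s" for s
  define H where "H p = h (pt (X (fst p)) (W (fst p)) (snd p))" for p :: "real \<times> real"
  have XW: "X s \<in> M" "W s \<in> M" if "s \<in> {0..1}" for s using that xy by (auto simp: X_def W_def)
  have dXW: "d (X s) (W s) \<le> \<bar>q x - q y\<bar> + d x y" if s: "s \<in> {0..1}" for s
  proof -
    have "d (X s) (W s) \<le> (1 - s) * d (\<sigma> (q x)) (\<sigma> (q y)) + s * d x y"
      unfolding X_def W_def using s xy by (intro pt_convex) auto
    also have "\<dots> \<le> d (\<sigma> (q x)) (\<sigma> (q y)) + d x y"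
      using s by (intro add_mono mult_left_le_one_le) auto
    finally show ?thesis by (simp add: line_dist)
  qed
  define L where "L = h x + h y + \<bar>q x - q y\<bar> + d x y + 1"
  have L: "0 < L" by (simp add: L_def add_nonneg_pos)
  have lip: "\<bar>H (s, \<tau>) - H (s', \<tau>')\<bar> \<le> L * (\<bar>s - s'\<bar> + \<bar>\<tau> - \<tau>'\<bar>)"
    if st: "s \<in> {0..1}" "s' \<in> {0..1}" "\<tau> \<in> {0..1}" "\<tau>' \<in> {0..1}" for s s' \<tau> \<tau>'
  proof -
    have in_M: "pt (X s) (W s) \<tau> \<in> M" "pt (X s') (W s') \<tau> \<in> M" "pt (X s') (W s') \<tau>' \<in> M"
      using XW st by auto
    have "\<bar>H (s, \<tau>) - H (s', \<tau>')\<bar> \<le> d (pt (X s) (W s) \<tau>) (pt (X s') (W s') \<tau>')"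
      unfolding H_def using in_M by (simp add: height_lipschitz)
    also have "\<dots> \<le> d (pt (X s) (W s) \<tau>) (pt (X s') (W s') \<tau>) + d (pt (X s') (W s') \<tau>) (pt (X s') (W s') \<tau>')"
      using in_M by (intro mdist_triangle) auto
    also have "d (pt (X s) (W s) \<tau>) (pt (X s') (W s') \<tau>) \<le> (1 - \<tau>) * d (X s) (X s') + \<tau> * d (W s) (W s')"
      using XW st by (intro pt_convex) auto
    also have "\<dots> \<le> d (X s) (X s') + d (W s) (W s')"
      using st by (intro add_mono mult_left_le_one_le) auto
    also have "d (X s) (X s') = \<bar>s - s'\<bar> * h x"
      unfolding X_def height_def using pt_dist[of "\<sigma> (q x)" x s s'] xy st by (simp add: mdist_commute)
    also have "d (W s) (W s') = \<bar>s - s'\<bar> * h y"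
      unfolding W_def height_def using pt_dist[of "\<sigma> (q y)" y s s'] xy st by (simp add: mdist_commute)
    also have "d (pt (X s') (W s') \<tau>) (pt (X s') (W s') \<tau>') = \<bar>\<tau> - \<tau>'\<bar> * d (X s') (W s')"
      using XW st by (intro pt_dist) auto
    also have "\<dots> \<le> \<bar>\<tau> - \<tau>'\<bar> * L"
      using dXW[OF st(2)] height_nonneg[of x] height_nonneg[of y] unfolding L_def
      by (intro mult_left_mono) linarith+
    also have "\<bar>s - s'\<bar> * h x + \<bar>s - s'\<bar> * h y \<le> \<bar>s - s'\<bar> * L"
      unfolding distrib_left[symmetric] by (intro mult_left_mono) (auto simp: L_def)
    finally show ?thesis by (simp add: algebra_simps)
  qed
  let ?S = "{0..1} \<times> {0..1} :: (real \<times> real) set"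
  have cont: "continuous_on ?S H"
  proof (rule lipschitz_on_continuous_on[of "2 * L"])
    show "(2 * L)-lipschitz_on ?S H"
      unfolding lipschitz_on_def
    proof (intro conjI ballI)
      fix a b assume ab: "a \<in> ?S" "b \<in> ?S"
      have "dist (H a) (H b) \<le> L * (\<bar>fst a - fst b\<bar> + \<bar>snd a - snd b\<bar>)"
        using lip[of "fst a" "fst b" "snd a" "snd b"] ab by (auto simp: dist_real_def)
      also have "\<dots> \<le> L * (dist a b + dist a b)"
        using L dist_fst_le[of a b] dist_snd_le[of a b] by (intro mult_left_mono add_mono) (auto simp: dist_real_def)
      finally show "dist (H a) (H b) \<le> 2 * L * dist a b" by simp
    qed (use L in auto)
  qed
  let ?K = "{p \<in> ?S. H p \<le> R}"
  have "compact ?K"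
  proof -
    have "closed ?K" using continuous_closed_preimage[OF cont, of "{..R}"]
      by (simp add: closed_Times vimage_def Int_def)
    then have "compact (?S \<inter> ?K)" by (intro compact_Int_closed compact_Times) auto
    then show ?thesis by (simp add: Int_absorb1 Int_commute subset_iff)
  qed
  moreover have "(0, 0) \<in> ?K" using XW(1)[of 0] XW(2)[of 0] xy R by (simp add: H_def X_def)
  \<comment> \<open>The first coordinate is 0 at the nearest points and 1 at \<open>x\<close> and
    \<open>y\<close>; its largest value with a low point is the critical moment.\<close>
  ultimately obtain p where p: "p \<in> ?K" "\<And>p'. p' \<in> ?K \<Longrightarrow> fst p' \<le> fst p"
    using continuous_attains_sup[of ?K fst] continuous_on_fst[OF continuous_on_id] by blast
  obtain s \<tau> where s: "p = (s, \<tau>)" by (cases p)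
  have st: "s \<in> {0..1}" "\<tau> \<in> {0..1}" "H (s, \<tau>) \<le> R" using p s by auto
  have all: "R \<le> H (s, \<tau>')" if t': "\<tau>' \<in> {0..1}" for \<tau>'
  proof (rule ccontr)
    assume "\<not> ?thesis"
    then have less: "H (s, \<tau>') < R" by simp
    have "s \<noteq> 1" using high[OF t'] less xy by (auto simp: H_def X_def W_def)
    then have s1: "s < 1" using st by auto
    define s' where "s' = min 1 (s + (R - H (s, \<tau>')) / L)"
    have s': "s < s'" "s' \<in> {0..1}" "s' - s \<le> (R - H (s, \<tau>')) / L"
    proof -
      have "0 < (R - H (s, \<tau>')) / L" using less L by simp
      then show "s < s'" "s' \<in> {0..1}" "s' - s \<le> (R - H (s, \<tau>')) / L"
        using s1 st(1) by (auto simp: s'_def)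
    qed
    have "H (s', \<tau>') \<le> H (s, \<tau>') + L * (s' - s)" using lip[OF st(1) s'(2) t' t'] s'(1) by simp
    also have "\<dots> \<le> R" using s'(3) L by (simp add: field_simps)
    finally have "s' \<le> s" using p(2)[of "(s', \<tau>')"] s' t' s by auto
    then show False using s' by simp
  qed
  define z where "z = pt (X s) (W s) \<tau>"
  have z: "z \<in> M" "h z = R" using all[OF st(2)] st XW[OF st(1)] by (auto simp: z_def H_def)
  \<comment> \<open>Seen from \<open>z\<close>, whose height is exactly \<open>R\<close>, both
    halves of the critical segment are high, so \<open>C\<close> applies to each; the feet of their
    ends are still those of \<open>x\<close> and \<open>y\<close>.\<close>
  have seg: "R \<le> h (pt z (X s) t)" "R \<le> h (pt z (W s) t)" if t: "t \<in> {0..1}" for t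
  proof -
    have r: "t * \<tau> \<in> {0..1}" "(1 - t) * \<tau> \<in> {0..1}" "(1 - t) * \<tau> + t \<in> {0..1}"
    proof -
      show "t * \<tau> \<in> {0..1}" "(1 - t) * \<tau> \<in> {0..1}" using t st by (auto simp: mult_le_one)
      have "(1 - t) * \<tau> \<le> (1 - t) * 1" using t st by (intro mult_left_mono) auto
      then show "(1 - t) * \<tau> + t \<in> {0..1}" using t st by auto
    qed
    have "pt (X s) z (1 - t) = pt (X s) (W s) ((1 - t) * \<tau>)"
      using pt_reparam[of "X s" "W s" 0 \<tau> "1 - t"] XW[OF st(1)] st t by (simp add: z_def)
    moreover have "pt (X s) z (1 - t) = pt z (X s) t"
      using pt_swap[of z "X s" t] z XW[OF st(1)] t by simp
    ultimately show "R \<le> h (pt z (X s) t)" using all[OF r(2)] by (simp add: H_def)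
    have "pt z (W s) t = pt (X s) (W s) ((1 - t) * \<tau> + t)"
      using pt_reparam[of "X s" "W s" \<tau> 1 t] XW[OF st(1)] st t by (simp add: z_def)
    then show "R \<le> h (pt z (W s) t)" using all[OF r(3)] by (simp add: H_def)
  qed
  have "\<bar>q z - q (X s)\<bar> \<le> C" "\<bar>q z - q (W s)\<bar> \<le> C" using C z XW[OF st(1)] seg by auto
  moreover have "q (X s) = q x" "q (W s) = q y" using foot_perp xy st by (auto simp: X_def W_def)
  ultimately show False using far by auto
qed

text \<open>Up to the first point \<open>z\<close> of height at most \<open>R\<close> the segment is
  high. Read backwards from \<open>z\<close>, this initial piece falls under the hypothesis on high
  segments, so the foot of \<open>z\<close> is within \<open>C\<close> of the foot of
  \<open>x\<close>.\<close>

lemma near_foot_exists: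
  assumes C: "\<And>x z. x \<in> M \<Longrightarrow> z \<in> M \<Longrightarrow> h z = R \<Longrightarrow> (\<forall>\<tau>\<in>{0..1}. R \<le> h (pt z x \<tau>)) \<Longrightarrow> \<bar>q z - q x\<bar> \<le> C" "0 \<le> C"
    and xy: "x \<in> M" "y \<in> M" and far: "2 * C < \<bar>q x - q y\<bar>"
  shows "\<exists>\<tau>\<in>{0..1}. d (pt x y \<tau>) (\<sigma> (q x)) \<le> R + C"
proof -
  define H where "H \<tau> = h (pt x y \<tau>)" for \<tau>
  have lip: "\<bar>H s - H t\<bar> \<le> d x y * \<bar>s - t\<bar>" if "s \<in> {0..1}" "t \<in> {0..1}" for s t
    unfolding H_def using height_lipschitz[of "pt x y s" "pt x y t"] pt_dist[of x y s t] xy that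
    by (simp add: mult.commute)
  then have cont: "continuous_on {0..1} H" by (rule continuous_on_of_abs_diff_le) auto
  let ?K = "{\<tau> \<in> {0..1}. H \<tau> \<le> R}"
  have "compact ?K"
  proof -
    have "closed ?K" using continuous_closed_preimage[OF cont, of "{..R}"]
      by (simp add: vimage_def Int_def)
    then have "compact ({0..1} \<inter> ?K)" by (intro compact_Int_closed) auto
    then show ?thesis by (simp add: Int_absorb1 Int_commute subset_iff)
  qed
  moreover have "?K \<noteq> {}"
  proof -
    have "\<exists>\<tau>\<in>{0..1}. h (pt x y \<tau>) < R" by (rule low_point_exists[OF _ xy far]) (rule C(1))
    then obtain \<tau>\<^sub>0 where "\<tau>\<^sub>0 \<in> {0..1}" "H \<tau>\<^sub>0 < R" unfolding H_def by blast
    then have "\<tau>\<^sub>0 \<in> ?K" by simp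
    then show ?thesis by blast
  qed
  ultimately obtain \<tau> where t: "\<tau> \<in> ?K" "\<And>\<tau>'. \<tau>' \<in> ?K \<Longrightarrow> \<tau> \<le> \<tau>'"
    using continuous_attains_inf[of ?K "\<lambda>x. x"] continuous_on_id by blast
  define z where "z = pt x y \<tau>"
  have z: "z \<in> M" "h z \<le> R" using t xy by (auto simp: z_def H_def)
  have "\<bar>q z - q x\<bar> \<le> C"
  proof (cases "\<tau> = 0")
    case True then show ?thesis using xy C(2) by (simp add: z_def)
  next
    case False
    then have pos: "0 < \<tau>" using t by auto
    have gt: "R < H s" if "0 \<le> s" "s < \<tau>" for s using t(2)[of s] t(1) that by force
    have "R \<le> H \<tau>"
    proof (rule ccontr)
      assume "\<not> R \<le> H \<tau>"
      then have "H \<tau> < R" by simp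
      moreover have "continuous_on {0..\<tau>} H" using cont t by (auto intro: continuous_on_subset)
      ultimately obtain s where "0 \<le> s" "s \<le> \<tau>" "H s = R"
        using IVT2'[of H \<tau> R 0] gt[of 0] pos by auto
      then show False using gt[of s] \<open>H \<tau> < R\<close> by (cases "s = \<tau>") auto
    qed
    moreover have "R \<le> h (pt z x s)" if s: "s \<in> {0..1}" for s
    proof -
      have "pt z x s = pt x z (1 - s)" using pt_swap[of z x s] z xy s by simp
      also have "\<dots> = pt x y ((1 - s) * \<tau>)"
        using pt_reparam[of x y 0 \<tau> "1 - s"] xy t s by (simp add: z_def)
      finally have "h (pt z x s) = H ((1 - s) * \<tau>)" by (simp add: H_def)
      moreover have "0 \<le> (1 - s) * \<tau>" "(1 - s) * \<tau> \<le> \<tau>" using s pos by (auto simp: mult_left_le_one_le)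
      ultimately show ?thesis using s pos gt[of "(1 - s) * \<tau>"] \<open>R \<le> H \<tau>\<close> by (cases "s = 0") auto
    qed
    ultimately show ?thesis using C(1)[OF xy(1) z(1)] z by (simp add: z_def H_def)
  qed
  then have "d z (\<sigma> (q x)) \<le> R + C"
    using dist_line_ge[OF z(1), of "q x"] z by (simp add: abs_minus_commute)
  then show ?thesis using t by (auto simp: z_def)
qed

text \<open>\<open>near_foot_exists\<close> at both ends gives points of the segment near the two
  extreme feet; convexity of the metric brings the points between them close to the line in
  between.\<close>

theorem contracting_exists: "\<exists>C. contracting Y \<sigma> C"
proof -
  obtain C where C: "C > 0" "\<And>x z. x \<in> M \<Longrightarrow> z \<in> M \<Longrightarrow> h z = R \<Longrightarrow> (\<forall>\<tau>\<in>{0..1}. R \<le> h (pt z x \<tau>)) \<Longrightarrow> \<bar>q z - q x\<bar> \<le> C"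
    using foot_diff_le_of_high_segment by blast
  have C0: "0 \<le> C" using C(1) by simp
  have "\<exists>\<tau>\<in>{0..1}. d (pt x y \<tau>) (\<sigma> t) \<le> R + 2 * C + 1"
    if xy: "x \<in> M" "y \<in> M" and far: "R + 2 * C + 1 \<le> \<bar>q x - q y\<bar>" and t: "t \<in> closed_segment (q x) (q y)"
    for x y t
  proof -
    have far': "2 * C < \<bar>q x - q y\<bar>" "2 * C < \<bar>q y - q x\<bar>" using far R by auto
    obtain a where a: "a \<in> {0..1}" "d (pt x y a) (\<sigma> (q x)) \<le> R + C"
      using near_foot_exists[OF C(2) C0 xy far'(1)] by blast
    obtain b where b: "b \<in> {0..1}" "d (pt y x b) (\<sigma> (q y)) \<le> R + C"
      using near_foot_exists[OF C(2) C0 xy(2,1) far'(2)] by blast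
    define b' where "b' = 1 - b"
    have b': "b' \<in> {0..1}" "pt y x b = pt x y b'"
      using b pt_swap[of y x b] xy by (auto simp: b'_def)
    obtain \<mu> where mu: "\<mu> \<in> {0..1}" "t = (1 - \<mu>) * q x + \<mu> * q y"
      using t by (auto simp: closed_segment_def)
    let ?z = "pt x y a" and ?w = "pt x y b'"
    have zw: "?z \<in> M" "?w \<in> M" using a b' xy by auto
    have "d (pt ?z ?w \<mu>) (pt (\<sigma> (q x)) (\<sigma> (q y)) \<mu>) \<le> (1 - \<mu>) * d ?z (\<sigma> (q x)) + \<mu> * d ?w (\<sigma> (q y))"
      using zw mu by (intro pt_convex) auto
    also have "\<dots> \<le> (1 - \<mu>) * (R + C) + \<mu> * (R + C)"
      using a b b' mu by (intro add_mono mult_left_mono) auto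
    also have "\<dots> \<le> R + 2 * C + 1" using C0 by (simp add: algebra_simps)
    finally have near: "d (pt ?z ?w \<mu>) (\<sigma> t) \<le> R + 2 * C + 1" using mu by (simp add: pt_line)
    \<comment> \<open>The order of the two near points along the segment is not known, so both cases
      are treated.\<close>
    have "\<exists>\<tau>\<in>{0..1}. pt ?z ?w \<mu> = pt x y \<tau>"
    proof (cases "a \<le> b'")
      case True
      then show ?thesis using pt_reparam[OF xy a(1) b'(1) True, of \<mu>] mu
        by (intro bexI[of _ "(1 - \<mu>) * a + \<mu> * b'"]) (use a b' mu in \<open>auto intro: convex_bound_le\<close>)
    next
      case False
      have "pt ?z ?w \<mu> = pt ?w ?z (1 - \<mu>)" using pt_swap[of ?z ?w \<mu>] zw mu by simp
      also have "\<dots> = pt x y ((1 - (1 - \<mu>)) * b' + (1 - \<mu>) * a)"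
        using pt_reparam[OF xy b'(1) a(1), of "1 - \<mu>"] False mu by simp
      finally show ?thesis
        by (intro bexI[of _ "(1 - (1 - \<mu>)) * b' + (1 - \<mu>) * a"]) (use a b' mu in \<open>auto intro: convex_bound_le\<close>)
    qed
    then show ?thesis using near by auto
  qed
  then show ?thesis using C0 R by (intro exI[of _ "R + 2 * C + 1"]) (auto simp: contracting_def)
qed

end

section \<open>Properness and flat half-planes\<close>

text \<open>A finite cover of the compact ball by open sets lying in compact sets has a Lebesgue
  number. A point of a slightly larger ball is close to a point of the old one on its geodesic to
  \<open>p\<close>, hence still covered.\<close>

lemma (in hadamard) mcball_extend_compact:
  assumes p: "p \<in> M" and lc: "locally_compact_space (mtopology_of Y)"
    and r: "0 \<le> r" "compactin (mtopology_of Y) (mcball_of Y p r)"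
  shows "\<exists>e>0. compactin (mtopology_of Y) (mcball_of Y p (r + e))"
proof -
  interpret ms: Metric_space M d by simp
  have top: "mtopology_of Y = ms.mtopology" "mcball_of Y = ms.mcball"
    by (simp_all add: mtopology_of_def mcball_of_def)
  let ?C = "{U. openin ms.mtopology U \<and> (\<exists>K. compactin ms.mtopology K \<and> U \<subseteq> K)}"
  have "ms.mcball p r \<subseteq> \<Union>?C"
  proof
    fix x assume "x \<in> ms.mcball p r"
    then have "x \<in> topspace ms.mtopology" by simp
    then show "x \<in> \<Union>?C" using lc unfolding locally_compact_space_def top by blast
  qed
  then obtain F where F: "finite F" "F \<subseteq> ?C" "ms.mcball p r \<subseteq> \<Union>F"
    using r(2) unfolding compactin_def top by (metis (no_types, lifting) mem_Collect_eq)
  then have "\<forall>U\<in>F. \<exists>K. compactin ms.mtopology K \<and> U \<subseteq> K" by blast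
  then obtain K where K: "\<And>U. U \<in> F \<Longrightarrow> compactin ms.mtopology (K U) \<and> U \<subseteq> K U"
    by metis
  have cK: "compactin ms.mtopology (\<Union>(K ` F))" using F K by (intro compactin_Union) auto
  have "openin ms.mtopology (\<Union>F)" using F by auto
  then obtain e where e: "e > 0" "\<And>x. x \<in> ms.mcball p r \<Longrightarrow> ms.mball x e \<subseteq> \<Union>F"
    using ms.lebesgue_number[of "ms.mcball p r" "{\<Union>F}"] r(2) F(3) unfolding top by auto
  have "ms.mcball p (r + e / 2) \<subseteq> \<Union>F"
  proof
    fix y assume y: "y \<in> ms.mcball p (r + e / 2)"
    then have yM: "y \<in> M" "d p y \<le> r + e / 2" by auto
    show "y \<in> \<Union>F"
    proof (cases "d p y \<le> r")
      case True
      then show ?thesis using F(3) yM p by auto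
    next
      case False
      define \<tau> where "\<tau> = r / d p y"
      have t: "0 \<le> \<tau>" "\<tau> \<le> 1" "\<tau> * d p y = r" using False r(1) by (auto simp: \<tau>_def divide_le_eq_1)
      have z: "pt p y \<tau> \<in> M" "d p (pt p y \<tau>) \<le> r" "d (pt p y \<tau>) y < e"
        using t p yM pt_dist_left[of p y \<tau>] pt_dist_right[of p y \<tau>] e(1)
        by (auto simp: left_diff_distrib)
      then have "y \<in> ms.mball (pt p y \<tau>) e" using yM by auto
      then show ?thesis using e(2)[of "pt p y \<tau>"] z p by auto
    qed
  qed
  then have "ms.mcball p (r + e / 2) \<subseteq> \<Union>(K ` F)" using K by blast
  then have "compactin ms.mtopology (ms.mcball p (r + e / 2))"
    using cK closed_compactin ms.closedin_mcball by blast
  then show ?thesis using e(1) unfolding top by (intro exI[of _ "e / 2"]) auto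
qed

text \<open>By completeness total boundedness suffices: pulling points towards \<open>p\<close> by
  at most \<open>e / 2\<close> lands in a smaller compact ball, whose finite
  \<open>e / 2\<close>-net is an \<open>e\<close>-net of the given ball.\<close>

lemma (in hadamard) mcball_limit_compact:
  assumes p: "p \<in> M" and r: "0 < r" "\<And>s. 0 \<le> s \<Longrightarrow> s < r \<Longrightarrow> compactin (mtopology_of Y) (mcball_of Y p s)"
  shows "compactin (mtopology_of Y) (mcball_of Y p r)"
proof -
  interpret ms: Metric_space M d by simp
  have top: "mtopology_of Y = ms.mtopology" "mcball_of Y = ms.mcball"
    by (simp_all add: mtopology_of_def mcball_of_def)
  have comp: "ms.mcomplete" using had by (simp add: hadamard_space_def mcomplete_of_def)
  have "ms.mtotally_bounded (ms.mcball p r)"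
    unfolding ms.mtotally_bounded_def
  proof (intro allI impI)
    fix e :: real assume e: "0 < e"
    define s where "s = max 0 (r - e / 2)"
    have s: "0 \<le> s" "s < r" "r - s \<le> e / 2" using r e by (auto simp: s_def max_def)
    have "ms.mtotally_bounded (ms.mcball p s)"
      using r(2)[OF s(1,2)] ms.compactin_imp_mtotally_bounded unfolding top by blast
    then obtain K where K: "finite K" "K \<subseteq> ms.mcball p s" "ms.mcball p s \<subseteq> (\<Union>x\<in>K. ms.mball x (e / 2))"
      using e unfolding ms.mtotally_bounded_def by (meson half_gt_zero)
    have "ms.mcball p r \<subseteq> (\<Union>x\<in>K. ms.mball x e)"
    proof
      fix y assume "y \<in> ms.mcball p r"
      then have y: "y \<in> M" "d p y \<le> r" by auto
      define \<tau> where "\<tau> = s / r"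
      have t: "0 \<le> \<tau>" "\<tau> \<le> 1" "\<tau> * r = s" using s r by (auto simp: \<tau>_def)
      define z where "z = pt p y \<tau>"
      have z: "z \<in> M" "d p z \<le> s" "d z y \<le> e / 2"
      proof -
        show "z \<in> M" using t p y by (auto simp: z_def)
        have "d p z = \<tau> * d p y" unfolding z_def using t p y by (intro pt_dist_left) auto
        also have "\<dots> \<le> \<tau> * r" using t y by (intro mult_left_mono) auto
        finally show "d p z \<le> s" using t by simp
        have "d z y = (1 - \<tau>) * d p y" unfolding z_def using t p y by (intro pt_dist_right) auto
        also have "\<dots> \<le> (1 - \<tau>) * r" using t y by (intro mult_left_mono) auto
        also have "\<dots> = r - s" using t by (simp add: algebra_simps)
        finally show "d z y \<le> e / 2" using s by simp
      qed
      then obtain x where x: "x \<in> K" "z \<in> ms.mball x (e / 2)" using K(3) p by auto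
      then have "d x y < e" using z y mdist_triangle[of x Y z y] by auto
      then show "y \<in> (\<Union>x\<in>K. ms.mball x e)" using x y by auto
    qed
    moreover have "K \<subseteq> ms.mcball p r" using K(2) s by auto
    ultimately show "\<exists>K. finite K \<and> K \<subseteq> ms.mcball p r \<and> ms.mcball p r \<subseteq> (\<Union>x\<in>K. ms.mball x e)"
      using K(1) by blast
  qed
  then have "compactin ms.mtopology (ms.mtopology closure_of (ms.mcball p r))"
    using ms.mtotally_bounded_eq_compact_closure_of[OF comp] by blast
  then show ?thesis unfolding top by (simp add: closure_of_closedin)
qed

text \<open>The Hopf-Rinow argument: at the infimum of the radii of noncompact balls the ball is
  compact by \<open>mcball_limit_compact\<close>, and \<open>mcball_extend_compact\<close> then
  contradicts the infimum.\<close>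

theorem (in hadamard) mcball_compact:
  assumes p: "p \<in> M" and lc: "locally_compact_space (mtopology_of Y)"
  shows "compactin (mtopology_of Y) (mcball_of Y p r)"
proof (rule ccontr)
  interpret ms: Metric_space M d by simp
  have top: "mtopology_of Y = ms.mtopology" "mcball_of Y = ms.mcball"
    by (simp_all add: mtopology_of_def mcball_of_def)
  let ?P = "\<lambda>r. compactin (mtopology_of Y) (mcball_of Y p r)"
  assume nr: "\<not> ?P r"
  have down: "?P s" if "?P t" "s \<le> t" for s t
    using that ms.mcball_subset_concentric[OF that(2), of p] unfolding top
    by (meson closed_compactin ms.closedin_mcball)
  let ?S = "{t. 0 \<le> t \<and> \<not> ?P t}"
  have P0: "?P 0"
  proof -
    have "mcball_of Y p 0 = {p}" using p by (auto simp: mcball_of_def ms.mcball_def order_antisym_conv)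
    then show ?thesis using p by simp
  qed
  have "0 \<le> r" using nr down[OF P0, of r] by linarith
  then have rS: "r \<in> ?S" using nr by simp
  define s where "s = Inf ?S"
  have bb: "bdd_below ?S" by (rule bdd_belowI[of _ 0]) auto
  have s0: "0 \<le> s" unfolding s_def using rS by (intro cInf_greatest) auto
  have below: "?P t" if "0 \<le> t" "t < s" for t
    using cInf_lower[OF _ bb, of t] that unfolding s_def by (metis (mono_tags, lifting) mem_Collect_eq not_le)
  have "?P s" using P0 mcball_limit_compact[OF p _ below] s0 by (cases "s = 0") auto
  then obtain e where e: "e > 0" "?P (s + e)" using mcball_extend_compact[OF p lc s0] by blast
  have "s + e \<le> s"
    unfolding s_def
  proof (rule cInf_greatest)
    fix t assume "t \<in> ?S"
    then show "Inf ?S + e \<le> t" using down[OF e(2), of t] unfolding s_def by force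
  qed (use rS in blast)
  then show False using e by simp
qed

section \<open>Flat half-planes as limits of almost flat strips\<close>

context gline
begin

lemma foot_height_isometry:
  assumes \<theta>: "\<And>x. x \<in> M \<Longrightarrow> \<theta> x \<in> M" "\<And>x y. x \<in> M \<Longrightarrow> y \<in> M \<Longrightarrow> d (\<theta> x) (\<theta> y) = d x y"
    and a: "\<And>t. \<theta> (\<sigma> t) = \<sigma> (t + a)" and x: "x \<in> M"
  shows "q (\<theta> x) = q x + a" "h (\<theta> x) = h x"
proof -
  have *: "d (\<theta> x) (\<sigma> (t + a)) = d x (\<sigma> t)" for t
    using \<theta>(2)[OF x, of "\<sigma> t"] a by simp
  show "q (\<theta> x) = q x + a"
  proof (rule foot_eqI)
    fix s
    show "d (\<theta> x) (\<sigma> (q x + a)) \<le> d (\<theta> x) (\<sigma> s)"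
      using *[of "q x"] *[of "s - a"] foot_le[OF x, of "s - a"] by (simp add: height_def)
  qed (use \<theta> x in auto)
  then show "h (\<theta> x) = h x" by (simp add: height_def *)
qed

text \<open>The sum of the squared diagonals of each rectangle is at most that of the squared sides, and each
  diagonal is at least as long as in the plane because the corners project to each other.\<close>

lemma flat_half_plane_of_rectangles:
  fixes \<Phi> :: "real \<times> real \<Rightarrow> 'a"
  assumes in_M: "\<And>y s. 0 \<le> y \<Longrightarrow> \<Phi> (y, s) \<in> M"
    and height: "\<And>y s. 0 \<le> y \<Longrightarrow> h (\<Phi> (y, s)) = y"
    and foot: "\<And>y s. 0 \<le> y \<Longrightarrow> q (\<Phi> (y, s)) = c + s"
    and hor: "\<And>y s s'. 0 \<le> y \<Longrightarrow> d (\<Phi> (y, s)) (\<Phi> (y, s')) \<le> \<bar>s - s'\<bar>"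
    and ver: "\<And>y y' s. 0 \<le> y \<Longrightarrow> 0 \<le> y' \<Longrightarrow> d (\<Phi> (y, s)) (\<Phi> (y', s)) \<le> \<bar>y - y'\<bar>"
  shows "bounds_flat_half_plane Y \<sigma>"
proof -
  interpret ms: Metric_space M d by simp
  have hor_eq: "d (\<Phi> (y, s)) (\<Phi> (y, s')) = \<bar>s - s'\<bar>" if "0 \<le> y" for y s s'
    using hor[OF that, of s s'] foot_lipschitz[OF in_M[OF that] in_M[OF that], of s s'] foot[OF that] by simp
  have le_aux: "(d (\<Phi> (y, s)) (\<Phi> (y', s')))\<^sup>2 = (y - y')\<^sup>2 + (s - s')\<^sup>2"
    if y: "0 \<le> y" "y \<le> y'" for y y' s s'
  proof -
    have y': "0 \<le> y'" using y by simp
    \<comment> \<open>The horizontal line at height \<open>y\<close> is itself a geodesic line, and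
      the heights show that \<open>\<Phi> (y', s')\<close> has foot \<open>s'\<close> on it.
      \<open>pythagoras\<close> for this line bounds the diagonals from below.\<close>
    interpret g: gline Y "\<lambda>t. \<Phi> (y, t)"
      by unfold_locales (use hor_eq[OF y(1)] in_M[OF y(1)] in \<open>auto simp: geodesic_on_def\<close>)
    have ge: "(y - y')\<^sup>2 + (s - s')\<^sup>2 \<le> (d (\<Phi> (y', s')) (\<Phi> (y, s)))\<^sup>2" for s s'
    proof -
      have b: "y' - y \<le> d (\<Phi> (y', s')) (\<Phi> (y, t))" for t
        using height_lipschitz[OF in_M[OF y'] in_M[OF y(1)], of s' t] height y y' by simp
      have "foot Y (\<lambda>t. \<Phi> (y, t)) (\<Phi> (y', s')) = s'"
      proof (rule g.foot_eqI[OF in_M[OF y']])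
        fix t show "d (\<Phi> (y', s')) (\<Phi> (y, s')) \<le> d (\<Phi> (y', s')) (\<Phi> (y, t))"
          using b[of t] ver[OF y' y(1), of s'] y by simp
      qed
      moreover have "(y' - y)\<^sup>2 \<le> (d (\<Phi> (y', s')) (\<Phi> (y, s')))\<^sup>2"
        using b[of s'] y by (intro power_mono) auto
      ultimately show ?thesis
        using g.pythagoras[OF in_M[OF y', of s'], of s] by (simp add: height_def power2_commute)
    qed
    have v: "(d (\<Phi> (y, s)) (\<Phi> (y', s)))\<^sup>2 \<le> (y - y')\<^sup>2" for s
      using ver[OF y(1) y', of s] by (metis mdist_nonneg power2_abs power_mono)
    have "(d (\<Phi> (y, s)) (\<Phi> (y', s')))\<^sup>2 + (d (\<Phi> (y, s')) (\<Phi> (y', s)))\<^sup>2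
        \<le> (d (\<Phi> (y, s)) (\<Phi> (y, s')))\<^sup>2 + (d (\<Phi> (y, s')) (\<Phi> (y', s')))\<^sup>2
          + (d (\<Phi> (y', s')) (\<Phi> (y', s)))\<^sup>2 + (d (\<Phi> (y', s)) (\<Phi> (y, s)))\<^sup>2"
      using in_M y y' by (intro quadrilateral) auto
    also have "\<dots> \<le> (s - s')\<^sup>2 + (y - y')\<^sup>2 + (s - s')\<^sup>2 + (y - y')\<^sup>2"
      using v[of s] v[of s'] hor_eq[OF y(1)] hor_eq[OF y'] by (simp add: mdist_commute power2_commute)
    finally show ?thesis using ge[of s' s] ge[of s s']
      by (simp add: mdist_commute power2_commute)
  qed
  have eq: "d (\<Phi> (y, s)) (\<Phi> (y', s')) = sqrt ((y - y')\<^sup>2 + (s - s')\<^sup>2)" if y: "0 \<le> y" "0 \<le> y'" for y y' s s'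
  proof -
    have "(d (\<Phi> (y, s)) (\<Phi> (y', s')))\<^sup>2 = (y - y')\<^sup>2 + (s - s')\<^sup>2"
      using le_aux[of y y' s s'] le_aux[of y' y s' s] y by (cases "y \<le> y'") (auto simp: mdist_commute power2_commute)
    then show ?thesis by (metis mdist_nonneg real_sqrt_unique)
  qed
  \<comment> \<open>The shift by \<open>c\<close> makes \<open>\<phi> (0, s)\<close> equal to
    \<open>\<sigma> s\<close>.\<close>
  define \<phi> where "\<phi> p = \<Phi> (fst p, snd p - c)" for p
  let ?H = "{0..} \<times> UNIV :: (real \<times> real) set"
  have phiM: "\<phi> p \<in> M" if "p \<in> ?H" for p using that in_M by (auto simp: \<phi>_def)
  have iso: "d (\<phi> p) (\<phi> q') = dist p q'" if "p \<in> ?H" "q' \<in> ?H" for p q'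
    using that eq by (auto simp: \<phi>_def dist_prod_def dist_real_def)
  have bd: "\<phi> ` ({0} \<times> UNIV) = range \<sigma>"
  proof -
    have "\<Phi> (0, s) = \<sigma> (c + s)" for s
      using height[of 0 s] foot[of 0 s] in_M[of 0 s] by (simp add: height_def)
    then have *: "\<phi> (0, s) = \<sigma> s" for s by (simp add: \<phi>_def)
    have "{0} \<times> UNIV = range (Pair (0::real) :: real \<Rightarrow> _)" by auto
    then have "\<phi> ` ({0} \<times> UNIV) = range (\<lambda>s. \<phi> (0, s))" by (simp only: image_image)
    then show ?thesis by (simp only: *)
  qed
  have closed: "closedin ms.mtopology (\<phi> ` ?H)"
    unfolding ms.metric_closedin_iff_sequentially_closed
  proof (intro conjI allI impI)
    show "\<phi> ` ?H \<subseteq> M" using phiM by auto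
    fix x l assume "range x \<subseteq> \<phi> ` ?H \<and> limitin ms.mtopology x l sequentially"
    then have r: "range x \<subseteq> \<phi> ` ?H" and lim: "limitin ms.mtopology x l sequentially" by auto
    have "\<forall>n. \<exists>p\<in>?H. x n = \<phi> p" using r by blast
    then obtain p where p: "\<And>n. p n \<in> ?H" "\<And>n. x n = \<phi> (p n)" by metis
    have l: "l \<in> M" using lim by (simp add: ms.limitin_metric)
    have xl: "(\<lambda>n. d (x n) l) \<longlonglongrightarrow> 0" using lim by (simp add: ms.limitin_metric_dist_null)
    have "Cauchy p"
    proof (rule metric_CauchyI)
      fix e :: real assume "0 < e"
      then obtain N where N: "\<And>n. n \<ge> N \<Longrightarrow> d (x n) l < e / 2"
        using order_tendstoD(2)[OF xl, of "e / 2"] by (auto simp: eventually_sequentially)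
      have "dist (p m) (p n) < e" if "m \<ge> N" "n \<ge> N" for m n
        using N[OF that(1)] N[OF that(2)] mdist_triangle[of "x m" Y l "x n"] l phiM[OF p(1)] iso[OF p(1) p(1), of m n]
        by (simp add: p(2) mdist_commute)
      then show "\<exists>N. \<forall>m\<ge>N. \<forall>n\<ge>N. dist (p m) (p n) < e" by blast
    qed
    then obtain p0 where p0: "p \<longlonglongrightarrow> p0" using Cauchy_convergent_iff convergent_def by blast
    have "closed ?H" by (intro closed_Times) auto
    then have H0: "p0 \<in> ?H" using closed_sequentially p0 p(1) by blast
    have sum: "(\<lambda>n. d (x n) l + dist (p n) p0) \<longlonglongrightarrow> 0 + 0"
      using xl p0[THEN tendsto_dist_iff[THEN iffD1]] by (rule tendsto_add)
    have le: "d l (\<phi> p0) \<le> d (x n) l + dist (p n) p0" for n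
      using mdist_triangle[of l Y "x n" "\<phi> p0"] l phiM[OF H0] phiM[OF p(1)[of n]] iso[OF p(1)[of n] H0]
      by (simp add: p(2) mdist_commute)
    have "d l (\<phi> p0) \<le> 0 + 0" by (rule LIMSEQ_le_const[OF sum]) (intro exI allI impI le)
    then have "d l (\<phi> p0) = 0" using mdist_nonneg[of Y l "\<phi> p0"] by linarith
    then have "l = \<phi> p0" using l phiM[OF H0] by simp
    then show "l \<in> \<phi> ` ?H" using H0 by blast
  qed
  have "geodesically_convex Y (\<phi> ` ?H)"
    unfolding geodesically_convex_def
  proof (intro conjI ballI allI impI)
    show "\<phi> ` ?H \<subseteq> M" using phiM by auto
    fix x y e assume "x \<in> \<phi> ` ?H" "y \<in> \<phi> ` ?H" and e: "geodesic_between Y x y e"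
    then obtain a b where ab: "a \<in> ?H" "b \<in> ?H" "x = \<phi> a" "y = \<phi> b" by blast
    have xy: "x \<in> M" "y \<in> M" using ab phiM by auto
    show "e ` {0..d x y} \<subseteq> \<phi> ` ?H"
    proof
      fix z assume "z \<in> e ` {0..d x y}"
      then obtain t where t: "t \<in> {0..d x y}" "z = e t" by blast
      define \<tau> where "\<tau> = t / d x y"
      have tau: "0 \<le> \<tau>" "\<tau> \<le> 1" "t = \<tau> * d x y"
        using t by (cases "d x y = 0"; auto simp: \<tau>_def divide_le_eq_1)+
      define w where "w = (1 - \<tau>) *\<^sub>R a + \<tau> *\<^sub>R b"
      have "convex ?H" by (intro convex_Times) auto
      then have w: "w \<in> ?H" unfolding w_def using ab tau by (intro convexD) auto
      have "a - w = \<tau> *\<^sub>R (a - b)" "w - b = (1 - \<tau>) *\<^sub>R (a - b)" by (auto simp: w_def algebra_simps)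
      then have "dist a w = \<tau> * dist a b" "dist w b = (1 - \<tau>) * dist a b" using tau by (auto simp: dist_norm)
      then have "\<phi> w = pt x y \<tau>" using iso ab w tau phiM by (intro pt_unique) auto
      then have "z = \<phi> w" using pt_geodesic[OF xy e tau(1,2)] t(2) tau(3) by simp
      then show "z \<in> \<phi> ` ?H" using w by blast
    qed
  qed
  then show ?thesis unfolding bounds_flat_half_plane_def
    using closed bd iso by (intro exI[of _ "\<phi> ` ?H"] conjI exI[of _ \<phi>] ballI) (auto simp: mtopology_of_def)
qed

text \<open>Negating \<open>nf_line\<close> at a large height yields a high segment whose feet move
  at almost full speed. A translation along \<open>\<sigma>\<close> puts the foot of its midpoint
  into \<open>{0..l}\<close>, which keeps the segments for different \<open>n\<close> over a common
  part of the line.\<close>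

lemma approx_strip_exists:
  assumes l: "0 < l"
    and trans: "\<And>k::int. \<exists>\<theta>. (\<forall>x\<in>M. \<theta> x \<in> M) \<and> (\<forall>x\<in>M. \<forall>y\<in>M. d (\<theta> x) (\<theta> y) = d x y)
        \<and> (\<forall>t. \<theta> (\<sigma> t) = \<sigma> (t + of_int k * l))"
    and n: "1 \<le> n"
    and no_nf: "\<not> (\<exists>R D \<kappa>. nf_line Y \<sigma> R D \<kappa>)"
  shows "\<exists>W. \<forall>s\<in>{-n/2..n/2}. W s \<in> M \<and> n\<^sup>2 \<le> h (W s) \<and> \<bar>q (W s) - q (W 0) - s\<bar> \<le> 1 / n
     \<and> (\<forall>s'\<in>{-n/2..n/2}. d (W s) (W s') \<le> \<bar>s - s'\<bar>) \<and> q (W 0) \<in> {0..l}"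
proof -
  \<comment> \<open>The summand \<open>n\<close> in the height pays for the length of the segment,
    so that all of it stays above \<open>n\<^sup>2\<close>.\<close>
  have "\<not> nf_line Y \<sigma> (n\<^sup>2 + n) n (1 / n)" using no_nf by blast
  then obtain w w' where w: "w \<in> M" "w' \<in> M" "n\<^sup>2 + n \<le> h w" "n\<^sup>2 + n \<le> h w'" "d w w' \<le> n"
      "n - 1 / n < \<bar>q w - q w'\<bar>"
    using n gline_axioms by (auto simp: nf_line_def nf_line_axioms_def not_le add_pos_pos)
  have "\<exists>a b. a \<in> M \<and> b \<in> M \<and> n\<^sup>2 + n \<le> h a \<and> d a b \<le> n \<and> n - 1 / n < q b - q a"
  proof (cases "q w \<le> q w'")
    case True then show ?thesis using w by (intro exI[of _ w] exI[of _ w']) auto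
  next
    case False then show ?thesis using w by (intro exI[of _ w'] exI[of _ w]) (auto simp: mdist_commute)
  qed
  then obtain a b where ab: "a \<in> M" "b \<in> M" "n\<^sup>2 + n \<le> h a" "d a b \<le> n" "n - 1 / n < q b - q a" by blast
  define c where "c = q (pt a b (1/2))"
  obtain \<theta> where \<theta>: "\<And>x. x \<in> M \<Longrightarrow> \<theta> x \<in> M" "\<And>x y. x \<in> M \<Longrightarrow> y \<in> M \<Longrightarrow> d (\<theta> x) (\<theta> y) = d x y"
      "\<And>t. \<theta> (\<sigma> t) = \<sigma> (t + of_int (- \<lfloor>c / l\<rfloor>) * l)"
    using trans[of "- \<lfloor>c / l\<rfloor>"] by blast
  define W where "W s = \<theta> (pt a b (s / n + 1 / 2))" for s
  have tau: "s / n + 1 / 2 \<in> {0..1}" if "s \<in> {-n/2..n/2}" for s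
    using that n by (auto simp: field_simps)
  have base: "pt a b (s / n + 1 / 2) \<in> M" if "s \<in> {-n/2..n/2}" for s
    using tau[OF that] ab by auto
  have qW: "q (W s) = q (pt a b (s / n + 1 / 2)) - of_int \<lfloor>c / l\<rfloor> * l"
    and hW: "h (W s) = h (pt a b (s / n + 1 / 2))" if "s \<in> {-n/2..n/2}" for s
    using foot_height_isometry[OF \<theta> base[OF that]] by (auto simp: W_def)
  have WM: "W s \<in> M" if "s \<in> {-n/2..n/2}" for s using base[OF that] \<theta>(1) by (auto simp: W_def)
  have Wd: "d (W s) (W s') \<le> \<bar>s - s'\<bar>" if s: "s \<in> {-n/2..n/2}" "s' \<in> {-n/2..n/2}" for s s'
  proof -
    have "d (W s) (W s') = \<bar>(s / n + 1 / 2) - (s' / n + 1 / 2)\<bar> * d a b"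
      unfolding W_def using \<theta>(2) base s tau ab pt_dist by metis
    also have "\<dots> \<le> \<bar>(s / n + 1 / 2) - (s' / n + 1 / 2)\<bar> * n" using ab by (intro mult_left_mono) auto
    also have "\<dots> = \<bar>s - s'\<bar>" using n by (simp add: diff_divide_distrib[symmetric] abs_divide)
    finally show ?thesis .
  qed
  have ends: "- n / 2 \<in> {-n/2..n/2}" "n / 2 \<in> {-n/2..n/2}" "0 \<in> {-n/2..n/2}" using n by auto
  have q_lip: "\<bar>q (W s) - q (W s')\<bar> \<le> \<bar>s - s'\<bar>" if "s \<in> {-n/2..n/2}" "s' \<in> {-n/2..n/2}" for s s'
    using foot_lipschitz[OF WM WM] Wd that by (meson order_trans)
  have "q (W (n / 2)) - q (W (- n / 2)) = q b - q a"
    using qW[OF ends(1)] qW[OF ends(2)] n ab by simp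
  then have tot: "n - 1 / n < q (W (n / 2)) - q (W (- n / 2))" using ab by simp
  \<comment> \<open>The feet gain more than \<open>n - 1 / n\<close> in total at speed at most 1, so
    no subinterval falls short by more than \<open>1 / n\<close>.\<close>
  have low: "(t - s) - 1 / n \<le> q (W t) - q (W s)" if "s \<in> {-n/2..n/2}" "t \<in> {-n/2..n/2}" "s \<le> t" for s t
    using q_lip[OF ends(2) that(2)] q_lip[OF that(1) ends(1)] that tot by (auto simp: abs_le_iff)
  have h_low: "n\<^sup>2 \<le> h (W s)" if s: "s \<in> {-n/2..n/2}" for s
  proof -
    have "d a (pt a b (s / n + 1 / 2)) \<le> 1 * n"
      using pt_dist_left[OF ab(1,2), of "s / n + 1 / 2"] tau[OF s] ab(4)
      by (auto intro: order_trans[OF mult_left_le_one_le])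
    then show ?thesis using height_lipschitz[OF ab(1) base[OF s]] ab(3) hW[OF s] by (simp add: abs_le_iff)
  qed
  have q0: "q (W 0) \<in> {0..l}"
  proof -
    have fl: "of_int \<lfloor>c / l\<rfloor> \<le> c / l" "c / l < of_int \<lfloor>c / l\<rfloor> + 1" by linarith+
    have "of_int \<lfloor>c / l\<rfloor> * l \<le> c" "c < (of_int \<lfloor>c / l\<rfloor> + 1) * l"
      using pos_le_divide_eq[OF l, THEN iffD1, OF fl(1)] pos_divide_less_eq[OF l, THEN iffD1, OF fl(2)] by auto
    then show ?thesis using qW[OF ends(3)] by (simp add: c_def distrib_right)
  qed
  have "\<bar>q (W s) - q (W 0) - s\<bar> \<le> 1 / n" if s: "s \<in> {-n/2..n/2}" for s
  proof (cases "0 \<le> s")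
    case True
    then show ?thesis using low[OF ends(3) s] q_lip[OF s ends(3)] n by (simp add: abs_le_iff)
  next
    case False
    then show ?thesis using low[OF s ends(3)] q_lip[OF s ends(3)] n by (simp add: abs_le_iff)
  qed
  then show ?thesis using WM Wd h_low q0 by (intro exI[of _ W]) blast
qed

text \<open>Tychonoff's theorem replaces the diagonal sequence argument: pairs of values of a cluster
  point are approximated along infinitely many members of the sequence.\<close>

lemma pointwise_cluster_exists:
  fixes \<Psi> :: "nat \<Rightarrow> 'b \<Rightarrow> 'a"
  assumes proper: "\<And>x r. x \<in> M \<Longrightarrow> compactin (mtopology_of Y) (mcball_of Y x r)"
    and p: "p \<in> M" and bound: "\<And>n a. \<Psi> n a \<in> M" "\<And>n a. d p (\<Psi> n a) \<le> B a"
  shows "\<exists>\<Phi>. (\<forall>a. \<Phi> a \<in> M) \<and>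
     (\<forall>a b e N. 0 < e \<longrightarrow> (\<exists>n\<ge>N. d (\<Psi> n a) (\<Phi> a) < e \<and> d (\<Psi> n b) (\<Phi> b) < e))"
proof -
  interpret ms: Metric_space M d by simp
  have top: "mtopology_of Y = ms.mtopology" "mcball_of Y = ms.mcball"
    by (simp_all add: mtopology_of_def mcball_of_def)
  let ?T = "\<lambda>a. subtopology ms.mtopology (ms.mcball p (B a))"
  let ?P = "product_topology ?T UNIV"
  have "compact_space (?T a)" for a
    using proper[OF p, of "B a"] unfolding top by (rule compact_space_subtopology)
  then have cP: "compact_space ?P" by (simp add: compact_space_product_topology)
  have topT: "topspace (?T a) = ms.mcball p (B a)" for a
    by (auto simp: topspace_subtopology)
  have in_P: "\<Psi> n \<in> topspace ?P" for n
    using bound p by (simp add: topT PiE_iff)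
  let ?C = "\<lambda>n. ?P closure_of (\<Psi> ` {n..})"
  have "(\<Inter>n. ?C n) \<noteq> {}"
  proof (rule compact_space_imp_nest[OF cP])
    show "closedin ?P (?C n)" for n by simp
    show "?C n \<noteq> {}" for n
      using closure_of_subset[of "\<Psi> ` {n..}" ?P] in_P by blast
    show "decseq ?C" unfolding decseq_def by (intro allI impI closure_of_mono image_mono) auto
  qed
  then obtain \<Phi> where Phi: "\<And>n. \<Phi> \<in> ?C n" by blast
  then have Phi_top: "\<Phi> \<in> topspace ?P" using closure_of_subset_topspace[of ?P "\<Psi> ` {0..}"] Phi[of 0] by blast
  have PhiM: "\<Phi> a \<in> M" for a using Phi_top by (simp add: topT PiE_iff)
  have "\<exists>n\<ge>N. d (\<Psi> n a) (\<Phi> a) < e \<and> d (\<Psi> n b) (\<Phi> b) < e" if e: "0 < e" for a b e N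
  proof -
    let ?U = "\<lambda>a. {f \<in> topspace ?P. f a \<in> topspace (?T a) \<inter> ms.mball (\<Phi> a) e}"
    have "openin ?P (?U a)" for a
    proof (rule openin_continuous_map_preimage)
      show "continuous_map ?P (?T a) (\<lambda>f. f a)" by (rule continuous_map_product_projection) simp
      show "openin (?T a) (topspace (?T a) \<inter> ms.mball (\<Phi> a) e)"
        unfolding topT by (metis openin_subtopology_Int2 ms.openin_mball)
    qed
    then have op: "openin ?P (?U a \<inter> ?U b)" by (intro openin_Int)
    have mem: "\<Phi> \<in> ?U a \<inter> ?U b" using Phi_top PhiM e by (auto simp: topT PiE_iff)
    have all: "\<forall>T. \<Phi> \<in> T \<and> openin ?P T \<longrightarrow> (\<exists>y. y \<in> \<Psi> ` {N..} \<and> y \<in> T)"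
      using Phi[of N] unfolding in_closure_of by (rule conjunct2)
    have "\<exists>y. y \<in> \<Psi> ` {N..} \<and> y \<in> ?U a \<inter> ?U b"
      by (rule all[THEN spec, THEN mp, OF conjI[OF mem op]])
    then obtain g where g: "g \<in> \<Psi> ` {N..}" "g \<in> ?U a \<inter> ?U b" by (elim exE conjE)
    obtain n where n: "n \<ge> N" "g = \<Psi> n" using g(1) by auto
    have "g a \<in> ms.mball (\<Phi> a) e" "g b \<in> ms.mball (\<Phi> b) e" using g(2) by simp_all
    then show ?thesis using n by (intro exI[of _ n]) (simp add: mdist_commute)
  qed
  then show ?thesis using PhiM by blast
qed

end

section \<open>Axes of rank one isometries\<close>

lemma inverse_le_of_large:
  fixes r e :: real
  assumes "4 / e \<le> r" "0 < e" "0 < r" shows "1 / r \<le> e / 4"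
  using assms by (simp add: field_simps)

lemma divide_square_le_of_large:
  fixes x r e :: real
  assumes "3 * x / e \<le> r" "0 < e" "1 \<le> r" shows "x / r\<^sup>2 \<le> e / 3"
proof -
  have "3 * x \<le> r * e" using assms by (simp add: field_simps)
  also have "\<dots> \<le> r\<^sup>2 * e" using assms by (intro mult_right_mono) (auto simp: power2_eq_square)
  finally have "x \<le> e / 3 * r\<^sup>2" by (simp add: mult.commute)
  then show ?thesis using assms by (subst pos_divide_le_eq) auto
qed

context gline begin

text \<open>The perpendiculars from the high segment \<open>W n\<close> to the line, cut at common
  heights, span an almost flat rectangle: convexity keeps the horizontal sides short and their feet
  keep them long. Properness yields a limit without errors, which is a flat half-plane.\<close>

theorem nf_of_not_flat_half_plane:
  assumes proper: "\<And>x r. x \<in> M \<Longrightarrow> compactin (mtopology_of Y) (mcball_of Y x r)"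
    and l: "0 < l"
    and trans: "\<And>k::int. \<exists>\<theta>. (\<forall>x\<in>M. \<theta> x \<in> M) \<and> (\<forall>x\<in>M. \<forall>y\<in>M. d (\<theta> x) (\<theta> y) = d x y)
        \<and> (\<forall>t. \<theta> (\<sigma> t) = \<sigma> (t + of_int k * l))"
    and no_flat: "\<not> bounds_flat_half_plane Y \<sigma>"
  shows "\<exists>R D \<kappa>. nf_line Y \<sigma> R D \<kappa>"
proof (rule ccontr)
  assume no_nf: "\<not> ?thesis"
  let ?I = "\<lambda>n::nat. {- real (Suc n) / 2..real (Suc n) / 2}"
  have "\<forall>n. \<exists>W. \<forall>s\<in>?I n. W s \<in> M \<and> (real (Suc n))\<^sup>2 \<le> h (W s) \<and> \<bar>q (W s) - q (W 0) - s\<bar> \<le> 1 / real (Suc n)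
     \<and> (\<forall>s'\<in>?I n. d (W s) (W s') \<le> \<bar>s - s'\<bar>) \<and> q (W 0) \<in> {0..l}"
    by (intro allI approx_strip_exists[OF l trans _ no_nf]) simp
  from choice[OF this] obtain W where W_all: "\<forall>n. \<forall>s\<in>?I n. W n s \<in> M \<and> (real (Suc n))\<^sup>2 \<le> h (W n s)
     \<and> \<bar>q (W n s) - q (W n 0) - s\<bar> \<le> 1 / real (Suc n)
     \<and> (\<forall>s'\<in>?I n. d (W n s) (W n s') \<le> \<bar>s - s'\<bar>) \<and> q (W n 0) \<in> {0..l}" ..
  have W: "W n s \<in> M" "(real (Suc n))\<^sup>2 \<le> h (W n s)" "\<bar>q (W n s) - q (W n 0) - s\<bar> \<le> 1 / real (Suc n)"
      "s' \<in> ?I n \<Longrightarrow> d (W n s) (W n s') \<le> \<bar>s - s'\<bar>" "q (W n 0) \<in> {0..l}"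
    if "s \<in> ?I n" for n s s'
    using W_all that by blast+
  \<comment> \<open>\<open>ok n\<close> delimits the rectangle below \<open>W n\<close>. Outside it
    \<open>\<Psi> n\<close> takes the default value \<open>\<sigma> 0\<close>, invisible in the
    limit because every point of the half-plane is eventually inside.\<close>
  define ok where "ok n p \<longleftrightarrow> fst p \<in> {0..(real (Suc n))\<^sup>2} \<and> snd p \<in> ?I n" for n and p :: "real \<times> real"
  define \<Psi> where "\<Psi> n p = (if ok n p then pt (\<sigma> (q (W n (snd p)))) (W n (snd p)) (fst p / h (W n (snd p))) else \<sigma> 0)" for n p
  have hpos: "0 < h (W n s)" if "s \<in> ?I n" for n s
  proof -
    have "0 < (real (Suc n))\<^sup>2" by simp
    then show ?thesis using W(2)[OF that] by linarith
  qed
  have tau: "0 \<le> y / h (W n s)" "y / h (W n s) \<le> 1" if "ok n (y, s)" for n y s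
    using that W(2)[of s n] hpos[of s n] by (auto simp: ok_def)
  have PsiM: "\<Psi> n p \<in> M" for n p
    using tau W(1)[of "snd p" n] by (cases p) (auto simp: \<Psi>_def ok_def)
  have Psi_q: "q (\<Psi> n (y, s)) = q (W n s)" and Psi_h: "h (\<Psi> n (y, s)) = y" if "ok n (y, s)" for n y s
    using foot_perp[OF W(1), of s n "y / h (W n s)"] tau[OF that] hpos[of s n] that
    by (auto simp: \<Psi>_def ok_def)
  have Psi_foot: "\<bar>q (\<Psi> n (y, s)) - q (W n 0) - s\<bar> \<le> 1 / real (Suc n)" if "ok n (y, s)" for n y s
    using Psi_q[OF that] W(3)[of s n] that by (simp add: ok_def)
  \<comment> \<open>At equal relative height the distance is at most
    \<open>\<bar>s - s'\<bar>\<close>. Passing to equal absolute height costs the second summand,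
    since the heights of the two upper ends differ by at most
    \<open>\<bar>s - s'\<bar>\<close>.\<close>
  have Psi_hor: "d (\<Psi> n (y, s)) (\<Psi> n (y, s')) \<le> \<bar>s - s'\<bar> + y * \<bar>s - s'\<bar> / (real (Suc n))\<^sup>2"
    if ok: "ok n (y, s)" "ok n (y, s')" for n y s s'
  proof -
    have s: "s \<in> ?I n" "s' \<in> ?I n" and y: "0 \<le> y" using ok by (auto simp: ok_def)
    let ?h = "h (W n s)" and ?h' = "h (W n s')"
    let ?z = "pt (\<sigma> (q (W n s'))) (W n s') (y / ?h)"
    have zM: "?z \<in> M" if "y / ?h \<le> 1" using that W(1)[OF s(2)] tau(1)[OF ok(1)] by auto
    have "d (\<Psi> n (y, s)) (\<Psi> n (y, s')) \<le> d (\<Psi> n (y, s)) ?z + d ?z (\<Psi> n (y, s'))"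
      using PsiM zM tau(2)[OF ok(1)] by (intro mdist_triangle) auto
    also have "d (\<Psi> n (y, s)) ?z \<le> (1 - y / ?h) * \<bar>s - s'\<bar> + (y / ?h) * \<bar>s - s'\<bar>"
    proof -
      have "d (\<Psi> n (y, s)) ?z \<le> (1 - y / ?h) * d (\<sigma> (q (W n s))) (\<sigma> (q (W n s'))) + (y / ?h) * d (W n s) (W n s')"
      proof -
        have "\<Psi> n (y, s) = pt (\<sigma> (q (W n s))) (W n s) (y / ?h)" using ok(1) by (simp add: \<Psi>_def)
        then show ?thesis
          using pt_convex[OF line_in W(1)[OF s(1)] line_in W(1)[OF s(2)] tau[OF ok(1)]] by simp
      qed
      also have "\<dots> \<le> (1 - y / ?h) * \<bar>s - s'\<bar> + (y / ?h) * \<bar>s - s'\<bar>"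
        using tau[OF ok(1)] W(4)[OF s] foot_lipschitz[OF W(1)[OF s(1)] W(1)[OF s(2)]]
        by (intro add_mono mult_left_mono) (auto simp: line_dist)
      finally show ?thesis .
    qed
    also have "\<dots> = \<bar>s - s'\<bar>" by (simp add: algebra_simps)
    also have "d ?z (\<Psi> n (y, s')) = \<bar>y / ?h - y / ?h'\<bar> * ?h'"
      using ok(2) pt_dist[of "\<sigma> (q (W n s'))" "W n s'" "y / ?h" "y / ?h'"] tau[OF ok(1)] tau[OF ok(2)] W(1)[OF s(2)]
      by (simp add: \<Psi>_def height_def mdist_commute)
    also have "\<dots> = \<bar>(y / ?h - y / ?h') * ?h'\<bar>" using hpos[OF s(2)] by (simp add: abs_mult)
    also have "(y / ?h - y / ?h') * ?h' = (?h' - ?h) * y / ?h"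
      using hpos[OF s(1)] hpos[OF s(2)] by (simp add: field_simps)
    also have "\<bar>\<dots>\<bar> = \<bar>?h' - ?h\<bar> * y / ?h" using hpos[OF s(1)] y by (simp add: abs_mult)
    also have "\<dots> \<le> \<bar>s - s'\<bar> * y / (real (Suc n))\<^sup>2"
    proof (intro frac_le mult_right_mono)
      show "\<bar>?h' - ?h\<bar> \<le> \<bar>s - s'\<bar>"
        using height_lipschitz[OF W(1)[OF s(2)] W(1)[OF s(1)]] W(4)[OF s] by (simp add: mdist_commute)
    qed (use y W(2)[OF s(1)] in auto)
    finally show ?thesis by (simp add: mult.commute)
  qed
  have Psi_ver: "d (\<Psi> n (y, s)) (\<Psi> n (y', s)) = \<bar>y - y'\<bar>" if ok: "ok n (y, s)" "ok n (y', s)" for n y y' s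
  proof -
    have s: "s \<in> ?I n" using ok by (auto simp: ok_def)
    have "d (\<Psi> n (y, s)) (\<Psi> n (y', s)) = \<bar>y / h (W n s) - y' / h (W n s)\<bar> * h (W n s)"
      using ok pt_dist[of "\<sigma> (q (W n s))" "W n s" "y / h (W n s)" "y' / h (W n s)"] tau[OF ok(1)] tau[OF ok(2)] W(1)[OF s]
      by (simp add: \<Psi>_def height_def mdist_commute)
    also have "\<dots> = \<bar>(y / h (W n s) - y' / h (W n s)) * h (W n s)\<bar>" using hpos[OF s] by (simp add: abs_mult)
    also have "\<dots> = \<bar>y - y'\<bar>" using hpos[OF s] by (simp add: left_diff_distrib)
    finally show ?thesis .
  qed
  have Psi_bound: "d (\<sigma> 0) (\<Psi> n p) \<le> \<bar>fst p\<bar> + \<bar>snd p\<bar> + 1 + l" for n p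
  proof (cases "ok n p")
    case True
    obtain y s where ys: "p = (y, s)" by (cases p)
    have ok: "ok n (y, s)" and s: "s \<in> ?I n" and y: "0 \<le> y" using True ys by (auto simp: ok_def)
    have "\<bar>q (\<Psi> n p)\<bar> \<le> \<bar>s\<bar> + 1 / real (Suc n) + l"
      using Psi_foot[OF ok] W(5)[OF s] ys by (auto simp: abs_le_iff)
    moreover have "1 / real (Suc n) \<le> 1" by simp
    ultimately have "\<bar>q (\<Psi> n p)\<bar> \<le> \<bar>s\<bar> + 1 + l" by linarith
    then show ?thesis
      using dist_line_ge[OF PsiM, of n p 0] Psi_h[OF ok] ys y by (simp add: mdist_commute)
  qed (use l in \<open>auto simp: \<Psi>_def\<close>)
  have "\<exists>\<Phi>. (\<forall>a. \<Phi> a \<in> M) \<and>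
     (\<forall>a b e N. 0 < e \<longrightarrow> (\<exists>n\<ge>N. d (\<Psi> n a) (\<Phi> a) < e \<and> d (\<Psi> n b) (\<Phi> b) < e))"
    by (rule pointwise_cluster_exists[OF proper line_in PsiM Psi_bound])
  then obtain \<Phi> where "(\<forall>a. \<Phi> a \<in> M) \<and>
     (\<forall>a b e N. 0 < e \<longrightarrow> (\<exists>n\<ge>N. d (\<Psi> n a) (\<Phi> a) < e \<and> d (\<Psi> n b) (\<Phi> b) < e))" ..
  then have PhiM: "\<And>p. \<Phi> p \<in> M"
    and Phi: "\<And>a b e N. 0 < e \<Longrightarrow> \<exists>n\<ge>N. d (\<Psi> n a) (\<Phi> a) < e \<and> d (\<Psi> n b) (\<Phi> b) < e"
    by blast+
  have ev: "\<exists>N. \<forall>n\<ge>N. ok n (y, s)" if y: "0 \<le> y" for y s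
  proof -
    obtain N where N: "max y (2 * \<bar>s\<bar>) \<le> real N" using real_arch_simple by blast
    have "ok n (y, s)" if "N \<le> n" for n
    proof -
      have "real N \<le> real n" using that by simp
      then have n: "y \<le> real (Suc n)" "2 * \<bar>s\<bar> \<le> real (Suc n)" using N by (simp_all add: max_def split: if_splits)
      have "real (Suc n) * 1 \<le> real (Suc n) * real (Suc n)" by (intro mult_left_mono) auto
      then have "real (Suc n) \<le> (real (Suc n))\<^sup>2" unfolding power2_eq_square mult_1_right .
      with n(1) have "y \<le> (real (Suc n))\<^sup>2" by (rule order_trans)
      moreover have s: "\<bar>s\<bar> \<le> real (Suc n) / 2" using n(2) by (simp del: of_nat_Suc)
      ultimately show ?thesis using y abs_le_D1[OF s] minus_le_iff[THEN iffD1, OF abs_le_D2[OF s]]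
        by (simp add: ok_def del: of_nat_Suc)
    qed
    then show ?thesis by blast
  qed
  have approx: "\<exists>n. ok n (y, s) \<and> ok n (y', s') \<and> c \<le> real (Suc n) \<and>
      d (\<Psi> n (y, s)) (\<Phi> (y, s)) < e \<and> d (\<Psi> n (y', s')) (\<Phi> (y', s')) < e"
    if "0 \<le> y" "0 \<le> y'" "0 < e" for y y' s s' e c
  proof -
    obtain N1 where N1: "\<forall>n\<ge>N1. ok n (y, s)" using ev \<open>0 \<le> y\<close> by blast
    obtain N2 where N2: "\<forall>n\<ge>N2. ok n (y', s')" using ev \<open>0 \<le> y'\<close> by blast
    obtain N3 where N3: "c \<le> real N3" using real_arch_simple by blast
    obtain n where n: "n \<ge> max N1 (max N2 N3)" "d (\<Psi> n (y, s)) (\<Phi> (y, s)) < e" "d (\<Psi> n (y', s')) (\<Phi> (y', s')) < e"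
      using Phi[OF \<open>0 < e\<close>] by blast
    then have "real N3 \<le> real n" by simp
    then have "c \<le> real (Suc n)" using N3 by simp
    then show ?thesis using n N1 N2 by auto
  qed
  define c where "c = q (\<Phi> (0, 0))"
  have Phi_h: "h (\<Phi> (y, s)) = y" if y: "0 \<le> y" for y s
  proof -
    have "\<bar>h (\<Phi> (y, s)) - y\<bar> \<le> 0 + e" if e: "0 < e" for e
    proof -
      obtain n where n: "ok n (y, s)" "d (\<Psi> n (y, s)) (\<Phi> (y, s)) < e" using approx[OF y y e] by blast
      then show ?thesis using height_lipschitz[OF PsiM PhiM, of n "(y, s)" "(y, s)"] Psi_h[OF n(1)] by linarith
    qed
    then have "\<bar>h (\<Phi> (y, s)) - y\<bar> \<le> 0" by (rule field_le_epsilon)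
    then show ?thesis by simp
  qed
  have Phi_q: "q (\<Phi> (y, s)) = c + s" if y: "0 \<le> y" for y s
  proof -
    have "\<bar>q (\<Phi> (y, s)) - c - s\<bar> \<le> 0 + e" if e: "0 < e" for e
    proof -
      have e4: "0 < e / 4" using e by simp
      \<comment> \<open>Approximating \<open>(y, s)\<close> together with \<open>(0, 0)\<close>
        cancels the offset \<open>q (W n 0)\<close>, which may vary with \<open>n\<close>.\<close>
      obtain n where n: "ok n (y, s)" "ok n (0, 0)" "4 / e \<le> real (Suc n)"
          "d (\<Psi> n (y, s)) (\<Phi> (y, s)) < e / 4" "d (\<Psi> n (0, 0)) (\<Phi> (0, 0)) < e / 4"
        using approx[OF y order_refl e4, of s 0 "4 / e"] by blast
      have small: "1 / real (Suc n) \<le> e / 4" by (rule inverse_le_of_large[OF n(3) e]) simp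
      have 1: "\<bar>q (\<Psi> n (y, s)) - q (\<Phi> (y, s))\<bar> \<le> e / 4"
        using foot_lipschitz[OF PsiM PhiM, of n "(y, s)" "(y, s)"] n(4) by (rule order_trans[OF _ less_imp_le])
      have 2: "\<bar>q (\<Psi> n (0, 0)) - c\<bar> \<le> e / 4"
        unfolding c_def using foot_lipschitz[OF PsiM PhiM, of n "(0, 0)" "(0, 0)"] n(5) by (rule order_trans[OF _ less_imp_le])
      have 3: "\<bar>q (\<Psi> n (y, s)) - q (W n 0) - s\<bar> \<le> e / 4"
        using Psi_foot[OF n(1)] small by (rule order_trans)
      have 4: "\<bar>q (\<Psi> n (0, 0)) - q (W n 0) - 0\<bar> \<le> e / 4"
        using Psi_foot[OF n(2)] small by (rule order_trans)
      from 1 2 3 4 show ?thesis unfolding abs_le_iff by linarith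
    qed
    then have "\<bar>q (\<Phi> (y, s)) - c - s\<bar> \<le> 0" by (rule field_le_epsilon)
    then show ?thesis by simp
  qed
  have Phi_hor: "d (\<Phi> (y, s)) (\<Phi> (y, s')) \<le> \<bar>s - s'\<bar>" if y: "0 \<le> y" for y s s'
  proof (rule field_le_epsilon)
    fix e :: real assume e: "0 < e"
    have e3: "0 < e / 3" using e by simp
    obtain n where n: "ok n (y, s)" "ok n (y, s')" "3 * (y * \<bar>s - s'\<bar>) / e \<le> real (Suc n)"
        "d (\<Psi> n (y, s)) (\<Phi> (y, s)) < e / 3" "d (\<Psi> n (y, s')) (\<Phi> (y, s')) < e / 3"
      using approx[OF y y e3, of s s' "3 * (y * \<bar>s - s'\<bar>) / e"] by blast
    have "y * \<bar>s - s'\<bar> / (real (Suc n))\<^sup>2 \<le> e / 3" by (rule divide_square_le_of_large[OF n(3) e]) simp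
    then show "d (\<Phi> (y, s)) (\<Phi> (y, s')) \<le> \<bar>s - s'\<bar> + e"
      using mdist_triangle[of "\<Phi> (y, s)" Y "\<Psi> n (y, s)" "\<Phi> (y, s')", OF PhiM PsiM PhiM]
        mdist_triangle[of "\<Psi> n (y, s)" Y "\<Psi> n (y, s')" "\<Phi> (y, s')", OF PsiM PsiM PhiM] Psi_hor[OF n(1,2)] n(4,5)
        mdist_commute[of Y "\<Phi> (y, s)" "\<Psi> n (y, s)"] by linarith
  qed
  have Phi_ver: "d (\<Phi> (y, s)) (\<Phi> (y', s)) \<le> \<bar>y - y'\<bar>" if y: "0 \<le> y" "0 \<le> y'" for y y' s
  proof (rule field_le_epsilon)
    fix e :: real assume e: "0 < e"
    have e2: "0 < e / 2" using e by simp
    obtain n where n: "ok n (y, s)" "ok n (y', s)"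
        "d (\<Psi> n (y, s)) (\<Phi> (y, s)) < e / 2" "d (\<Psi> n (y', s)) (\<Phi> (y', s)) < e / 2"
      using approx[OF y e2, of s s 0] by blast
    then show "d (\<Phi> (y, s)) (\<Phi> (y', s)) \<le> \<bar>y - y'\<bar> + e"
      using mdist_triangle[of "\<Phi> (y, s)" Y "\<Psi> n (y, s)" "\<Phi> (y', s)", OF PhiM PsiM PhiM]
        mdist_triangle[of "\<Psi> n (y, s)" Y "\<Psi> n (y', s)" "\<Phi> (y', s)", OF PsiM PsiM PhiM] Psi_ver[OF n(1,2)]
        mdist_commute[of Y "\<Phi> (y, s)" "\<Psi> n (y, s)"] by linarith
  qed
  have "bounds_flat_half_plane Y \<sigma>"
    by (rule flat_half_plane_of_rectangles[of \<Phi> c]) (assumption | rule PhiM Phi_h Phi_q Phi_hor Phi_ver)+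
  then show False using no_flat by simp
qed

end

section \<open>Isometries and the end points of their axes\<close>

lemma isometry_group_apply:
  assumes "f \<in> carrier (isometry_group Y)"
  shows "x \<in> mspace Y \<Longrightarrow> f x \<in> mspace Y"
    and "x \<in> mspace Y \<Longrightarrow> y \<in> mspace Y \<Longrightarrow> mdist Y (f x) (f y) = mdist Y x y"
  using assms Bij_imp_funcset by (fastforce simp: isometry_group_def)+

lemma isometry_group_mult_apply:
  assumes "f \<in> carrier (isometry_group Y)" "g \<in> carrier (isometry_group Y)" "x \<in> mspace Y"
  shows "(f \<otimes>\<^bsub>isometry_group Y\<^esub> g) x = f (g x)"
  using assms by (auto simp: isometry_group_def BijGroup_def compose_eq)

lemma isometry_group_one_apply:
  "x \<in> mspace Y \<Longrightarrow> \<one>\<^bsub>isometry_group Y\<^esub> x = x"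
  by (simp add: isometry_group_def BijGroup_def)

lemma isometry_group_inv_apply:
  assumes f: "f \<in> carrier (isometry_group Y)" and x: "x \<in> mspace Y"
  shows "(inv\<^bsub>isometry_group Y\<^esub> f) (f x) = x" "f ((inv\<^bsub>isometry_group Y\<^esub> f) x) = x"
proof -
  interpret G: group "isometry_group Y" by (rule group_isometry_group)
  show "(inv\<^bsub>isometry_group Y\<^esub> f) (f x) = x"
    using isometry_group_mult_apply[OF G.inv_closed[OF f] f x] G.l_inv[OF f] isometry_group_one_apply[OF x] by simp
  show "f ((inv\<^bsub>isometry_group Y\<^esub> f) x) = x"
    using isometry_group_mult_apply[OF f G.inv_closed[OF f] x] G.r_inv[OF f] isometry_group_one_apply[OF x] by simp
qed

lemma translation_pow:
  fixes k :: int
  assumes f: "f \<in> carrier (isometry_group Y)" and \<sigma>: "geodesic_on Y UNIV \<sigma>"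
    and l: "\<And>t. f (\<sigma> t) = \<sigma> (t + l)"
  shows "(f [^]\<^bsub>isometry_group Y\<^esub> k) (\<sigma> t) = \<sigma> (t + of_int k * l)"
proof -
  interpret G: group "isometry_group Y" by (rule group_isometry_group)
  have M: "\<sigma> t \<in> mspace Y" for t using \<sigma> by (auto simp: geodesic_on_def)
  have nat: "(f [^]\<^bsub>isometry_group Y\<^esub> n) (\<sigma> t) = \<sigma> (t + real n * l)" for n :: nat and t
  proof (induction n arbitrary: t)
    case 0 then show ?case using isometry_group_one_apply[OF M] by simp
  next
    case (Suc n)
    then show ?case using isometry_group_mult_apply[OF G.nat_pow_closed[OF f] f M] l by (simp add: algebra_simps)
  qed
  show ?thesis
  proof (cases k)
    case (nonneg n)
    then show ?thesis using nat by (simp add: int_pow_int)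
  next
    case (neg n)
    have "(inv\<^bsub>isometry_group Y\<^esub> (f [^]\<^bsub>isometry_group Y\<^esub> Suc n)) (\<sigma> t) = \<sigma> (t - real (Suc n) * l)"
      using isometry_group_inv_apply(1)[OF G.nat_pow_closed[OF f] M, of "Suc n" "t - real (Suc n) * l"] nat[of "Suc n"] by simp
    moreover have "f [^]\<^bsub>isometry_group Y\<^esub> k = inv\<^bsub>isometry_group Y\<^esub> (f [^]\<^bsub>isometry_group Y\<^esub> Suc n)"
      unfolding neg by (simp only: G.int_pow_neg[OF f] int_pow_int)
    moreover have "of_int k = - real (Suc n)" using neg by simp
    then have "t - real (Suc n) * l = t + of_int k * l" by (simp only: mult_minus_left diff_conv_add_uminus)
    ultimately show ?thesis by metis
  qed
qed

theorem (in hadamard) rank_one_contracting: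
  assumes lc: "locally_compact_space (mtopology_of Y)" and r: "rank_one Y f"
  shows "\<exists>\<sigma> C. is_axis Y f \<sigma> \<and> contracting Y \<sigma> C"
proof -
  obtain \<sigma> where f: "f \<in> carrier (isometry_group Y)" and ax: "is_axis Y f \<sigma>" and nb: "\<not> bounds_flat_half_plane Y \<sigma>"
    using r by (auto simp: rank_one_def axial_def)
  obtain l where \<sigma>: "geodesic_on Y UNIV \<sigma>" "0 < l" "\<And>t. f (\<sigma> t) = \<sigma> (t + l)" using ax unfolding is_axis_def by blast
  interpret G: group "isometry_group Y" by (rule group_isometry_group)
  interpret gline Y \<sigma> by unfold_locales (rule \<sigma>)
  have trans: "\<exists>\<theta>. (\<forall>x\<in>M. \<theta> x \<in> M) \<and> (\<forall>x\<in>M. \<forall>y\<in>M. d (\<theta> x) (\<theta> y) = d x y)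
        \<and> (\<forall>t. \<theta> (\<sigma> t) = \<sigma> (t + of_int k * l))" for k :: int
    using isometry_group_apply[OF G.int_pow_closed[OF f]] translation_pow[OF f \<sigma>(1,3)]
    by (intro exI[of _ "f [^]\<^bsub>isometry_group Y\<^esub> k"]) blast
  obtain R D \<kappa> where "nf_line Y \<sigma> R D \<kappa>"
    using nf_of_not_flat_half_plane[OF mcball_compact[OF _ lc] \<sigma>(2) trans nb] by blast
  from nf_line.contracting_exists[OF this] ax show ?thesis by blast
qed

lemma (in hadamard) boundary_point_eqI:
  assumes "\<And>t. \<sigma> t \<in> M" "\<And>t. \<tau> t \<in> M" and C: "\<And>t. 0 \<le> t \<Longrightarrow> d (\<sigma> t) (\<tau> t) \<le> C"
  shows "boundary_point Y \<sigma> = boundary_point Y \<tau>"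
proof -
  have aux: "boundary_point Y \<sigma> \<subseteq> boundary_point Y \<tau>"
    if M: "\<And>t. \<sigma> t \<in> M" "\<And>t. \<tau> t \<in> M" and C: "\<And>t. 0 \<le> t \<Longrightarrow> d (\<sigma> t) (\<tau> t) \<le> C" for \<sigma> \<tau>
  proof
    fix \<rho> assume "\<rho> \<in> boundary_point Y \<sigma>"
    then obtain B where \<rho>: "geodesic_on Y {0..} \<rho>" and B: "\<And>t. 0 \<le> t \<Longrightarrow> d (\<sigma> t) (\<rho> t) \<le> B"
      by (auto simp: boundary_point_def)
    have "d (\<tau> t) (\<rho> t) \<le> C + B" if "0 \<le> t" for t
    proof -
      have "\<rho> t \<in> M" using \<rho> that by (auto simp: geodesic_on_def)
      then show ?thesis
        using mdist_triangle[OF M(2)[of t] M(1)[of t], of "\<rho> t"] B[OF that] C[OF that] by (simp add: mdist_commute)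
    qed
    then show "\<rho> \<in> boundary_point Y \<tau>" using \<rho> by (auto simp: boundary_point_def)
  qed
  show ?thesis
    using aux[of \<sigma> \<tau>] aux[of \<tau> \<sigma>] assms by (simp add: mdist_commute subset_antisym)
qed

text \<open>The \<open>n\<close>-th power moves \<open>\<sigma> 0\<close> by \<open>n * l\<close>
  and \<open>\<tau> 0\<close> by \<open>n * m\<close>, and these differ by at most twice the
  distance of the two points, for every \<open>n\<close>. Hence \<open>l = m\<close>, and the
  distance at equal parameters is periodic.\<close>

lemma (in hadamard) axes_parallel:
  assumes f: "f \<in> carrier (isometry_group Y)" and ax: "is_axis Y f \<sigma>" "is_axis Y f \<tau>"
  shows "\<exists>C. \<forall>t. d (\<sigma> t) (\<tau> t) \<le> C"
proof -
  interpret G: group "isometry_group Y" by (rule group_isometry_group)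
  obtain l where \<sigma>: "geodesic_on Y UNIV \<sigma>" "0 < l" "\<And>t. f (\<sigma> t) = \<sigma> (t + l)" using ax(1) unfolding is_axis_def by blast
  obtain m where \<tau>: "geodesic_on Y UNIV \<tau>" "0 < m" "\<And>t. f (\<tau> t) = \<tau> (t + m)" using ax(2) unfolding is_axis_def by blast
  interpret s: gline Y \<sigma> by unfold_locales (rule \<sigma>)
  interpret t: gline Y \<tau> by unfold_locales (rule \<tau>)
  have pow: "d (\<sigma> (s + of_int k * l)) (\<tau> (t + of_int k * m)) = d (\<sigma> s) (\<tau> t)" for s t and k :: int
    using isometry_group_apply(2)[OF G.int_pow_closed[OF f], of "\<sigma> s" "\<tau> t" k]
      translation_pow[OF f \<sigma>(1,3)] translation_pow[OF f \<tau>(1,3)] by simp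
  define D where "D = d (\<sigma> 0) (\<tau> 0)"
  have "\<bar>l - m\<bar> * real n \<le> 2 * D" for n
  proof -
    have "\<bar>real n * l - real n * m\<bar> \<le> 2 * D"
      using pow[of 0 "int n" 0] mdist_triangle[of "\<sigma> 0" Y "\<tau> 0" "\<sigma> (real n * l)"]
        mdist_triangle[of "\<tau> 0" Y "\<tau> (real n * m)" "\<sigma> (real n * l)"]
        mdist_triangle[of "\<tau> 0" Y "\<sigma> 0" "\<tau> (real n * m)"] mdist_triangle[of "\<sigma> 0" Y "\<sigma> (real n * l)" "\<tau> (real n * m)"]
        \<sigma>(2) \<tau>(2)
      by (simp add: s.line_dist t.line_dist D_def mdist_commute abs_le_iff)
    also have "real n * l - real n * m = (l - m) * real n" by (simp add: algebra_simps)
    finally show ?thesis by (simp add: abs_mult)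
  qed
  then have "\<not> 0 < \<bar>l - m\<bar>"
    using reals_Archimedean3[of "\<bar>l - m\<bar>"] by (metis mult.commute not_le)
  then have lm: "m = l" by simp
  have "d (\<sigma> t) (\<tau> t) \<le> D + 2 * l" for t
  proof -
    define r where "r = t - of_int \<lfloor>t / l\<rfloor> * l"
    have fl: "of_int \<lfloor>t / l\<rfloor> \<le> t / l" "t / l < of_int \<lfloor>t / l\<rfloor> + 1" by linarith+
    have r: "0 \<le> r" "r \<le> l"
      using pos_le_divide_eq[OF \<sigma>(2), THEN iffD1, OF fl(1)] pos_divide_less_eq[OF \<sigma>(2), THEN iffD1, OF fl(2)]
      by (auto simp: r_def distrib_right)
    have "d (\<sigma> t) (\<tau> t) = d (\<sigma> r) (\<tau> r)" using pow[of r "\<lfloor>t / l\<rfloor>" r] lm by (simp add: r_def)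
    also have "\<dots> \<le> D + 2 * l"
      using mdist_triangle[of "\<sigma> r" Y "\<sigma> 0" "\<tau> r"] mdist_triangle[of "\<sigma> 0" Y "\<tau> 0" "\<tau> r"] r
      by (simp add: s.line_dist t.line_dist D_def)
    finally show ?thesis .
  qed
  then show ?thesis by blast
qed

text \<open>Parallel axes have the same end points, so the definite descriptions denote and can be
  evaluated on any axis.\<close>

lemma (in hadamard) attracting_repelling_point_eq:
  assumes f: "f \<in> carrier (isometry_group Y)" and ax: "is_axis Y f \<sigma>"
  shows "attracting_point Y f = boundary_point Y \<sigma>"
    and "repelling_point Y f = boundary_point Y (\<lambda>t. \<sigma> (- t))"
proof -
  have eq: "boundary_point Y \<tau> = boundary_point Y \<sigma> \<and>
      boundary_point Y (\<lambda>t. \<tau> (- t)) = boundary_point Y (\<lambda>t. \<sigma> (- t))" if t: "is_axis Y f \<tau>" for \<tau>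
  proof -
    obtain C where "\<And>t. d (\<tau> t) (\<sigma> t) \<le> C" using axes_parallel[OF f t ax] by blast
    moreover have "\<And>t. \<tau> t \<in> M" "\<And>t. \<sigma> t \<in> M"
      using t ax by (auto simp: is_axis_def geodesic_on_def)
    ultimately show ?thesis
      using boundary_point_eqI[of \<tau> \<sigma> C] boundary_point_eqI[of "\<lambda>t. \<tau> (- t)" "\<lambda>t. \<sigma> (- t)" C] by simp
  qed
  show "attracting_point Y f = boundary_point Y \<sigma>"
    unfolding attracting_point_def by (rule the_equality) (use ax eq in blast)+
  show "repelling_point Y f = boundary_point Y (\<lambda>t. \<sigma> (- t))"
    unfolding repelling_point_def by (rule the_equality) (use ax eq in blast)+
qed

section \<open>Projections of lines to a contracting line\<close>

context gline
begin

lemma contractingD: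
  assumes "contracting Y \<sigma> C" "x \<in> M" "y \<in> M" "C \<le> \<bar>q x - q y\<bar>" "t \<in> closed_segment (q x) (q y)"
  shows "\<exists>\<tau>. 0 \<le> \<tau> \<and> \<tau> \<le> 1 \<and> d (pt x y \<tau>) (\<sigma> t) \<le> C"
  using assms unfolding contracting_def by (meson atLeastAtMost_iff)

lemma contracting_reverse:
  assumes "contracting Y \<sigma> C" shows "contracting Y (\<lambda>t. \<sigma> (- t)) C"
  unfolding contracting_def
proof (intro conjI ballI allI impI)
  fix x y t assume xy: "x \<in> M" "y \<in> M"
    and A: "C \<le> \<bar>foot Y (\<lambda>t. \<sigma> (- t)) x - foot Y (\<lambda>t. \<sigma> (- t)) y\<bar> \<and>
      t \<in> closed_segment (foot Y (\<lambda>t. \<sigma> (- t)) x) (foot Y (\<lambda>t. \<sigma> (- t)) y)"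
  have "- t \<in> closed_segment (q x) (q y)"
    using A xy by (auto simp: foot_reverse closed_segment_eq_real_ivl split: if_splits)
  moreover have "C \<le> \<bar>q x - q y\<bar>" using A xy by (simp add: foot_reverse abs_minus_commute)
  ultimately show "\<exists>\<tau>\<in>{0..1}. d (pt x y \<tau>) (\<sigma> (- t)) \<le> C"
    using assms xy unfolding contracting_def by blast
qed (use assms in \<open>simp add: contracting_def\<close>)

text \<open>Unbounded feet force \<open>\<tau>\<close>, by contraction, to pass within
  \<open>C\<close> of every \<open>\<sigma> s\<close> beyond its starting foot; distances to the
  starting point determine the time of passage up to a constant.\<close>

lemma boundary_point_eq_of_unbounded_foot:
  assumes C: "contracting Y \<sigma> C" and \<tau>: "geodesic_on Y UNIV \<tau>"
    and unb: "\<And>B. \<exists>t\<ge>0. B \<le> q (\<tau> t)"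
  shows "boundary_point Y \<sigma> = boundary_point Y \<tau>"
proof -
  interpret t: gline Y \<tau> by unfold_locales (rule \<tau>)
  define a where "a = q (\<tau> 0)"
  define K where "K = 2 * C + h (\<tau> 0) + 3 * \<bar>a\<bar> + d (\<tau> 0) (\<sigma> 0)"
  have C0: "0 < C" using C by (simp add: contracting_def)
  have "d (\<sigma> s) (\<tau> s) \<le> K" if s: "0 \<le> s" for s
  proof (cases "a \<le> s")
    case True
    obtain u where u: "0 \<le> u" "s + C \<le> q (\<tau> u)" using unb by blast
    have "s \<in> closed_segment (q (\<tau> 0)) (q (\<tau> u))"
      using True u C0 by (auto simp: closed_segment_eq_real_ivl a_def)
    then obtain \<mu> where mu: "0 \<le> \<mu>" "\<mu> \<le> 1" "d (pt (\<tau> 0) (\<tau> u) \<mu>) (\<sigma> s) \<le> C"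
      using contractingD[OF C, of "\<tau> 0" "\<tau> u" s] True u C0 by (auto simp: a_def)
    define v where "v = \<mu> * u"
    have v: "0 \<le> v" "d (\<tau> v) (\<sigma> s) \<le> C" using mu u by (auto simp: v_def t.pt_line)
    have "\<bar>v - (s - a)\<bar> \<le> C + h (\<tau> 0)"
      using mdist_triangle[of "\<tau> 0" Y "\<tau> v" "\<sigma> s"] mdist_triangle[of "\<tau> 0" Y "\<sigma> a" "\<sigma> s"]
        mdist_triangle[of "\<tau> 0" Y "\<sigma> s" "\<tau> v"] mdist_triangle[of "\<sigma> a" Y "\<tau> 0" "\<sigma> s"] v True
      by (simp add: line_dist t.line_dist height_def a_def mdist_commute abs_le_iff)
    then have "\<bar>v - s\<bar> \<le> C + h (\<tau> 0) + \<bar>a\<bar>" by linarith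
    then show ?thesis
      using mdist_triangle[of "\<sigma> s" Y "\<tau> v" "\<tau> s", OF line_in t.line_in t.line_in] v(2) t.line_dist[of v s] mdist_commute[of Y "\<sigma> s" "\<tau> v"]
        mdist_nonneg[of Y "\<tau> 0" "\<sigma> 0"] abs_ge_zero[of a] height_nonneg[of "\<tau> 0"] unfolding K_def by linarith
  next
    case False
    have "d (\<sigma> s) (\<tau> s) \<le> 2 * s + d (\<tau> 0) (\<sigma> 0)"
      using mdist_triangle[of "\<sigma> s" Y "\<sigma> 0" "\<tau> s"] mdist_triangle[of "\<sigma> 0" Y "\<tau> 0" "\<tau> s"] s
      by (simp add: line_dist t.line_dist mdist_commute)
    then show ?thesis using False s C0 height_nonneg[of "\<tau> 0"] unfolding K_def by linarith
  qed
  then show ?thesis by (intro boundary_point_eqI[of _ _ K]) auto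
qed

text \<open>Unbounded feet would identify an end point of \<open>\<tau>\<close> with one of
  \<open>\<sigma>\<close>. The two ends of each line give four cases, obtained from one another by
  reversal.\<close>

lemma bounded_foot:
  assumes C: "contracting Y \<sigma> C" and \<tau>: "geodesic_on Y UNIV \<tau>"
    and ne: "{boundary_point Y \<sigma>, boundary_point Y (\<lambda>t. \<sigma> (- t))} \<inter> {boundary_point Y \<tau>, boundary_point Y (\<lambda>t. \<tau> (- t))} = {}"
  shows "\<exists>B. \<forall>t. \<bar>q (\<tau> t)\<bar> \<le> B"
proof -
  interpret t: gline Y \<tau> by unfold_locales (rule \<tau>)
  have \<tau>': "geodesic_on Y UNIV (\<lambda>t. \<tau> (- t))" using gline.line[OF t.gline_reverse] .
  interpret r: gline Y "\<lambda>t. \<sigma> (- t)" by (rule gline_reverse)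
  have aux: "\<exists>B. \<forall>t\<ge>0. F t \<le> B" if "(\<And>B. \<exists>t\<ge>0. B \<le> F t) \<Longrightarrow> False" for F :: "real \<Rightarrow> real"
  proof (rule ccontr)
    assume "\<not> ?thesis"
    then have "\<exists>t\<ge>0. B \<le> F t" for B by (meson linear)
    then show False by (rule that)
  qed
  have up: "\<exists>B. \<forall>t\<ge>0. q (\<tau> t) \<le> B" "\<exists>B. \<forall>t\<ge>0. q (\<tau> (- t)) \<le> B"
    by (rule aux, insert boundary_point_eq_of_unbounded_foot[OF C \<tau>] ne, blast)
       (rule aux, insert boundary_point_eq_of_unbounded_foot[OF C \<tau>'] ne, blast)
  have f: "foot Y (\<lambda>t. \<sigma> (- t)) (\<tau> t) = - q (\<tau> t)" for t by (rule foot_reverse) simp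
  have down: "\<exists>B. \<forall>t\<ge>0. - q (\<tau> t) \<le> B" "\<exists>B. \<forall>t\<ge>0. - q (\<tau> (- t)) \<le> B"
    by (rule aux, insert r.boundary_point_eq_of_unbounded_foot[OF contracting_reverse[OF C] \<tau>, unfolded f] ne, blast)
       (rule aux, insert r.boundary_point_eq_of_unbounded_foot[OF contracting_reverse[OF C] \<tau>', unfolded f] ne, blast)
  obtain a b c e where B: "\<And>t. t \<ge> 0 \<Longrightarrow> q (\<tau> t) \<le> a" "\<And>t. t \<ge> 0 \<Longrightarrow> q (\<tau> (- t)) \<le> b"
      "\<And>t. t \<ge> 0 \<Longrightarrow> - q (\<tau> t) \<le> c" "\<And>t. t \<ge> 0 \<Longrightarrow> - q (\<tau> (- t)) \<le> e"
    using up down by metis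
  have "\<bar>q (\<tau> t)\<bar> \<le> \<bar>a\<bar> + \<bar>b\<bar> + \<bar>c\<bar> + \<bar>e\<bar>" for t
    using B[of t] B[of "- t"] by (cases "0 \<le> t") (auto simp: abs_le_iff)
  then show ?thesis by blast
qed

end

lemma (in hadamard) independent_bounded_foot:
  assumes ind: "independent_rank_one Y g f"
    and ax: "is_axis Y g \<tau>" "is_axis Y f \<sigma>" and C: "contracting Y \<sigma> C"
  shows "\<exists>B. \<forall>t. \<bar>foot Y \<sigma> (\<tau> t)\<bar> \<le> B"
proof -
  have c: "f \<in> carrier (isometry_group Y)" "g \<in> carrier (isometry_group Y)"
    using ind by (auto simp: independent_rank_one_def rank_one_def axial_def)
  interpret gline Y \<sigma> by unfold_locales (use ax in \<open>simp add: is_axis_def\<close>)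
  show ?thesis
  proof (rule bounded_foot[OF C])
    show "geodesic_on Y UNIV \<tau>" using ax by (simp add: is_axis_def)
    show "{boundary_point Y \<sigma>, boundary_point Y (\<lambda>t. \<sigma> (- t))} \<inter> {boundary_point Y \<tau>, boundary_point Y (\<lambda>t. \<tau> (- t))} = {}"
      using ind attracting_repelling_point_eq[OF c(1) ax(2)] attracting_repelling_point_eq[OF c(2) ax(1)]
      by (auto simp: independent_rank_one_def)
  qed
qed

section \<open>Independent axes\<close>

context hadamard
begin

lemma pt_isometry:
  assumes f: "f \<in> carrier (isometry_group Y)" and M: "x \<in> M" "y \<in> M" and t: "0 \<le> \<tau>" "\<tau> \<le> 1"
  shows "f (pt x y \<tau>) = pt (f x) (f y) \<tau>"
  using isometry_group_apply[OF f] M t pt_dist_left[OF M t] pt_dist_right[OF M t]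
  by (intro pt_unique) auto

lemma geodesic_line_image:
  assumes "f \<in> carrier (isometry_group Y)" "geodesic_on Y UNIV \<sigma>"
  shows "geodesic_on Y UNIV (\<lambda>t. f (\<sigma> t))"
proof -
  have "\<sigma> t \<in> M" for t using assms(2) by (auto simp: geodesic_on_def)
  then show ?thesis using assms(2) isometry_group_apply[OF assms(1)] by (auto simp: geodesic_on_def)
qed

lemma foot_image:
  assumes f: "f \<in> carrier (isometry_group Y)" and \<sigma>: "geodesic_on Y UNIV \<sigma>" and x: "x \<in> M"
  shows "foot Y (\<lambda>t. f (\<sigma> t)) (f x) = foot Y \<sigma> x"
proof -
  interpret s: gline Y \<sigma> by unfold_locales (rule \<sigma>)
  interpret f: gline Y "\<lambda>t. f (\<sigma> t)" by unfold_locales (rule geodesic_line_image[OF f \<sigma>])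
  show ?thesis
    using isometry_group_apply[OF f] x s.foot_le[OF x] by (intro f.foot_eqI) (auto simp: height_def)
qed

lemma contracting_image:
  assumes f: "f \<in> carrier (isometry_group Y)" and \<sigma>: "geodesic_on Y UNIV \<sigma>" and C: "contracting Y \<sigma> C"
  shows "contracting Y (\<lambda>t. f (\<sigma> t)) C"
  unfolding contracting_def
proof (intro conjI ballI allI impI)
  interpret G: group "isometry_group Y" by (rule group_isometry_group)
  interpret s: gline Y \<sigma> by unfold_locales (rule \<sigma>)
  let ?g = "inv\<^bsub>isometry_group Y\<^esub> f"
  fix x y t assume xy: "x \<in> M" "y \<in> M"
    and A: "C \<le> \<bar>foot Y (\<lambda>t. f (\<sigma> t)) x - foot Y (\<lambda>t. f (\<sigma> t)) y\<bar> \<and>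
      t \<in> closed_segment (foot Y (\<lambda>t. f (\<sigma> t)) x) (foot Y (\<lambda>t. f (\<sigma> t)) y)"
  have g: "?g z \<in> M" "f (?g z) = z" if "z \<in> M" for z
    using isometry_group_apply(1)[OF G.inv_closed[OF f] that] isometry_group_inv_apply(2)[OF f that] by auto
  have ft: "foot Y (\<lambda>t. f (\<sigma> t)) z = foot Y \<sigma> (?g z)" if "z \<in> M" for z
    using foot_image[OF f \<sigma> g(1)[OF that]] g(2)[OF that] by simp
  obtain \<tau> where t: "0 \<le> \<tau>" "\<tau> \<le> 1" "d (pt (?g x) (?g y) \<tau>) (\<sigma> t) \<le> C"
    using s.contractingD[OF C g(1)[OF xy(1)] g(1)[OF xy(2)], of t] A ft xy by auto
  have "d (pt x y \<tau>) (f (\<sigma> t)) = d (f (pt (?g x) (?g y) \<tau>)) (f (\<sigma> t))"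
    using pt_isometry[OF f g(1)[OF xy(1)] g(1)[OF xy(2)] t(1,2)] g xy by simp
  also have "\<dots> \<le> C" using isometry_group_apply(2)[OF f] g xy t by simp
  finally show "\<exists>\<tau>\<in>{0..1}. d (pt x y \<tau>) (f (\<sigma> t)) \<le> C" using t by auto
qed (use C in \<open>simp add: contracting_def\<close>)

lemma foot_translate:
  assumes f: "f \<in> carrier (isometry_group Y)" and \<sigma>: "geodesic_on Y UNIV \<sigma>"
    and l: "\<And>t. f (\<sigma> t) = \<sigma> (t + l)" and x: "x \<in> M"
  shows "foot Y \<sigma> (f x) = foot Y \<sigma> x + l"
proof -
  interpret s: gline Y \<sigma> by unfold_locales (rule \<sigma>)
  show ?thesis by (rule s.foot_height_isometry(1)[OF _ _ l x]) (use isometry_group_apply[OF f] in auto)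
qed

lemma dist_via_near_point:
  assumes M: "x \<in> M" "y \<in> M" "p \<in> M" and t: "0 \<le> \<tau>" "\<tau> \<le> 1" and near: "d (pt x y \<tau>) p \<le> C"
  shows "d x p + d p y - 2 * C \<le> d x y"
proof -
  have "d x p \<le> d x (pt x y \<tau>) + C"
    using mdist_triangle[of x Y "pt x y \<tau>" p] M t near by auto
  moreover have "d p y \<le> d (pt x y \<tau>) y + C"
    using mdist_triangle[of p Y "pt x y \<tau>" y] M t near by (auto simp: mdist_commute)
  moreover have "d x (pt x y \<tau>) + d (pt x y \<tau>) y = d x y"
    using pt_dist_left[OF M(1,2) t] pt_dist_right[OF M(1,2) t] by (simp add: algebra_simps)
  ultimately show ?thesis by linarith
qed

text \<open>On \<open>\<sigma>\<close>, the projections of \<open>\<tau>\<close> and of its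
  translate are at least \<open>C\<close> apart. So a geodesic from \<open>\<tau> a\<close> to a
  point \<open>v\<close> of the translate passes within \<open>B + C\<close> of
  \<open>\<sigma> 0\<close>; if \<open>\<tau> a\<close> is nearest to \<open>v\<close>, comparison
  with \<open>\<tau> 0\<close> bounds \<open>a\<close>.\<close>

lemma bounded_foot_translate:
  assumes f: "f \<in> carrier (isometry_group Y)" and \<sigma>: "geodesic_on Y UNIV \<sigma>"
    and l: "0 < l" "\<And>t. f (\<sigma> t) = \<sigma> (t + l)" and C: "contracting Y \<sigma> C"
    and \<tau>: "geodesic_on Y UNIV \<tau>" and B: "\<And>t. \<bar>foot Y \<sigma> (\<tau> t)\<bar> \<le> B"
    and k: "2 * B + C \<le> \<bar>of_int k\<bar> * l"
  shows "\<exists>B'. \<forall>t. \<bar>foot Y \<tau> ((f [^]\<^bsub>isometry_group Y\<^esub> (k::int)) (\<tau> t))\<bar> \<le> B'"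
proof -
  interpret G: group "isometry_group Y" by (rule group_isometry_group)
  interpret s: gline Y \<sigma> by unfold_locales (rule \<sigma>)
  interpret t: gline Y \<tau> by unfold_locales (rule \<tau>)
  have fk: "f [^]\<^bsub>isometry_group Y\<^esub> k \<in> carrier (isometry_group Y)" using f by simp
  let ?p = "\<sigma> 0"
  have "\<bar>foot Y \<tau> ((f [^]\<^bsub>isometry_group Y\<^esub> k) (\<tau> t))\<bar> \<le> 2 * d ?p (\<tau> 0) + 2 * (B + C)" for t
  proof -
    define v where "v = (f [^]\<^bsub>isometry_group Y\<^esub> k) (\<tau> t)"
    define a where "a = foot Y \<tau> v"
    have vM: "v \<in> M" using isometry_group_apply(1)[OF fk] by (simp add: v_def)
    have qv: "foot Y \<sigma> v = foot Y \<sigma> (\<tau> t) + of_int k * l"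
      unfolding v_def by (rule foot_translate[OF fk \<sigma> translation_pow[OF f \<sigma> l(2)]]) simp
    have "\<bar>of_int k * l\<bar> = \<bar>of_int k\<bar> * l" using l by (simp add: abs_mult)
    then have far: "C \<le> \<bar>foot Y \<sigma> (\<tau> a) - foot Y \<sigma> v\<bar>" using qv k B[of t] B[of a] by linarith
    obtain \<mu> where mu: "0 \<le> \<mu>" "\<mu> \<le> 1" "d (pt (\<tau> a) v \<mu>) (\<sigma> (foot Y \<sigma> (\<tau> a))) \<le> C"
      using s.contractingD[OF C _ vM far, of "foot Y \<sigma> (\<tau> a)"] by auto
    have "d (\<sigma> (foot Y \<sigma> (\<tau> a))) ?p \<le> B" using B[of a] by (simp add: s.line_dist)
    then have near: "d (pt (\<tau> a) v \<mu>) ?p \<le> B + C"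
      using mdist_triangle[of "pt (\<tau> a) v \<mu>" Y "\<sigma> (foot Y \<sigma> (\<tau> a))" ?p] mu vM by simp
    have "d (\<tau> a) ?p + d ?p v - 2 * (B + C) \<le> d (\<tau> a) v"
      by (rule dist_via_near_point[OF _ vM _ mu(1,2) near]) auto
    moreover have "d (\<tau> a) v \<le> d v (\<tau> 0)" using t.foot_le[OF vM, of 0] by (simp add: height_def a_def mdist_commute)
    moreover have "d v (\<tau> 0) \<le> d ?p v + d ?p (\<tau> 0)" using mdist_triangle[of v Y ?p "\<tau> 0"] vM by (simp add: mdist_commute)
    moreover have "\<bar>a\<bar> \<le> d (\<tau> a) ?p + d ?p (\<tau> 0)" using mdist_triangle[of "\<tau> a" Y ?p "\<tau> 0"] by (simp add: t.line_dist)
    ultimately show ?thesis unfolding a_def[symmetric] v_def[symmetric] by linarith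
  qed
  then show ?thesis by blast
qed

text \<open>If both nearest points were far away, the geodesic from \<open>p\<close> to \<open>x\<close> would follow both lines for a
  long time, contrary to the bounded projection.\<close>

lemma eventually_at_most_one_far_foot:
  assumes \<sigma>: "geodesic_on Y UNIV \<sigma>" "contracting Y \<sigma> C" and \<tau>: "geodesic_on Y UNIV \<tau>" "contracting Y \<tau> C"
    and B: "\<And>t. \<bar>foot Y \<sigma> (\<tau> t)\<bar> \<le> B" and p: "p \<in> M"
  shows "\<forall>\<^sub>F D in at_top. \<forall>x\<in>M. \<bar>foot Y \<sigma> x - foot Y \<sigma> p\<bar> \<le> D \<or> \<bar>foot Y \<tau> x - foot Y \<tau> p\<bar> \<le> D"
proof -
  interpret s: gline Y \<sigma> by unfold_locales (rule \<sigma>)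
  interpret t: gline Y \<tau> by unfold_locales (rule \<tau>)
  define E where "E = C + height Y \<sigma> p + height Y \<tau> p"
  have C0: "0 < C" using \<sigma>(2) by (simp add: contracting_def)
  show ?thesis
    unfolding eventually_at_top_linorder
  proof (intro exI[of _ "C + \<bar>B\<bar> + 2 * E + 2 * C + \<bar>foot Y \<sigma> p\<bar> + 1"] allI impI ballI)
    fix D x assume D: "C + \<bar>B\<bar> + 2 * E + 2 * C + \<bar>foot Y \<sigma> p\<bar> + 1 \<le> D" and x: "x \<in> M"
    have E0: "0 \<le> E" using C0 by (simp add: E_def)
    \<comment> \<open>Contraction puts a point of the segment near the point of the line at
      parameter distance exactly \<open>D\<close> from the foot of \<open>p\<close>. Its distance to
      \<open>p\<close> is then \<open>D\<close> up to \<open>E\<close>, whichever line is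
      used.\<close>
    have pass: "\<exists>\<mu> t. 0 \<le> \<mu> \<and> \<mu> \<le> 1 \<and> \<bar>t - foot Y \<rho> p\<bar> = D \<and> d (pt p x \<mu>) (\<rho> t) \<le> C \<and> \<bar>d p (pt p x \<mu>) - D\<bar> \<le> E"
      if \<rho>: "geodesic_on Y UNIV \<rho>" "contracting Y \<rho> C" and far: "\<not> \<bar>foot Y \<rho> x - foot Y \<rho> p\<bar> \<le> D"
        and E: "C + height Y \<rho> p \<le> E" for \<rho>
    proof -
      interpret r: gline Y \<rho> by unfold_locales (rule \<rho>)
      define t where "t = (if foot Y \<rho> p \<le> foot Y \<rho> x then foot Y \<rho> p + D else foot Y \<rho> p - D)"
      have D0: "0 \<le> D" using D E0 C0 by linarith
      have t: "\<bar>t - foot Y \<rho> p\<bar> = D" using D0 by (simp add: t_def)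
      have "t \<in> closed_segment (foot Y \<rho> p) (foot Y \<rho> x)"
        using far D0 by (auto simp: t_def closed_segment_eq_real_ivl)
      moreover have "C \<le> \<bar>foot Y \<rho> p - foot Y \<rho> x\<bar>" using far D E0 C0 by linarith
      ultimately obtain \<mu> where mu: "0 \<le> \<mu>" "\<mu> \<le> 1" "d (pt p x \<mu>) (\<rho> t) \<le> C"
        using r.contractingD[OF \<rho>(2) p x] by blast
      have "\<bar>d p (pt p x \<mu>) - D\<bar> \<le> C + height Y \<rho> p"
        using mdist_triangle[of p Y "pt p x \<mu>" "\<rho> t"] mdist_triangle[of p Y "\<rho> t" "pt p x \<mu>"] mu p x
          r.dist_line_ge[OF p, of t] r.foot_dist_le[OF p, of t] t
        by (simp add: mdist_commute abs_le_iff)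
      then show ?thesis using mu t E by (intro exI[of _ \<mu>] exI[of _ t]) auto
    qed
    show "\<bar>foot Y \<sigma> x - foot Y \<sigma> p\<bar> \<le> D \<or> \<bar>foot Y \<tau> x - foot Y \<tau> p\<bar> \<le> D"
    proof (rule ccontr)
      assume "\<not> ?thesis"
      then have far: "\<not> \<bar>foot Y \<sigma> x - foot Y \<sigma> p\<bar> \<le> D" "\<not> \<bar>foot Y \<tau> x - foot Y \<tau> p\<bar> \<le> D" by auto
      obtain \<mu> t where m: "0 \<le> \<mu>" "\<mu> \<le> 1" "\<bar>t - foot Y \<sigma> p\<bar> = D" "d (pt p x \<mu>) (\<sigma> t) \<le> C" "\<bar>d p (pt p x \<mu>) - D\<bar> \<le> E"
        using pass[OF \<sigma> far(1)] by (auto simp: E_def)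
      obtain \<nu> u where n: "0 \<le> \<nu>" "\<nu> \<le> 1" "d (pt p x \<nu>) (\<tau> u) \<le> C" "\<bar>d p (pt p x \<nu>) - D\<bar> \<le> E"
        using pass[OF \<tau> far(2)] by (auto simp: E_def)
      \<comment> \<open>Both passages lie on one segment at nearly the same distance from
        \<open>p\<close>. The two lines thus come close to each other far out, against the bound
        \<open>B\<close>.\<close>
      have "d (pt p x \<mu>) (pt p x \<nu>) = \<bar>(\<mu> - \<nu>) * d p x\<bar>" using pt_dist[OF p x] m n by (simp add: abs_mult)
      also have "(\<mu> - \<nu>) * d p x = d p (pt p x \<mu>) - d p (pt p x \<nu>)"
        using pt_dist_left[OF p x] m n by (simp add: left_diff_distrib)
      also have "\<bar>\<dots>\<bar> \<le> 2 * E" using m n by linarith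
      finally have "d (\<sigma> t) (\<tau> u) \<le> 2 * E + 2 * C"
        using mdist_triangle[of "\<sigma> t" Y "pt p x \<mu>" "\<tau> u"] mdist_triangle[of "pt p x \<mu>" Y "pt p x \<nu>" "\<tau> u"] m n p x
        by (simp add: mdist_commute)
      then have "\<bar>t - foot Y \<sigma> (\<tau> u)\<bar> \<le> 2 * E + 2 * C"
        using s.foot_lipschitz[of "\<sigma> t" "\<tau> u"] by simp
      then show False using B[of u] m(3) D C0 by linarith
    qed
  qed
qed

text \<open>When the segment is near \<open>b\<close>, its foot on \<open>\<tau>\<close> is far out,
  so by \<open>D\<close> its foot on \<open>\<sigma>\<close> is back near that of \<open>p\<close>.
  Contraction then forces a return to \<open>\<sigma>\<close> close to \<open>p\<close> after the
  passage near \<open>a\<close>, although the distance to \<open>p\<close> only grows along the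
  segment.\<close>

lemma not_both_near:
  assumes \<sigma>: "geodesic_on Y UNIV \<sigma>" "contracting Y \<sigma> C" and p: "p \<in> M" and x: "x \<in> M"
    and \<tau>: "geodesic_on Y UNIV \<tau>"
    and D: "\<And>x. x \<in> M \<Longrightarrow> \<bar>foot Y \<sigma> x - foot Y \<sigma> p\<bar> \<le> D \<or> \<bar>foot Y \<tau> x - foot Y \<tau> p\<bar> \<le> D"
    and a: "a \<in> M" "foot Y \<sigma> a = foot Y \<sigma> p + L" and b: "b \<in> M" "foot Y \<tau> b = foot Y \<tau> p + L"
    and L: "2 * R + D + C + height Y \<sigma> p < L" "0 \<le> R" "0 \<le> D"
    and s: "0 \<le> s" "s \<le> u" "u \<le> 1" and near: "d (pt p x s) a \<le> R" "d (pt p x u) b \<le> R"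
  shows False
proof -
  interpret s: gline Y \<sigma> by unfold_locales (rule \<sigma>)
  interpret t: gline Y \<tau> by unfold_locales (rule \<tau>)
  have C0: "0 < C" using \<sigma>(2) by (simp add: contracting_def)
  let ?z = "pt p x s" and ?w = "pt p x u"
  have M: "?z \<in> M" "?w \<in> M" using s p x by auto
  have "\<not> \<bar>foot Y \<tau> ?w - foot Y \<tau> p\<bar> \<le> D"
    using t.foot_lipschitz[OF M(2) b(1)] near(2) b(2) L C0 s.height_nonneg[of p] by linarith
  then have wD: "\<bar>foot Y \<sigma> ?w - foot Y \<sigma> p\<bar> \<le> D" using D[OF M(2)] by blast
  have "C \<le> \<bar>foot Y \<sigma> ?z - foot Y \<sigma> ?w\<bar>"
    using s.foot_lipschitz[OF M(1) a(1)] near(1) a(2) L wD s.height_nonneg[of p] by linarith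
  then obtain \<mu> where mu: "0 \<le> \<mu>" "\<mu> \<le> 1" "d (pt ?z ?w \<mu>) (\<sigma> (foot Y \<sigma> ?w)) \<le> C"
    using s.contractingD[OF \<sigma>(2) M, of "foot Y \<sigma> ?w"] by auto
  define v where "v = (1 - \<mu>) * s + \<mu> * u"
  have v: "pt ?z ?w \<mu> = pt p x v"
    using pt_reparam[OF p x _ _ s(2) mu(1,2)] s by (simp add: v_def)
  have "v = s + \<mu> * (u - s)" by (simp add: v_def algebra_simps)
  moreover have "\<mu> * (u - s) \<le> u - s" using mu s mult_left_le_one_le[of "u - s" \<mu>] by simp
  moreover have "0 \<le> \<mu> * (u - s)" using mu s by simp
  ultimately have vs: "s \<le> v" "v \<le> 1" using s(3) by simp_all
  have "d p ?z \<le> d p (pt p x v)"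
    using pt_dist_left[OF p x, of s] pt_dist_left[OF p x, of v] s vs by (simp add: mult_right_mono)
  moreover have "d p (pt p x v) \<le> C + D + height Y \<sigma> p"
    using mdist_triangle[of p Y "\<sigma> (foot Y \<sigma> ?w)" "pt p x v"] s.dist_line_ge[OF p, of "foot Y \<sigma> ?w"] wD mu(3) v p x s vs
    by (simp add: mdist_commute)
  moreover have "L \<le> d p a" using s.foot_lipschitz[OF p a(1)] a(2) by linarith
  moreover have "d p a \<le> d p ?z + R" using mdist_triangle[OF p M(1) a(1)] near(1) by linarith
  ultimately show False using L by linarith
qed

text \<open>The lines are axes of the conjugates of \<open>g\<close> by powers of \<open>f\<close>.
  Undoing the first power turns their mutual projection into that of a translate of
  \<open>\<tau>\<close> to \<open>\<tau>\<close>, to which \<open>bounded_foot_translate\<close>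
  applies once \<open>N\<close> is large.\<close>

lemma independent_conjugates:
  assumes lc: "locally_compact_space (mtopology_of Y)" and ind: "independent_rank_one Y g f"
  shows "\<exists>\<tau> l C N\<^sub>0. geodesic_on Y UNIV \<tau> \<and> 0 < l \<and> (\<forall>t. g (\<tau> t) = \<tau> (t + l)) \<and> contracting Y \<tau> C \<and>
    (\<forall>N::nat. \<forall>j k. N\<^sub>0 \<le> N \<and> j \<noteq> k \<longrightarrow>
       (\<exists>B. \<forall>t. \<bar>foot Y (\<lambda>t. (f [^]\<^bsub>isometry_group Y\<^esub> (int N * int j)) (\<tau> t))
                ((f [^]\<^bsub>isometry_group Y\<^esub> (int N * int k)) (\<tau> t))\<bar> \<le> B))"
proof -
  interpret G: group "isometry_group Y" by (rule group_isometry_group)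
  have r: "rank_one Y g" "rank_one Y f" using ind by (auto simp: independent_rank_one_def)
  then have f: "f \<in> carrier (isometry_group Y)" by (simp add: rank_one_def axial_def)
  obtain \<tau> C where \<tau>: "is_axis Y g \<tau>" "contracting Y \<tau> C" using rank_one_contracting[OF lc r(1)] by blast
  obtain \<sigma> K where \<sigma>: "is_axis Y f \<sigma>" "contracting Y \<sigma> K" using rank_one_contracting[OF lc r(2)] by blast
  obtain l where l: "geodesic_on Y UNIV \<tau>" "0 < l" "\<And>t. g (\<tau> t) = \<tau> (t + l)"
    using \<tau>(1) unfolding is_axis_def by blast
  obtain m where m: "geodesic_on Y UNIV \<sigma>" "0 < m" "\<And>t. f (\<sigma> t) = \<sigma> (t + m)"
    using \<sigma>(1) unfolding is_axis_def by blast
  obtain B where B: "\<And>t. \<bar>foot Y \<sigma> (\<tau> t)\<bar> \<le> B"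
    using independent_bounded_foot[OF ind \<tau>(1) \<sigma>] by blast
  obtain N\<^sub>0 :: nat where N0: "2 * B + K < real N\<^sub>0 * m" using reals_Archimedean3[OF m(2)] by blast
  have \<tau>M: "\<tau> t \<in> M" for t using l(1) by (auto simp: geodesic_on_def)
  have "\<exists>B. \<forall>t. \<bar>foot Y (\<lambda>t. (f [^]\<^bsub>isometry_group Y\<^esub> (int N * int j)) (\<tau> t))
                ((f [^]\<^bsub>isometry_group Y\<^esub> (int N * int k)) (\<tau> t))\<bar> \<le> B"
    if N: "N\<^sub>0 \<le> N" and jk: "j \<noteq> k" for N j k
  proof -
    define e where "e = int N * (int k - int j)"
    have "real N\<^sub>0 * m \<le> real N * m" using N m(2) by (intro mult_right_mono) auto
    also have "\<dots> \<le> \<bar>of_int e\<bar> * m"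
    proof (intro mult_right_mono)
      have "1 \<le> \<bar>int k - int j\<bar>" using jk by simp
      then have "int N * 1 \<le> int N * \<bar>int k - int j\<bar>" by (intro mult_left_mono) auto
      then have "int N \<le> \<bar>e\<bar>" by (simp add: e_def abs_mult)
      then show "real N \<le> \<bar>of_int e\<bar>" by linarith
    qed (use m in auto)
    finally have e: "2 * B + K \<le> \<bar>of_int e\<bar> * m" using N0 by simp
    obtain B' where B': "\<And>t. \<bar>foot Y \<tau> ((f [^]\<^bsub>isometry_group Y\<^esub> e) (\<tau> t))\<bar> \<le> B'"
      using bounded_foot_translate[OF f m \<sigma>(2) l(1) B e] by blast
    have "(f [^]\<^bsub>isometry_group Y\<^esub> (int N * int k)) (\<tau> t)
        = (f [^]\<^bsub>isometry_group Y\<^esub> (int N * int j)) ((f [^]\<^bsub>isometry_group Y\<^esub> e) (\<tau> t))" for t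
    proof -
      have "int N * int k = int N * int j + e" by (simp add: e_def algebra_simps)
      then show ?thesis
        using isometry_group_mult_apply[OF G.int_pow_closed[OF f] G.int_pow_closed[OF f] \<tau>M] G.int_pow_mult[OF f] by metis
    qed
    then have "foot Y (\<lambda>t. (f [^]\<^bsub>isometry_group Y\<^esub> (int N * int j)) (\<tau> t))
                ((f [^]\<^bsub>isometry_group Y\<^esub> (int N * int k)) (\<tau> t)) = foot Y \<tau> ((f [^]\<^bsub>isometry_group Y\<^esub> e) (\<tau> t))" for t
      using foot_image[OF G.int_pow_closed[OF f] l(1) isometry_group_apply(1)[OF G.int_pow_closed[OF f] \<tau>M]] by simp
    then show ?thesis using B' by (intro exI[of _ B']) simp
  qed
  then show ?thesis using l \<tau>(2) by blast
qed

end

section \<open>Simultaneous extension in all factors\<close>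

lemma eventually_nat_mult_ge:
  fixes c l :: real assumes "0 < l" shows "\<forall>\<^sub>F n in sequentially. c \<le> real n * l"
proof -
  obtain N :: nat where N: "c < real N * l" using reals_Archimedean3[OF assms] by blast
  have "c \<le> real n * l" if "N \<le> n" for n
  proof -
    have "real N * l \<le> real n * l" using that assms by (intro mult_right_mono) auto
    then show ?thesis using N by simp
  qed
  then show ?thesis unfolding eventually_sequentially by blast
qed

locale product_action =
  fixes X :: "'i::finite \<Rightarrow> 'a metric" and \<Gamma> :: "('i \<Rightarrow> 'a \<Rightarrow> 'a) set" and p :: "'i \<Rightarrow> 'a"
  assumes hadamard: "\<And>i. hadamard_space (X i)"
    and loc_compact: "\<And>i. locally_compact_space (mtopology_of (X i))"
    and sub: "subgroup \<Gamma> (product_group UNIV (\<lambda>i. isometry_group (X i)))"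
    and discontinuous: "properly_discontinuous X \<Gamma>"
    and base: "p \<in> mspace (product_metric X)"
begin

abbreviation "G \<equiv> product_group UNIV (\<lambda>i. isometry_group (X i))"

lemma hadamard_factor: "hadamard (X i)"
  by unfold_locales (rule hadamard)

lemma base_in [simp, intro]: "p i \<in> mspace (X i)"
  using base by (simp add: mspace_product_metric)

sublocale G: group G
  by (rule product_group) (rule group_isometry_group)

lemma \<Gamma>_carrier: "\<gamma> \<in> \<Gamma> \<Longrightarrow> \<gamma> \<in> carrier G"
  using subgroup.subset[OF sub] by blast

lemma comp_carrier: "\<gamma> \<in> \<Gamma> \<Longrightarrow> \<gamma> i \<in> carrier (isometry_group (X i))"
  using \<Gamma>_carrier by fastforce

lemma comp_in [simp, intro]: "\<gamma> \<in> \<Gamma> \<Longrightarrow> x \<in> mspace (X i) \<Longrightarrow> \<gamma> i x \<in> mspace (X i)"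
  using isometry_group_apply(1)[OF comp_carrier] by blast

lemma comp_dist: "\<gamma> \<in> \<Gamma> \<Longrightarrow> x \<in> mspace (X i) \<Longrightarrow> y \<in> mspace (X i)
    \<Longrightarrow> mdist (X i) (\<gamma> i x) (\<gamma> i y) = mdist (X i) x y"
  using isometry_group_apply(2)[OF comp_carrier] by blast

lemma comp_mult: "\<gamma> \<in> \<Gamma> \<Longrightarrow> \<gamma>' \<in> \<Gamma> \<Longrightarrow> x \<in> mspace (X i) \<Longrightarrow> (\<gamma> \<otimes>\<^bsub>G\<^esub> \<gamma>') i x = \<gamma> i (\<gamma>' i x)"
  using isometry_group_mult_apply[OF comp_carrier comp_carrier] by simp

lemma comp_inv:
  assumes "\<gamma> \<in> \<Gamma>" "x \<in> mspace (X i)"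
  shows "(inv\<^bsub>G\<^esub> \<gamma>) i (\<gamma> i x) = x" "\<gamma> i ((inv\<^bsub>G\<^esub> \<gamma>) i x) = x"
proof -
  have "inv\<^bsub>G\<^esub> \<gamma> = (\<lambda>i\<in>UNIV. inv\<^bsub>isometry_group (X i)\<^esub> \<gamma> i)"
    using \<Gamma>_carrier[OF assms(1)] by (intro inv_product_group group_isometry_group) auto
  then show "(inv\<^bsub>G\<^esub> \<gamma>) i (\<gamma> i x) = x" "\<gamma> i ((inv\<^bsub>G\<^esub> \<gamma>) i x) = x"
    using isometry_group_inv_apply[OF comp_carrier[OF assms(1)] assms(2)] by simp_all
qed

lemma \<Gamma>_closed: "\<gamma> \<in> \<Gamma> \<Longrightarrow> \<gamma>' \<in> \<Gamma> \<Longrightarrow> \<gamma> \<otimes>\<^bsub>G\<^esub> \<gamma>' \<in> \<Gamma>" "\<gamma> \<in> \<Gamma> \<Longrightarrow> inv\<^bsub>G\<^esub> \<gamma> \<in> \<Gamma>" "\<one>\<^bsub>G\<^esub> \<in> \<Gamma>"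
  using subgroup.m_closed[OF sub] subgroup.m_inv_closed[OF sub] subgroup.one_closed[OF sub] by blast+

lemma \<Gamma>_pow: "\<gamma> \<in> \<Gamma> \<Longrightarrow> \<gamma> [^]\<^bsub>G\<^esub> (n::nat) \<in> \<Gamma>"
  by (induction n) (auto simp: \<Gamma>_closed simp del: mult_product_group one_product_group)

lemma comp_pow: "\<gamma> \<in> \<Gamma> \<Longrightarrow> (\<gamma> [^]\<^bsub>G\<^esub> (n::nat)) i = \<gamma> i [^]\<^bsub>isometry_group (X i)\<^esub> n"
  by (induction n) auto

definition len :: "('i \<Rightarrow> 'a \<Rightarrow> 'a) \<Rightarrow> 'i \<Rightarrow> real" where
  "len \<gamma> i = mdist (X i) (p i) (\<gamma> i (p i))"

text \<open>The parameter is chosen separately in each factor; the passages in different factors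
  need not be simultaneous.\<close>

definition near :: "real \<Rightarrow> ('i \<Rightarrow> 'a \<Rightarrow> 'a) \<Rightarrow> ('i \<Rightarrow> 'a \<Rightarrow> 'a) \<Rightarrow> bool" where
  "near R \<gamma>\<^sub>1 \<gamma> \<longleftrightarrow> (\<forall>i. \<exists>\<tau>. 0 \<le> \<tau> \<and> \<tau> \<le> 1 \<and>
     mdist (X i) (geo_pt (X i) (p i) (\<gamma> i (p i)) \<tau>) (\<gamma>\<^sub>1 i (p i)) \<le> R)"

lemma len_nonneg [simp]: "0 \<le> len \<gamma> i"
  by (simp add: len_def)

end

text \<open>The elements produced below are conjugates of one element, so \<open>l\<close> and
  \<open>C\<close> depend on the factor only.\<close>

locale independent_family = product_action X \<Gamma> p
  for X :: "'i::finite \<Rightarrow> 'a metric" and \<Gamma> p +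
  fixes F :: "nat \<Rightarrow> 'i \<Rightarrow> 'a \<Rightarrow> 'a" and S :: "nat \<Rightarrow> 'i \<Rightarrow> real \<Rightarrow> 'a" and l C :: "'i \<Rightarrow> real"
  assumes F: "F k \<in> \<Gamma>" and S: "geodesic_on (X i) UNIV (S k i)" and l: "0 < l i"
    and translate: "F k i (S k i t) = S k i (t + l i)"
    and contr: "contracting (X i) (S k i) (C i)"
    and bounded: "j \<noteq> k \<Longrightarrow> \<exists>B. \<forall>t. \<bar>foot (X i) (S j i) (S k i t)\<bar> \<le> B"

text \<open>The conjugating powers of \<open>h\<close> act on all factors at once, so the exponents
  \<open>N\<^sub>0 i\<close> required by the factors are replaced by their maximum.\<close>

lemma (in product_action) independent_family_exists:
  assumes "\<exists>g\<in>\<Gamma>. \<exists>h\<in>\<Gamma>. independent_regular_axial X g h"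
  shows "\<exists>F S l C. independent_family X \<Gamma> p F S l C"
proof -
  obtain g h where gh: "g \<in> \<Gamma>" "h \<in> \<Gamma>" and ind: "\<And>i. independent_rank_one (X i) (g i) (h i)"
    using assms by (auto simp: independent_regular_axial_def)
  let ?I = "\<lambda>i. isometry_group (X i)"
  define P where "P i \<tau> l C N\<^sub>0 \<longleftrightarrow> geodesic_on (X i) UNIV \<tau> \<and> 0 < l \<and> (\<forall>t. g i (\<tau> t) = \<tau> (t + l)) \<and> contracting (X i) \<tau> C \<and>
    (\<forall>N::nat. \<forall>j k. N\<^sub>0 \<le> N \<and> j \<noteq> k \<longrightarrow>
       (\<exists>B. \<forall>t. \<bar>foot (X i) (\<lambda>t. (h i [^]\<^bsub>?I i\<^esub> (int N * int j)) (\<tau> t)) ((h i [^]\<^bsub>?I i\<^esub> (int N * int k)) (\<tau> t))\<bar> \<le> B))"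
    for i \<tau> l C and N\<^sub>0 :: nat
  have "\<exists>\<tau> l C N\<^sub>0. P i \<tau> l C N\<^sub>0" for i
    unfolding P_def by (rule hadamard.independent_conjugates[OF hadamard_factor loc_compact ind])
  then obtain \<tau> l C N\<^sub>0 where P: "\<And>i. P i (\<tau> i) (l i) (C i) (N\<^sub>0 i)" by metis
  define N where "N = Max (range N\<^sub>0)"
  have N: "N\<^sub>0 i \<le> N" for i by (simp add: N_def)
  define a where "a k = h [^]\<^bsub>G\<^esub> (N * k)" for k
  have a: "a k \<in> \<Gamma>" for k using \<Gamma>_pow[OF gh(2)] by (simp add: a_def)
  have a_comp: "a k i = h i [^]\<^bsub>?I i\<^esub> (int N * int k)" for k i
    using comp_pow[OF gh(2)] by (simp add: a_def int_pow_int flip: of_nat_mult)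
  define F where "F k = a k \<otimes>\<^bsub>G\<^esub> (g \<otimes>\<^bsub>G\<^esub> inv\<^bsub>G\<^esub> (a k))" for k
  define S where "S k i t = a k i (\<tau> i t)" for k i t
  have F: "F k \<in> \<Gamma>" for k unfolding F_def by (intro \<Gamma>_closed a gh)
  have \<tau>: "geodesic_on (X i) UNIV (\<tau> i)" "0 < l i" "\<And>t. g i (\<tau> i t) = \<tau> i (t + l i)" "contracting (X i) (\<tau> i) (C i)" for i
    using P[of i] by (auto simp: P_def)
  have \<tau>M: "\<tau> i t \<in> mspace (X i)" for i t using \<tau>(1)[of i] by (auto simp: geodesic_on_def)
  have "independent_family X \<Gamma> p F S l C"
  proof
    fix i j k t
    show "F k \<in> \<Gamma>" by (rule F)
    show "0 < l i" by (rule \<tau>)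
    show "geodesic_on (X i) UNIV (S k i)"
      using hadamard.geodesic_line_image[OF hadamard_factor comp_carrier[OF a] \<tau>(1)] by (simp add: S_def[abs_def])
    show "contracting (X i) (S k i) (C i)"
      using hadamard.contracting_image[OF hadamard_factor comp_carrier[OF a] \<tau>(1,4)] by (simp add: S_def[abs_def])
    show "F k i (S k i t) = S k i (t + l i)"
      unfolding F_def S_def using a gh \<tau>M comp_inv(1)[OF a \<tau>M] \<tau>(3)
      by (simp add: comp_mult \<Gamma>_closed del: mult_product_group inv_product_group)
    show "\<exists>B. \<forall>t. \<bar>foot (X i) (S j i) (S k i t)\<bar> \<le> B" if "j \<noteq> k"
      using P[of i] N[of i] that by (simp add: P_def S_def[abs_def] a_comp)
  qed
  then show ?thesis by blast
qed

context independent_family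
begin

lemma far_foot_bound:
  "\<exists>D\<ge>0. \<forall>j<n. \<forall>k<n. j \<noteq> k \<longrightarrow> (\<forall>i. \<forall>x\<in>mspace (X i).
     \<bar>foot (X i) (S j i) x - foot (X i) (S j i) (p i)\<bar> \<le> D \<or> \<bar>foot (X i) (S k i) x - foot (X i) (S k i) (p i)\<bar> \<le> D)"
proof -
  let ?P = "\<lambda>D j k. j \<noteq> k \<longrightarrow> (\<forall>i. \<forall>x\<in>mspace (X i).
     \<bar>foot (X i) (S j i) x - foot (X i) (S j i) (p i)\<bar> \<le> D \<or> \<bar>foot (X i) (S k i) x - foot (X i) (S k i) (p i)\<bar> \<le> D)"
  have "\<forall>\<^sub>F D in at_top. ?P D j k" for j k
  proof (cases "j = k")
    case False
    have "\<forall>\<^sub>F D in at_top. \<forall>i. \<forall>x\<in>mspace (X i).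
     \<bar>foot (X i) (S j i) x - foot (X i) (S j i) (p i)\<bar> \<le> D \<or> \<bar>foot (X i) (S k i) x - foot (X i) (S k i) (p i)\<bar> \<le> D"
    proof (rule eventually_all_finite)
      fix i
      obtain B where "\<And>t. \<bar>foot (X i) (S j i) (S k i t)\<bar> \<le> B" using bounded[OF False] by blast
      then show "\<forall>\<^sub>F D in at_top. \<forall>x\<in>mspace (X i).
     \<bar>foot (X i) (S j i) x - foot (X i) (S j i) (p i)\<bar> \<le> D \<or> \<bar>foot (X i) (S k i) x - foot (X i) (S k i) (p i)\<bar> \<le> D"
        by (intro hadamard.eventually_at_most_one_far_foot[OF hadamard_factor S contr S contr]) auto
    qed
    then show ?thesis by (rule eventually_mono) blast
  qed simp
  then have "\<forall>\<^sub>F D in at_top. \<forall>j\<in>{..<n}. \<forall>k\<in>{..<n}. ?P D j k"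
    by (intro eventually_ball_finite ballI) auto
  then have "\<forall>\<^sub>F D in at_top. 0 \<le> D \<and> (\<forall>j\<in>{..<n}. \<forall>k\<in>{..<n}. ?P D j k)"
    using eventually_ge_at_top[of "0::real"] by eventually_elim auto
  then obtain D where "0 \<le> D \<and> (\<forall>j\<in>{..<n}. \<forall>k\<in>{..<n}. ?P D j k)"
    using eventually_happens'[OF trivial_limit_at_top_linorder] by blast
  then show ?thesis by (intro exI[of _ D]) auto
qed

lemma foot_pow:
  assumes x: "x \<in> mspace (X i)"
  shows "foot (X i) (S k i) ((F k [^]\<^bsub>G\<^esub> (n::nat)) i x) = foot (X i) (S k i) x + real n * l i"
proof -
  interpret I: group "isometry_group (X i)" by (rule group_isometry_group)
  have f: "F k i \<in> carrier (isometry_group (X i))" using comp_carrier[OF F] .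
  have "(F k i [^]\<^bsub>isometry_group (X i)\<^esub> int n) (S k i t) = S k i (t + real n * l i)" for t
    using translation_pow[OF f S translate, of "int n" t] by simp
  from hadamard.foot_translate[OF hadamard_factor I.int_pow_closed[OF f] S this x]
  show ?thesis unfolding comp_pow[OF F] int_pow_int .
qed

lemma good_index_exists:
  assumes n: "n = 2 * CARD('i) + 1"
    and D: "\<And>j k i x. j < n \<Longrightarrow> k < n \<Longrightarrow> j \<noteq> k \<Longrightarrow> x \<in> mspace (X i) \<Longrightarrow>
     \<bar>foot (X i) (S j i) x - foot (X i) (S j i) (p i)\<bar> \<le> D \<or> \<bar>foot (X i) (S k i) x - foot (X i) (S k i) (p i)\<bar> \<le> D"
    and xy: "\<And>i. x i \<in> mspace (X i)" "\<And>i. y i \<in> mspace (X i)"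
  shows "\<exists>j<n. \<forall>i. \<bar>foot (X i) (S j i) (x i) - foot (X i) (S j i) (p i)\<bar> \<le> D
     \<and> \<bar>foot (X i) (S j i) (y i) - foot (X i) (S j i) (p i)\<bar> \<le> D"
proof -
  define bad where "bad z i = {j\<in>{..<n}. \<not> \<bar>foot (X i) (S j i) (z i) - foot (X i) (S j i) (p i)\<bar> \<le> D}" for z :: "'i \<Rightarrow> 'a" and i
  have fin: "finite (bad z i)" for z i by (simp add: bad_def)
  have one: "card (bad z i) \<le> 1" if "\<And>i. z i \<in> mspace (X i)" for z i
  proof -
    have "\<forall>j\<in>bad z i. \<forall>k\<in>bad z i. j = k" using D[of _ _ "z i" i] that by (auto simp: bad_def)
    then show ?thesis using card_le_Suc0_iff_eq[OF fin] by simp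
  qed
  have "card (\<Union>i. bad x i \<union> bad y i) \<le> (\<Sum>i\<in>UNIV. card (bad x i \<union> bad y i))" by (rule card_UN_le) simp
  also have "\<dots> \<le> (\<Sum>i\<in>(UNIV::'i set). 2)"
    using one[of x] one[of y] xy by (intro sum_mono order_trans[OF card_Un_le]) (metis add_mono one_add_one)
  also have "\<dots> < card {..<n}" by (simp add: n)
  finally have "\<not> {..<n} \<subseteq> (\<Union>i. bad x i \<union> bad y i)"
    using card_mono[of "\<Union>i. bad x i \<union> bad y i" "{..<n}"] fin by auto
  then obtain j where "j < n" "\<And>i. j \<notin> bad x i" "\<And>i. j \<notin> bad y i" by blast
  then show ?thesis by (intro exI[of _ j]) (auto simp: bad_def)
qed

text \<open>Each of \<open>\<gamma>\<^sub>1\<^sup>-\<^sup>1 p\<close> and \<open>\<gamma>\<^sub>2 p\<close> spoils at most one of the independent lines in each factor, so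
  among \<open>2 * CARD('i) + 1\<close> of them one is good for both points in all factors at once.\<close>

theorem extension:
  "\<exists>A R. finite A \<and> A \<subseteq> \<Gamma> \<and> 0 \<le> R \<and> (\<forall>\<gamma>\<^sub>1\<in>\<Gamma>. \<forall>\<gamma>\<^sub>2\<in>\<Gamma>. \<exists>f\<in>A. near R \<gamma>\<^sub>1 (\<gamma>\<^sub>1 \<otimes>\<^bsub>G\<^esub> (f \<otimes>\<^bsub>G\<^esub> \<gamma>\<^sub>2)))"
proof -
  define n where "n = 2 * CARD('i) + 1"
  obtain D where D0: "0 \<le> D" and D1: "\<forall>j<n. \<forall>k<n. j \<noteq> k \<longrightarrow> (\<forall>i. \<forall>x\<in>mspace (X i).
     \<bar>foot (X i) (S j i) x - foot (X i) (S j i) (p i)\<bar> \<le> D \<or> \<bar>foot (X i) (S k i) x - foot (X i) (S k i) (p i)\<bar> \<le> D)"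
    using far_foot_bound[of n] by (elim exE conjE)
  have D: "\<bar>foot (X i) (S j i) x - foot (X i) (S j i) (p i)\<bar> \<le> D \<or> \<bar>foot (X i) (S k i) x - foot (X i) (S k i) (p i)\<bar> \<le> D"
    if "j < n" "k < n" "j \<noteq> k" "x \<in> mspace (X i)" for j k i x
    using D1[rule_format, OF that] .
  \<comment> \<open>The translation has to outweigh the deviation \<open>D\<close> of each of the
    two feet and leave the threshold \<open>C i\<close> of contraction.\<close>
  have "\<forall>\<^sub>F N in sequentially. \<forall>i. 2 * D + C i \<le> real N * l i"
    by (intro eventually_all_finite eventually_nat_mult_ge l)
  then obtain N :: nat where N: "\<And>i. 2 * D + C i \<le> real N * l i"
    using eventually_happens'[OF sequentially_bot] by blast
  have "\<forall>\<^sub>F R in at_top. \<forall>j\<in>{..<n}. \<forall>i. C i + D + height (X i) (S j i) (p i) \<le> R"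
    by (intro eventually_ball_finite ballI eventually_all_finite eventually_ge_at_top) auto
  then have ev: "\<forall>\<^sub>F R in at_top. 0 \<le> R \<and> (\<forall>j\<in>{..<n}. \<forall>i. C i + D + height (X i) (S j i) (p i) \<le> R)"
    using eventually_ge_at_top[of "0::real"] by eventually_elim auto
  obtain R :: real where R1: "0 \<le> R \<and> (\<forall>j\<in>{..<n}. \<forall>i. C i + D + height (X i) (S j i) (p i) \<le> R)"
    using eventually_happens'[OF trivial_limit_at_top_linorder ev] ..
  then have R: "0 \<le> R" "\<And>j i. j < n \<Longrightarrow> C i + D + height (X i) (S j i) (p i) \<le> R" by auto
  define A where "A = (\<lambda>j. F j [^]\<^bsub>G\<^esub> N) ` {..<n}"
  have A: "A \<subseteq> \<Gamma>" using \<Gamma>_pow[OF F] by (auto simp: A_def)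
  have "\<exists>f\<in>A. near R \<gamma>\<^sub>1 (\<gamma>\<^sub>1 \<otimes>\<^bsub>G\<^esub> (f \<otimes>\<^bsub>G\<^esub> \<gamma>\<^sub>2))" if g: "\<gamma>\<^sub>1 \<in> \<Gamma>" "\<gamma>\<^sub>2 \<in> \<Gamma>" for \<gamma>\<^sub>1 \<gamma>\<^sub>2
  proof -
    \<comment> \<open>Everything is moved by the inverse of \<open>\<gamma>\<^sub>1\<close>: the
      segment from \<open>x\<close> to the image of \<open>y\<close> under the inserted element has
      to pass near \<open>p\<close>.\<close>
    define x where "x i = (inv\<^bsub>G\<^esub> \<gamma>\<^sub>1) i (p i)" for i
    define y where "y i = \<gamma>\<^sub>2 i (p i)" for i
    have xM: "x i \<in> mspace (X i)" and yM: "y i \<in> mspace (X i)" for i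
      using g \<Gamma>_closed(2)[OF g(1)] by (auto simp: x_def y_def simp del: inv_product_group)
    obtain j where j: "j < n" "\<And>i. \<bar>foot (X i) (S j i) (x i) - foot (X i) (S j i) (p i)\<bar> \<le> D"
        "\<And>i. \<bar>foot (X i) (S j i) (y i) - foot (X i) (S j i) (p i)\<bar> \<le> D"
      using good_index_exists[OF n_def D xM yM] by blast
    define f where "f = F j [^]\<^bsub>G\<^esub> N"
    have f: "f \<in> \<Gamma>" "f \<in> A" using \<Gamma>_pow[OF F] j by (auto simp: f_def A_def)
    have "near R \<gamma>\<^sub>1 (\<gamma>\<^sub>1 \<otimes>\<^bsub>G\<^esub> (f \<otimes>\<^bsub>G\<^esub> \<gamma>\<^sub>2))"
      unfolding near_def
    proof
      fix i
      interpret s: gline "X i" "S j i"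
        by (intro gline.intro hadamard_factor gline_axioms.intro S)
      let ?\<sigma> = "S j i" and ?x = "x i" and ?y = "f i (y i)"
      have M: "?x \<in> mspace (X i)" "?y \<in> mspace (X i)" using xM yM f by auto
      have "foot (X i) ?\<sigma> ?y = foot (X i) ?\<sigma> (y i) + real N * l i"
        unfolding f_def by (rule foot_pow[OF yM])
      then have "C i \<le> \<bar>foot (X i) ?\<sigma> ?x - foot (X i) ?\<sigma> ?y\<bar>"
        using j(2)[of i] j(3)[of i] N[of i] by linarith
      then obtain \<tau> where t: "0 \<le> \<tau>" "\<tau> \<le> 1" "mdist (X i) (geo_pt (X i) ?x ?y \<tau>) (?\<sigma> (foot (X i) ?\<sigma> ?x)) \<le> C i"
        using s.contractingD[OF contr M, of "foot (X i) ?\<sigma> ?x"] by auto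
      let ?z = "geo_pt (X i) ?x ?y \<tau>"
      have zM: "?z \<in> mspace (X i)" using M t by auto
      have "mdist (X i) (?\<sigma> (foot (X i) ?\<sigma> ?x)) (p i) \<le> D + height (X i) ?\<sigma> (p i)"
        using s.dist_line_ge[OF base_in, of "foot (X i) ?\<sigma> ?x"] j(2)[of i] by (simp add: mdist_commute)
      then have "mdist (X i) ?z (p i) \<le> R"
        using mdist_triangle[of ?z "X i" "?\<sigma> (foot (X i) ?\<sigma> ?x)" "p i"] zM t R(2)[OF j(1), of i] by simp
      moreover have "\<gamma>\<^sub>1 i ?z = geo_pt (X i) (p i) ((\<gamma>\<^sub>1 \<otimes>\<^bsub>G\<^esub> (f \<otimes>\<^bsub>G\<^esub> \<gamma>\<^sub>2)) i (p i)) \<tau>"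
        using s.pt_isometry[OF comp_carrier[OF g(1)] M t(1,2)] comp_inv(2)[OF g(1) base_in] g f
        by (simp add: x_def y_def comp_mult \<Gamma>_closed del: mult_product_group inv_product_group)
      ultimately show "\<exists>\<tau>. 0 \<le> \<tau> \<and> \<tau> \<le> 1 \<and>
         mdist (X i) (geo_pt (X i) (p i) ((\<gamma>\<^sub>1 \<otimes>\<^bsub>G\<^esub> (f \<otimes>\<^bsub>G\<^esub> \<gamma>\<^sub>2)) i (p i)) \<tau>) (\<gamma>\<^sub>1 i (p i)) \<le> R"
        using t comp_dist[OF g(1) zM base_in] by (intro exI[of _ \<tau>]) auto
    qed
    then show ?thesis using f by blast
  qed
  then show ?thesis using A R(1) by (intro exI[of _ A] exI[of _ R]) (auto simp: A_def)
qed

text \<open>Large powers of different members of the family move \<open>p\<close> far along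
  different axes, and by \<open>not_both_near\<close> no geodesic from \<open>p\<close> passes near
  two such points. This gives arbitrarily many elements of multiplicity one.\<close>

lemma separated_set_exists:
  assumes R: "0 \<le> R"
  shows "\<exists>B. finite B \<and> card B = n \<and> B \<subseteq> \<Gamma> \<and> (\<forall>\<gamma>\<in>\<Gamma>. card {b\<in>B. near R b \<gamma>} \<le> 1)"
proof -
  obtain D where D0: "0 \<le> D" and D1: "\<forall>j<n. \<forall>k<n. j \<noteq> k \<longrightarrow> (\<forall>i. \<forall>x\<in>mspace (X i).
     \<bar>foot (X i) (S j i) x - foot (X i) (S j i) (p i)\<bar> \<le> D \<or> \<bar>foot (X i) (S k i) x - foot (X i) (S k i) (p i)\<bar> \<le> D)"
    using far_foot_bound[of n] by (elim exE conjE)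
  have D: "\<bar>foot (X i) (S j i) x - foot (X i) (S j i) (p i)\<bar> \<le> D \<or> \<bar>foot (X i) (S k i) x - foot (X i) (S k i) (p i)\<bar> \<le> D"
    if "j < n" "k < n" "j \<noteq> k" "x \<in> mspace (X i)" for j k i x
    using D1[rule_format, OF that] .
  \<comment> \<open>\<open>near\<close> holds in every factor, so a contradiction in an arbitrary
    one is enough.\<close>
  define i :: 'i where "i = undefined"
  have ev: "\<forall>\<^sub>F N in sequentially. \<forall>j\<in>{..<n}. 2 * R + D + C i + height (X i) (S j i) (p i) + 1 \<le> real N * l i"
    by (intro eventually_ball_finite ballI eventually_nat_mult_ge l) auto
  obtain N :: nat where N1: "\<forall>j\<in>{..<n}. 2 * R + D + C i + height (X i) (S j i) (p i) + 1 \<le> real N * l i"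
    using eventually_happens'[OF sequentially_bot ev] ..
  have N: "2 * R + D + C i + height (X i) (S j i) (p i) < real N * l i" if "j < n" for j
    using bspec[OF N1, of j] that by simp
  define b where "b j = F j [^]\<^bsub>G\<^esub> N" for j
  have b: "b j \<in> \<Gamma>" for j using \<Gamma>_pow[OF F] by (simp add: b_def)
  have b_foot: "foot (X i) (S j i) (b j i (p i)) = foot (X i) (S j i) (p i) + real N * l i" for j
    unfolding b_def by (rule foot_pow) simp
  have excl: "j = k" if jk: "j < n" "k < n" and g: "\<gamma> \<in> \<Gamma>" and nr: "near R (b j) \<gamma>" "near R (b k) \<gamma>" for j k \<gamma>
  proof (rule ccontr)
    assume ne: "j \<noteq> k"
    obtain s where s: "0 \<le> s" "s \<le> 1" "mdist (X i) (geo_pt (X i) (p i) (\<gamma> i (p i)) s) (b j i (p i)) \<le> R"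
      using nr(1)[unfolded near_def, THEN spec, of i] by (elim exE conjE)
    obtain u where u: "0 \<le> u" "u \<le> 1" "mdist (X i) (geo_pt (X i) (p i) (\<gamma> i (p i)) u) (b k i (p i)) \<le> R"
      using nr(2)[unfolded near_def, THEN spec, of i] by (elim exE conjE)
    have M: "\<gamma> i (p i) \<in> mspace (X i)" "b j i (p i) \<in> mspace (X i)" "b k i (p i) \<in> mspace (X i)"
      using g b by auto
    interpret had: hadamard "X i" by (rule hadamard_factor)
    have D': "\<bar>foot (X i) (S j i) x - foot (X i) (S j i) (p i)\<bar> \<le> D \<or> \<bar>foot (X i) (S k i) x - foot (X i) (S k i) (p i)\<bar> \<le> D"
        "\<bar>foot (X i) (S k i) x - foot (X i) (S k i) (p i)\<bar> \<le> D \<or> \<bar>foot (X i) (S j i) x - foot (X i) (S j i) (p i)\<bar> \<le> D"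
      if "x \<in> mspace (X i)" for x
      using D[OF jk ne that] by blast+
    note facts = S contr base_in M b_foot N[OF jk(1)] N[OF jk(2)] R D0 s u
    show False
    proof (cases "s \<le> u")
      case True
      show ?thesis
        by (rule had.not_both_near[of "S j i" "C i" "p i" "\<gamma> i (p i)" "S k i" D "b j i (p i)" "real N * l i" "b k i (p i)" R s u])
           (fact facts True | erule D'(1))+
    next
      case False
      then have us: "u \<le> s" by simp
      show ?thesis
        by (rule had.not_both_near[of "S k i" "C i" "p i" "\<gamma> i (p i)" "S j i" D "b k i (p i)" "real N * l i" "b j i (p i)" R u s])
           (fact facts us | erule D'(2))+
    qed
  qed
  have self: "near R \<gamma> \<gamma>" if "\<gamma> \<in> \<Gamma>" for \<gamma>
    unfolding near_def
  proof
    fix i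
    interpret had: hadamard "X i" by (rule hadamard_factor)
    show "\<exists>\<tau>. 0 \<le> \<tau> \<and> \<tau> \<le> 1 \<and> mdist (X i) (geo_pt (X i) (p i) (\<gamma> i (p i)) \<tau>) (\<gamma> i (p i)) \<le> R"
      using that R by (intro exI[of _ 1]) auto
  qed
  have "inj_on b {..<n}"
    using excl self[OF b] by (intro inj_onI) (metis lessThan_iff b)
  then have "card (b ` {..<n}) = n" by (simp add: card_image)
  moreover have "card {x\<in>b ` {..<n}. near R x \<gamma>} \<le> 1" if "\<gamma> \<in> \<Gamma>" for \<gamma>
  proof -
    have "\<forall>x\<in>{x\<in>b ` {..<n}. near R x \<gamma>}. \<forall>y\<in>{x\<in>b ` {..<n}. near R x \<gamma>}. x = y"
      using excl[OF _ _ that] by auto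
    then show ?thesis using card_le_Suc0_iff_eq[of "{x\<in>b ` {..<n}. near R x \<gamma>}"] by simp
  qed
  ultimately show ?thesis using b by (intro exI[of _ "b ` {..<n}"]) auto
qed

end

section \<open>Multiplicities\<close>

lemma (in hadamard) dist_le_of_near_segment:
  assumes M: "x \<in> M" "y \<in> M" "a \<in> M" "b \<in> M"
    and s: "0 \<le> s" "s \<le> 1" "d (pt x y s) a \<le> R" and u: "0 \<le> u" "u \<le> 1" "d (pt x y u) b \<le> R"
  shows "d a b \<le> \<bar>d x a - d x b\<bar> + 4 * R"
proof -
  let ?z = "pt x y s" and ?w = "pt x y u"
  have zw: "?z \<in> M" "?w \<in> M" using s u M by auto
  have "d ?z ?w = \<bar>(s - u) * d x y\<bar>" using pt_dist[OF M(1,2), of s u] s u by (simp add: abs_mult)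
  moreover have "(s - u) * d x y = d x ?z - d x ?w"
    using pt_dist_left[OF M(1,2)] s u by (simp add: left_diff_distrib)
  ultimately have "d ?z ?w = \<bar>d x ?z - d x ?w\<bar>" by simp
  moreover have "\<bar>d x ?z - d x a\<bar> \<le> R"
    using mdist_triangle[of x Y ?z a] mdist_triangle[of x Y a ?z] zw M s by (simp add: mdist_commute abs_le_iff)
  moreover have "\<bar>d x ?w - d x b\<bar> \<le> R"
    using mdist_triangle[of x Y ?w b] mdist_triangle[of x Y b ?w] zw M u by (simp add: mdist_commute abs_le_iff)
  moreover have "d a b \<le> R + d ?z ?w + R"
    using mdist_triangle[of a Y ?z b] mdist_triangle[of ?z Y ?w b] zw M s u by (simp add: mdist_commute)
  ultimately show ?thesis by linarith
qed

context product_action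
begin

text \<open>Tychonoff's theorem gives compactness in the product topology; the identity into the
  metric topology is continuous because the metric is at most the sum of the coordinate
  distances.\<close>

lemma compactin_product_of_balls:
  "compactin (mtopology_of (product_metric X)) (PiE UNIV (\<lambda>i. mcball_of (X i) (p i) R))"
proof -
  interpret P: Metric_space "mspace (product_metric X)" "mdist (product_metric X)" by simp
  let ?T = "product_topology (\<lambda>i. mtopology_of (X i)) UNIV"
  have "compactin ?T (PiE UNIV (\<lambda>i. mcball_of (X i) (p i) R))"
    using hadamard.mcball_compact[OF hadamard_factor base_in loc_compact] by (simp add: compactin_PiE)
  moreover have "continuous_map ?T P.mtopology id"
    unfolding P.continuous_map_to_metric
  proof (intro ballI allI impI)
    fix x and e :: real assume x: "x \<in> topspace ?T" and e: "0 < e"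
    then have xM: "x i \<in> mspace (X i)" for i by (auto simp: PiE_iff)
    define c where "c = e / real CARD('i)"
    have c: "0 < c" using e by (simp add: c_def)
    let ?U = "PiE UNIV (\<lambda>i. Metric_space.mball (mspace (X i)) (mdist (X i)) (x i) c)"
    have "openin (mtopology_of (X i)) (Metric_space.mball (mspace (X i)) (mdist (X i)) (x i) c)" for i
      unfolding mtopology_of_def by (intro Metric_space.openin_mball) simp
    then have "openin ?T ?U" by (subst openin_PiE_gen) auto
    moreover have "x \<in> ?U" using xM c by (auto simp: Metric_space.in_mball)
    moreover have "id y \<in> P.mball (id x) e" if y: "y \<in> ?U" for y
    proof -
      have y: "y i \<in> mspace (X i)" "mdist (X i) (x i) (y i) < c" for i
        using y by (auto simp: Metric_space.in_mball PiE_iff)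
      have "mdist (product_metric X) x y = L2_set (\<lambda>i. mdist (X i) (x i) (y i)) UNIV"
        by (simp add: mdist_product_metric L2_set_def)
      also have "\<dots> \<le> (\<Sum>i\<in>UNIV. mdist (X i) (x i) (y i))" by (rule L2_set_le_sum) simp
      also have "\<dots> < (\<Sum>i\<in>(UNIV::'i set). c)" by (rule sum_strict_mono) (use y in auto)
      also have "\<dots> = e" by (simp add: c_def)
      finally have "mdist (product_metric X) x y < e" .
      moreover have "x \<in> mspace (product_metric X)" "y \<in> mspace (product_metric X)"
        using xM y by (simp_all add: mspace_product_metric)
      ultimately show ?thesis unfolding P.in_mball id_apply by (intro conjI)
    qed
    ultimately show "\<exists>U. openin ?T U \<and> x \<in> U \<and> (\<forall>y\<in>U. id y \<in> P.mball (id x) e)" by blast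
  qed
  ultimately have "compactin P.mtopology (id ` (PiE UNIV (\<lambda>i. mcball_of (X i) (p i) R)))"
    by (rule image_compactin)
  then show ?thesis by (simp add: mtopology_of_def)
qed

lemma finite_bounded_len: "finite {\<gamma>\<in>\<Gamma>. \<forall>i. len \<gamma> i \<le> R}"
proof (cases "0 \<le> R")
  case True
  let ?K = "PiE UNIV (\<lambda>i. mcball_of (X i) (p i) R)"
  have "finite {\<gamma>\<in>\<Gamma>. act \<gamma> ` ?K \<inter> ?K \<noteq> {}}"
    using discontinuous compactin_product_of_balls unfolding properly_discontinuous_def by blast
  moreover have "{\<gamma>\<in>\<Gamma>. \<forall>i. len \<gamma> i \<le> R} \<subseteq> {\<gamma>\<in>\<Gamma>. act \<gamma> ` ?K \<inter> ?K \<noteq> {}}"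
  proof
    fix \<gamma> assume g: "\<gamma> \<in> {\<gamma>\<in>\<Gamma>. \<forall>i. len \<gamma> i \<le> R}"
    have "mdist (X i) (p i) (p i) = 0" for i using base_in[of i] by simp
    then have "p \<in> ?K" using True by (auto simp: PiE_iff)
    moreover have "act \<gamma> p \<in> ?K" using g by (auto simp: PiE_iff act_def len_def)
    ultimately show "\<gamma> \<in> {\<gamma>\<in>\<Gamma>. act \<gamma> ` ?K \<inter> ?K \<noteq> {}}" using g by blast
  qed
  ultimately show ?thesis by (rule rev_finite_subset)
next
  case False
  have "\<not> (\<forall>i. len \<gamma> i \<le> R)" for \<gamma>
    using order_trans[OF len_nonneg[of \<gamma> undefined]] False by blast
  then have "{\<gamma>\<in>\<Gamma>. \<forall>i. len \<gamma> i \<le> R} = {}" by (simp only: simp_thms empty_def)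
  then show ?thesis by (simp only: finite.emptyI)
qed

text \<open>Two elements near the same \<open>\<gamma>\<close> with lengths in a common unit box
  move \<open>p\<close> to points at distance at most \<open>1 + 4 * R\<close> in each factor.
  Multiplying by the inverse of one of them maps all into a fixed finite set.\<close>

lemma card_near_le:
  assumes B: "finite B" "B \<subseteq> \<Gamma>" and box: "\<And>b b' i. b \<in> B \<Longrightarrow> b' \<in> B \<Longrightarrow> \<bar>len b i - len b' i\<bar> \<le> 1"
    and g: "\<gamma> \<in> \<Gamma>"
  shows "card {b\<in>B. near R b \<gamma>} \<le> card {\<gamma>\<in>\<Gamma>. \<forall>i. len \<gamma> i \<le> 1 + 4 * R}"
proof (cases "{b\<in>B. near R b \<gamma>} = {}")
  case False
  then obtain b0 where b0: "b0 \<in> B" "near R b0 \<gamma>" by blast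
  have b0\<Gamma>: "b0 \<in> \<Gamma>" using b0 B by blast
  let ?f = "\<lambda>b. inv\<^bsub>G\<^esub> b0 \<otimes>\<^bsub>G\<^esub> b"
  have inj: "inj_on ?f {b\<in>B. near R b \<gamma>}"
  proof (rule inj_onI)
    fix x y assume xy: "x \<in> {b\<in>B. near R b \<gamma>}" "y \<in> {b\<in>B. near R b \<gamma>}" "?f x = ?f y"
    then have "x \<in> carrier G" "y \<in> carrier G" using B(2) \<Gamma>_carrier by blast+
    then show "x = y"
      using G.Units_l_cancel[unfolded G.Units_eq, OF \<Gamma>_carrier[OF \<Gamma>_closed(2)[OF b0\<Gamma>]]] xy(3) by blast
  qed
  have "?f ` {b\<in>B. near R b \<gamma>} \<subseteq> {\<gamma>\<in>\<Gamma>. \<forall>i. len \<gamma> i \<le> 1 + 4 * R}"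
  proof
    fix x assume "x \<in> ?f ` {b\<in>B. near R b \<gamma>}"
    then obtain b where b': "x = ?f b" "b \<in> {b\<in>B. near R b \<gamma>}" by (rule imageE)
    then have b: "x = ?f b" "b \<in> B" "near R b \<gamma>" by simp_all
    have b\<Gamma>: "b \<in> \<Gamma>" using b B by blast
    have "len x i \<le> 1 + 4 * R" for i
    proof -
      interpret had: hadamard "X i" by (rule hadamard_factor)
      have M: "\<gamma> i (p i) \<in> mspace (X i)" "b i (p i) \<in> mspace (X i)" "b0 i (p i) \<in> mspace (X i)"
        using g b\<Gamma> b0\<Gamma> by auto
      obtain s where s: "0 \<le> s" "s \<le> 1" "mdist (X i) (geo_pt (X i) (p i) (\<gamma> i (p i)) s) (b0 i (p i)) \<le> R"
        using b0(2)[unfolded near_def, THEN spec, of i] by (elim exE conjE)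
      obtain u where u: "0 \<le> u" "u \<le> 1" "mdist (X i) (geo_pt (X i) (p i) (\<gamma> i (p i)) u) (b i (p i)) \<le> R"
        using b(3)[unfolded near_def, THEN spec, of i] by (elim exE conjE)
      have "mdist (X i) (b0 i (p i)) (b i (p i)) \<le> 1 + 4 * R"
        using had.dist_le_of_near_segment[OF base_in M(1) M(3) M(2) s u] box[OF b0(1) b(2), of i]
        unfolding len_def by linarith
      moreover have "len x i = mdist (X i) (b0 i (p i)) (b i (p i))"
      proof -
        have "len x i = mdist (X i) (p i) ((inv\<^bsub>G\<^esub> b0) i (b i (p i)))"
          unfolding len_def b(1) by (subst comp_mult[OF \<Gamma>_closed(2)[OF b0\<Gamma>] b\<Gamma> base_in]) (rule refl)
        also have "\<dots> = mdist (X i) ((inv\<^bsub>G\<^esub> b0) i (b0 i (p i))) ((inv\<^bsub>G\<^esub> b0) i (b i (p i)))"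
          by (subst comp_inv(1)[OF b0\<Gamma> base_in]) (rule refl)
        finally show ?thesis using comp_dist[OF \<Gamma>_closed(2)[OF b0\<Gamma>] M(3,2)] by (rule trans)
      qed
      ultimately show ?thesis by simp
    qed
    then show "x \<in> {\<gamma>\<in>\<Gamma>. \<forall>i. len \<gamma> i \<le> 1 + 4 * R}" using b(1) \<Gamma>_closed(1)[OF \<Gamma>_closed(2)[OF b0\<Gamma>] b\<Gamma>] by blast
  qed
  then show ?thesis using card_inj_on_le[OF inj _ finite_bounded_len] by blast
next
  case True
  show ?thesis unfolding True by simp
qed

text \<open>Nearness makes the triangle inequality through the image of \<open>p i\<close> under
  \<open>\<gamma>\<^sub>1\<close> an equality up to \<open>2 * R\<close>; inserting \<open>f\<close>
  changes the contribution of \<open>\<gamma>\<^sub>2\<close> by at most \<open>Q\<close>.\<close>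

lemma len_product:
  assumes g: "\<gamma>\<^sub>1 \<in> \<Gamma>" "f \<in> \<Gamma>" "\<gamma>\<^sub>2 \<in> \<Gamma>" and near: "near R \<gamma>\<^sub>1 (\<gamma>\<^sub>1 \<otimes>\<^bsub>G\<^esub> (f \<otimes>\<^bsub>G\<^esub> \<gamma>\<^sub>2))"
    and Q: "len f i \<le> Q" "0 \<le> R"
  shows "\<bar>len (\<gamma>\<^sub>1 \<otimes>\<^bsub>G\<^esub> (f \<otimes>\<^bsub>G\<^esub> \<gamma>\<^sub>2)) i - (len \<gamma>\<^sub>1 i + len \<gamma>\<^sub>2 i)\<bar> \<le> 2 * R + Q"
proof -
  interpret had: hadamard "X i" by (rule hadamard_factor)
  let ?g = "\<gamma>\<^sub>1 \<otimes>\<^bsub>G\<^esub> (f \<otimes>\<^bsub>G\<^esub> \<gamma>\<^sub>2)"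
  let ?d = "mdist (X i)"
  define x where "x = \<gamma>\<^sub>1 i (p i)"
  define y where "y = f i (\<gamma>\<^sub>2 i (p i))"
  define z where "z = ?g i (p i)"
  have M: "x \<in> mspace (X i)" "y \<in> mspace (X i)" "f i (p i) \<in> mspace (X i)" "\<gamma>\<^sub>2 i (p i) \<in> mspace (X i)"
    using g by (auto simp: x_def y_def)
  have z: "z = \<gamma>\<^sub>1 i y"
    unfolding z_def y_def
    by (subst comp_mult[OF g(1) \<Gamma>_closed(1)[OF g(2,3)] base_in], subst comp_mult[OF g(2,3) base_in]) (rule refl)
  have zM: "z \<in> mspace (X i)" using g M by (simp add: z)
  have xz: "?d x z = ?d (p i) y" unfolding z x_def by (rule comp_dist[OF g(1) base_in M(2)])
  have fy: "?d (f i (p i)) y = len \<gamma>\<^sub>2 i" unfolding y_def len_def by (rule comp_dist[OF g(2) base_in M(4)])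
  have up: "?d (p i) y \<le> len f i + len \<gamma>\<^sub>2 i"
    using mdist_triangle[OF base_in M(3,2)] fy by (simp add: len_def)
  have low: "len \<gamma>\<^sub>2 i \<le> len f i + ?d (p i) y"
    using mdist_triangle[OF M(3) base_in M(2)] fy by (simp add: len_def mdist_commute)
  obtain s where s: "0 \<le> s" "s \<le> 1" "?d (geo_pt (X i) (p i) z s) x \<le> R"
    using near[unfolded near_def, THEN spec, of i] unfolding x_def z_def by (elim exE conjE)
  have "?d (p i) x + ?d x z - 2 * R \<le> ?d (p i) z"
    by (rule had.dist_via_near_point[OF base_in zM M(1) s])
  moreover have "?d (p i) z \<le> ?d (p i) x + ?d x z" by (rule mdist_triangle[OF base_in M(1) zM])
  ultimately have A: "len \<gamma>\<^sub>1 i + ?d (p i) y - 2 * R \<le> len ?g i" "len ?g i \<le> len \<gamma>\<^sub>1 i + ?d (p i) y"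
    unfolding xz by (simp_all only: len_def x_def z_def)
  then show ?thesis using up low Q by linarith
qed

definition disp :: "('i \<Rightarrow> 'a \<Rightarrow> 'a) \<Rightarrow> real" where
  "disp \<gamma> = mdist (product_metric X) p (act \<gamma> p)"

lemma disp_eq_norm: "disp \<gamma> = norm (\<chi> i. len \<gamma> i)"
  by (simp add: disp_def mdist_product_metric act_def len_def norm_vec_def L2_set_def)

lemma disp_nonneg [simp]: "0 \<le> disp \<gamma>"
  by (simp add: disp_eq_norm)

lemma len_le_disp: "len \<gamma> i \<le> disp \<gamma>"
  using component_le_norm_cart[of "\<chi> i. len \<gamma> i" i] by (simp add: disp_eq_norm)

lemma finite_bounded_disp: "finite {\<gamma>\<in>\<Gamma>. disp \<gamma> \<le> R}"
  by (rule finite_subset[OF _ finite_bounded_len[of R]]) (use len_le_disp order_trans in blast)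

lemma disp_le_of_len:
  assumes "\<And>i. \<bar>len \<gamma> i - v $ i\<bar> \<le> e"
  shows "disp \<gamma> \<le> norm v + real CARD('i) * e"
proof -
  have "disp \<gamma> \<le> norm v + norm ((\<chi> i. len \<gamma> i) - v)"
    using norm_triangle_ineq[of v "(\<chi> i. len \<gamma> i) - v"] by (simp add: disp_eq_norm)
  also have "norm ((\<chi> i. len \<gamma> i) - v) \<le> (\<Sum>i\<in>UNIV. \<bar>((\<chi> i. len \<gamma> i) - v) $ i\<bar>)" by (rule norm_le_l1_cart)
  also have "\<dots> \<le> (\<Sum>i\<in>(UNIV::'i set). e)" using assms by (intro sum_mono) simp
  finally show ?thesis by simp
qed

end

section \<open>Exponential growth\<close>

lemma critical_exponent_less_imp_summable:
  assumes nonneg: "\<And>g. g \<in> A \<Longrightarrow> 0 \<le> f g" and less: "critical_exponent f A < ereal s"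
  shows "(\<lambda>g. exp (- s * f g)) summable_on A"
proof -
  have "critical_exponent f A = Inf {ereal t | t. (\<lambda>g. exp (- t * f g)) summable_on A}"
    by (rule critical_exponent_eq_Inf) (rule nonneg)
  then have "Inf {ereal t | t. (\<lambda>g. exp (- t * f g)) summable_on A} < ereal s" using less by (simp only:)
  then obtain t where t: "(\<lambda>g. exp (- t * f g)) summable_on A" "ereal t < ereal s"
    unfolding Inf_less_iff by blast
  show ?thesis
    by (rule summable_on_comparison_test[OF t(1)])
       (use nonneg t(2) in \<open>auto intro!: mult_right_mono\<close>)
qed

lemma critical_exponent_le_of_summable:
  assumes nonneg: "\<And>g. g \<in> A \<Longrightarrow> 0 \<le> f g" and s: "(\<lambda>g. exp (- s * f g)) summable_on A"
  shows "critical_exponent f A \<le> ereal s"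
proof -
  have "critical_exponent f A = Inf {ereal t | t. (\<lambda>g. exp (- t * f g)) summable_on A}"
    by (rule critical_exponent_eq_Inf) (rule nonneg)
  also have "\<dots> \<le> ereal s" by (rule Inf_lower) (use s in blast)
  finally show ?thesis .
qed

lemma critical_exponent_ge_of_not_summable:
  assumes nonneg: "\<And>g. g \<in> A \<Longrightarrow> 0 \<le> f g" and s: "\<not> (\<lambda>g. exp (- s * f g)) summable_on A"
  shows "ereal s \<le> critical_exponent f A"
proof (rule ccontr)
  assume "\<not> ?thesis"
  then have "critical_exponent f A < ereal s" by simp
  from critical_exponent_less_imp_summable[OF nonneg this] s show False by blast
qed

text \<open>For every \<open>k\<close> some finite partial sum is at least
  \<open>exp (k * (\<beta> - s * L))\<close>, which is unbounded.\<close>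

lemma not_summable_of_growth:
  fixes f :: "'g \<Rightarrow> real"
  assumes s: "0 \<le> s" "s * L < \<beta>"
    and growth: "\<And>k::nat. \<exists>S. finite S \<and> S \<subseteq> A \<and> (\<forall>g\<in>S. f g \<le> real k * L) \<and> exp (real k * \<beta>) \<le> real (card S)"
  shows "\<not> (\<lambda>g. exp (- s * f g)) summable_on A"
proof
  assume sum: "(\<lambda>g. exp (- s * f g)) summable_on A"
  let ?I = "infsum (\<lambda>g. exp (- s * f g)) A"
  have bound: "exp (real k * (\<beta> - s * L)) \<le> ?I" for k :: nat
  proof -
    obtain S where S: "finite S" "S \<subseteq> A" "\<forall>g\<in>S. f g \<le> real k * L" "exp (real k * \<beta>) \<le> real (card S)"
      using growth[of k] by (elim exE conjE)
    have "exp (real k * (\<beta> - s * L)) = exp (real k * \<beta>) * exp (- s * (real k * L))"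
      by (simp add: algebra_simps flip: exp_add)
    also have "\<dots> \<le> real (card S) * exp (- s * (real k * L))" using S(4) by (intro mult_right_mono) auto
    also have "\<dots> = (\<Sum>g\<in>S. exp (- s * (real k * L)))" by simp
    also have "\<dots> \<le> (\<Sum>g\<in>S. exp (- s * f g))"
      using S(3) s(1) by (intro sum_mono) (auto intro!: mult_left_mono)
    also have "\<dots> \<le> ?I" by (rule finite_sum_le_infsum[OF sum S(1,2)]) simp
    finally show ?thesis .
  qed
  obtain n :: nat where "?I < real n * (\<beta> - s * L)"
    using reals_Archimedean3[of "\<beta> - s * L"] s(2) by auto
  also have "\<dots> \<le> exp (real n * (\<beta> - s * L))" using exp_ge_add_one_self[of "real n * (\<beta> - s * L)"] by linarith
  also have "\<dots> \<le> ?I" by (rule bound)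
  finally show False by simp
qed

text \<open>If all late shells had fewer than \<open>exp (t * k)\<close> elements, the series at
  \<open>s\<close> would be dominated by a geometric one. This gives arbitrarily large
  \<open>k\<close>, but no control over which.\<close>

lemma large_shell_exists:
  fixes f :: "'g \<Rightarrow> real"
  assumes nonneg: "\<And>g. g \<in> A \<Longrightarrow> 0 \<le> f g" and fin: "\<And>r. finite {g\<in>A. f g \<le> r}"
    and st: "0 \<le> t" "t < s" and div: "\<not> (\<lambda>g. exp (- s * f g)) summable_on A"
  shows "\<exists>k\<ge>K. exp (t * real k) \<le> real (card {g\<in>A. nat \<lfloor>f g\<rfloor> = k})"
proof (rule ccontr)
  assume "\<not> ?thesis"
  then have small: "real (card {g\<in>A. nat \<lfloor>f g\<rfloor> = k}) \<le> exp (t * real k)" if "k \<ge> K" for k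
    using that by force
  define N where "N k = real (card {g\<in>A. nat \<lfloor>f g\<rfloor> = k})" for k
  define r where "r = exp (t - s)"
  have r: "0 < r" "r < 1" using st by (auto simp: r_def)
  define C where "C = (\<Sum>k<K. N k) + 1 / (1 - r)"
  have fin_shell: "finite {g\<in>A. nat \<lfloor>f g\<rfloor> = k}" for k
    by (rule finite_subset[OF _ fin[of "real k + 1"]]) (use floor_le_iff in \<open>auto; linarith\<close>)
  have fl: "real (nat \<lfloor>f g\<rfloor>) \<le> f g" if "g \<in> A" for g using nonneg[OF that] by simp
  have "sum (\<lambda>g. exp (- s * f g)) H \<le> C" if H: "H \<subseteq> A" "finite H" for H
  proof -
    define J where "J = Max (insert 0 ((\<lambda>g. nat \<lfloor>f g\<rfloor>) ` H))"
    have J: "nat \<lfloor>f g\<rfloor> \<in> {..J}" if "g \<in> H" for g using that H by (auto simp: J_def intro: Max_ge)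
    have "sum (\<lambda>g. exp (- s * f g)) H = (\<Sum>k\<le>J. sum (\<lambda>g. exp (- s * f g)) {g\<in>H. nat \<lfloor>f g\<rfloor> = k})"
      using J by (intro sum.group[symmetric] H(2)) auto
    also have "\<dots> \<le> (\<Sum>k\<le>J. N k * exp (- s * real k))"
    proof (rule sum_mono)
      fix k
      have "sum (\<lambda>g. exp (- s * f g)) {g\<in>H. nat \<lfloor>f g\<rfloor> = k} \<le> (\<Sum>g\<in>{g\<in>H. nat \<lfloor>f g\<rfloor> = k}. exp (- s * real k))"
        using st fl H by (intro sum_mono) (auto intro!: mult_left_mono)
      also have "\<dots> = real (card {g\<in>H. nat \<lfloor>f g\<rfloor> = k}) * exp (- s * real k)" by simp
      also have "\<dots> \<le> N k * exp (- s * real k)"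
        unfolding N_def using fin_shell[of k] H by (intro mult_right_mono) (auto intro!: card_mono)
      finally show "sum (\<lambda>g. exp (- s * f g)) {g\<in>H. nat \<lfloor>f g\<rfloor> = k} \<le> N k * exp (- s * real k)" .
    qed
    \<comment> \<open>The early shells are bounded by their cardinalities, using
      \<open>0 \<le> s\<close>; the late ones by a geometric series with ratio
      \<open>exp (t - s)\<close>.\<close>
    also have "\<dots> \<le> (\<Sum>k\<le>J. (if k < K then N k else 0) + r ^ k)"
    proof (rule sum_mono)
      fix k
      show "N k * exp (- s * real k) \<le> (if k < K then N k else 0) + r ^ k"
      proof (cases "k < K")
        case True
        have "N k * exp (- s * real k) \<le> N k * 1" using st by (intro mult_left_mono) (auto simp: N_def)
        then show ?thesis using True r by (simp add: add_increasing2)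
      next
        case False
        have "N k * exp (- s * real k) \<le> exp (t * real k) * exp (- s * real k)"
          using small[of k] False by (intro mult_right_mono) (auto simp: N_def)
        also have "\<dots> = r ^ k" by (simp add: r_def algebra_simps flip: exp_add exp_of_nat_mult)
        finally show ?thesis using False by simp
      qed
    qed
    also have "\<dots> = (\<Sum>k\<le>J. if k < K then N k else 0) + (\<Sum>k\<le>J. r ^ k)" by (simp add: sum.distrib)
    also have "\<dots> \<le> C"
      unfolding C_def
    proof (rule add_mono)
      have "(\<Sum>k\<le>J. if k < K then N k else 0) = (\<Sum>k\<in>{..J} \<inter> {..<K}. N k)"
        by (simp add: sum.inter_restrict)
      also have "\<dots> \<le> (\<Sum>k<K. N k)" by (intro sum_mono2) (auto simp: N_def)
      finally show "(\<Sum>k\<le>J. if k < K then N k else 0) \<le> (\<Sum>k<K. N k)" .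
      have "(\<Sum>k\<le>J. r ^ k) = (1 - r ^ Suc J) / (1 - r)"
        using sum_gp0[of r J] r by simp
      also have "\<dots> \<le> 1 / (1 - r)" using r by (intro divide_right_mono) auto
      finally show "(\<Sum>k\<le>J. r ^ k) \<le> 1 / (1 - r)" .
    qed
    finally show ?thesis .
  qed
  then have "bdd_above (sum (\<lambda>g. exp (- s * f g)) ` {F. F \<subseteq> A \<and> finite F})"
    by (intro bdd_aboveI2[of _ _ C]) auto
  then show False using div nonneg_bdd_above_summable_on[of A "\<lambda>g. exp (- s * f g)"] by simp
qed

lemma large_fibre_exists:
  assumes S: "finite S" and Y: "finite Y" "h ` S \<subseteq> Y" and c: "0 < c" "c \<le> real (card S)"
  shows "\<exists>y. c \<le> real (card {x\<in>S. h x = y}) * real (card Y)"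
proof (rule ccontr)
  assume "\<not> ?thesis"
  then have lt: "real (card {x\<in>S. h x = y}) * real (card Y) < c" for y by (simp add: not_le)
  have "S \<noteq> {}" using c by auto
  then have "Y \<noteq> {}" using Y by auto
  then have Y0: "0 < card Y" using Y(1) by (simp add: card_gt_0_iff)
  have "real (card S) = (\<Sum>y\<in>Y. real (card {x\<in>S. h x = y}))"
    using sum.group[OF S Y, of "\<lambda>_. 1::real"] by simp
  also have "\<dots> < (\<Sum>y\<in>Y. c / real (card Y))"
    using lt Y0 \<open>Y \<noteq> {}\<close> Y(1) by (intro sum_strict_mono) (auto simp: field_simps)
  also have "\<dots> = c" using Y0 by simp
  finally show False using c by simp
qed

text \<open>All that the counting retains of the geometry: one finite set for insertions, and
  arbitrarily large sets of multiplicity one for the same \<open>R\<close>.\<close>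

locale extension_data = product_action X \<Gamma> p
  for X :: "'i::finite \<Rightarrow> 'a metric" and \<Gamma> p +
  fixes A R
  assumes A: "finite A" "A \<subseteq> \<Gamma>" and R: "0 \<le> R"
    and ext: "\<lbrakk>\<gamma>\<^sub>1 \<in> \<Gamma>; \<gamma>\<^sub>2 \<in> \<Gamma>\<rbrakk> \<Longrightarrow> \<exists>f\<in>A. near R \<gamma>\<^sub>1 (\<gamma>\<^sub>1 \<otimes>\<^bsub>G\<^esub> (f \<otimes>\<^bsub>G\<^esub> \<gamma>\<^sub>2))"
    and separated: "\<exists>B. finite B \<and> card B = n \<and> B \<subseteq> \<Gamma> \<and> (\<forall>\<gamma>\<in>\<Gamma>. card {b\<in>B. near R b \<gamma>} \<le> 1)"
begin

text \<open>The bound of \<open>len_product\<close>, with the sum over \<open>A\<close> as a common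
  bound for the lengths of all inserted elements.\<close>

definition err :: real where "err = 2 * R + (\<Sum>f\<in>A. disp f)"

lemma err_nonneg: "0 \<le> err"
  unfolding err_def using R by (intro add_nonneg_nonneg sum_nonneg) auto

lemma A_nonempty: "0 < card A"
  using ext[OF \<Gamma>_closed(3) \<Gamma>_closed(3)] A(1) by (auto simp: card_gt_0_iff)

text \<open>Given the product, \<open>b\<close> is one of at most \<open>m\<close> elements near it
  and \<open>f\<close> one of \<open>card A\<close>; these two determine the last factor by
  cancellation. So the product map has fibres of at most \<open>m * card A\<close> elements.\<close>

lemma product_set_exists:
  assumes B: "finite B" "B \<subseteq> \<Gamma>" "\<forall>\<gamma>\<in>\<Gamma>. card {b\<in>B. near R b \<gamma>} \<le> m"
    and S: "finite S" "S \<subseteq> \<Gamma>"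
  shows "\<exists>S'. finite S' \<and> S' \<subseteq> \<Gamma> \<and> card B * card S \<le> m * card A * card S' \<and>
    (\<forall>\<gamma>'\<in>S'. \<exists>b\<in>B. \<exists>\<gamma>\<in>S. \<forall>i. \<bar>len \<gamma>' i - (len b i + len \<gamma> i)\<bar> \<le> err)"
proof -
  have "\<forall>z\<in>B \<times> S. \<exists>f\<in>A. near R (fst z) (fst z \<otimes>\<^bsub>G\<^esub> (f \<otimes>\<^bsub>G\<^esub> snd z))"
  proof
    fix z assume "z \<in> B \<times> S"
    then have "fst z \<in> \<Gamma>" "snd z \<in> \<Gamma>" using B(2) S(2) by auto
    then show "\<exists>f\<in>A. near R (fst z) (fst z \<otimes>\<^bsub>G\<^esub> (f \<otimes>\<^bsub>G\<^esub> snd z))" by (rule ext)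
  qed
  then have "\<forall>z\<in>B \<times> S. \<exists>f. f \<in> A \<and> near R (fst z) (fst z \<otimes>\<^bsub>G\<^esub> (f \<otimes>\<^bsub>G\<^esub> snd z))"
    unfolding Bex_def .
  from bchoice[OF this] obtain f where f_all: "\<forall>z\<in>B \<times> S. f z \<in> A \<and> near R (fst z) (fst z \<otimes>\<^bsub>G\<^esub> (f z \<otimes>\<^bsub>G\<^esub> snd z))" ..
  have f: "f z \<in> A" "near R (fst z) (fst z \<otimes>\<^bsub>G\<^esub> (f z \<otimes>\<^bsub>G\<^esub> snd z))" if "z \<in> B \<times> S" for z
    using f_all[rule_format, OF that] by (rule conjunct1, rule conjunct2)
  define P where "P z = fst z \<otimes>\<^bsub>G\<^esub> (f z \<otimes>\<^bsub>G\<^esub> snd z)" for z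
  have in_\<Gamma>: "fst z \<in> \<Gamma>" "snd z \<in> \<Gamma>" "f z \<in> \<Gamma>" if "z \<in> B \<times> S" for z
    using that B(2) S(2) f(1)[OF that] A(2) by auto
  have P\<Gamma>: "P z \<in> \<Gamma>" if "z \<in> B \<times> S" for z
    unfolding P_def using in_\<Gamma>[OF that] by (intro \<Gamma>_closed)
  let ?S' = "P ` (B \<times> S)"
  have fin: "finite (B \<times> S)" using B S by simp
  have fibre: "card {z\<in>B \<times> S. P z = \<gamma>} \<le> m * card A" if g: "\<gamma> \<in> ?S'" for \<gamma>
  proof -
    have g\<Gamma>: "\<gamma> \<in> \<Gamma>" using g P\<Gamma> by blast
    let ?F = "{z\<in>B \<times> S. P z = \<gamma>}"
    have inj: "inj_on (\<lambda>z. (fst z, f z)) ?F"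
    proof (rule inj_onI)
      fix z w assume zw: "z \<in> ?F" "w \<in> ?F" "(fst z, f z) = (fst w, f w)"
      have z: "z \<in> B \<times> S" "w \<in> B \<times> S" "P z = P w" "fst z = fst w" "f z = f w" using zw by auto
      have c: "fst w \<in> carrier G" "f w \<in> carrier G" "snd z \<in> carrier G" "snd w \<in> carrier G"
        using in_\<Gamma>[OF z(1)] in_\<Gamma>[OF z(2)] \<Gamma>_carrier by blast+
      have "fst w \<otimes>\<^bsub>G\<^esub> (f w \<otimes>\<^bsub>G\<^esub> snd z) = fst w \<otimes>\<^bsub>G\<^esub> (f w \<otimes>\<^bsub>G\<^esub> snd w)"
        using z(3) unfolding P_def z(4,5) .
      then have "f w \<otimes>\<^bsub>G\<^esub> snd z = f w \<otimes>\<^bsub>G\<^esub> snd w"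
        by (rule G.Units_l_cancel[unfolded G.Units_eq, OF c(1) G.m_closed[OF c(2,3)] G.m_closed[OF c(2,4)], THEN iffD1])
      then have "snd z = snd w"
        by (rule G.Units_l_cancel[unfolded G.Units_eq, OF c(2,3,4), THEN iffD1])
      then show "z = w" using z(4) by (rule prod_eqI[rotated])
    qed
    have "(\<lambda>z. (fst z, f z)) ` ?F \<subseteq> {b\<in>B. near R b \<gamma>} \<times> A"
      using f by (auto simp: P_def)
    then have "card ?F \<le> card ({b\<in>B. near R b \<gamma>} \<times> A)"
      by (rule card_inj_on_le[OF inj]) (use B(1) A(1) in simp)
    also have "\<dots> \<le> m * card A" using B(3)[rule_format, OF g\<Gamma>] by (simp add: card_cartesian_product)
    finally show ?thesis .
  qed
  have "card B * card S = card (B \<times> S)" by (simp add: card_cartesian_product)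
  also have "\<dots> = (\<Sum>\<gamma>\<in>?S'. card {z\<in>B \<times> S. P z = \<gamma>})"
    using sum.group[where g = P and h = "\<lambda>_. 1::nat", OF fin finite_imageI[OF fin] order_refl] by simp
  also have "\<dots> \<le> (\<Sum>\<gamma>\<in>?S'. m * card A)" by (intro sum_mono fibre)
  finally have count: "card B * card S \<le> m * card A * card ?S'" by (simp add: mult.commute)
  have "\<exists>b\<in>B. \<exists>\<gamma>\<in>S. \<forall>i. \<bar>len \<gamma>' i - (len b i + len \<gamma> i)\<bar> \<le> err" if g': "\<gamma>' \<in> ?S'" for \<gamma>'
  proof -
    obtain z where z: "\<gamma>' = P z" "z \<in> B \<times> S" using g' by (rule imageE)
    have "\<bar>len \<gamma>' i - (len (fst z) i + len (snd z) i)\<bar> \<le> err" for i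
    proof -
      have "len (f z) i \<le> (\<Sum>f\<in>A. disp f)"
        using len_le_disp[of "f z" i] member_le_sum[OF f(1)[OF z(2)], of disp] A(1) by simp
      then show ?thesis
        unfolding z(1) P_def err_def
        by (rule len_product[OF in_\<Gamma>(1)[OF z(2)] in_\<Gamma>(3)[OF z(2)] in_\<Gamma>(2)[OF z(2)] f(2)[OF z(2)] _ R])
    qed
    then show ?thesis using z(2) by (auto simp: mem_Times_iff)
  qed
  then show ?thesis using count fin P\<Gamma> by (intro exI[of _ ?S']) auto
qed

text \<open>New factors are put in front, so the multiplicity bound concerns \<open>B\<close> only;
  \<open>S\<close> may itself consist of products in another direction.\<close>

lemma iterated_product_set_exists:
  assumes B: "finite B" "B \<subseteq> \<Gamma>" "\<forall>\<gamma>\<in>\<Gamma>. card {b\<in>B. near R b \<gamma>} \<le> m"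
    and v: "\<forall>b\<in>B. \<forall>i. \<bar>len b i - v i\<bar> \<le> e"
    and S: "finite S" "S \<subseteq> \<Gamma>"
  shows "\<exists>S'. finite S' \<and> S' \<subseteq> \<Gamma> \<and> card B ^ k * card S \<le> (m * card A) ^ k * card S' \<and>
    (\<forall>\<gamma>'\<in>S'. \<exists>\<gamma>\<in>S. \<forall>i. \<bar>len \<gamma>' i - (len \<gamma> i + real k * v i)\<bar> \<le> real k * (err + e))"
proof (induction k)
  case 0
  then show ?case using S by (intro exI[of _ S]) auto
next
  case (Suc k)
  then obtain S1 where S1: "finite S1" "S1 \<subseteq> \<Gamma>" "card B ^ k * card S \<le> (m * card A) ^ k * card S1"
      "\<forall>\<gamma>'\<in>S1. \<exists>\<gamma>\<in>S. \<forall>i. \<bar>len \<gamma>' i - (len \<gamma> i + real k * v i)\<bar> \<le> real k * (err + e)"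
    by (elim exE conjE)
  obtain S2 where S2: "finite S2" "S2 \<subseteq> \<Gamma>" "card B * card S1 \<le> m * card A * card S2"
      "\<forall>\<gamma>'\<in>S2. \<exists>b\<in>B. \<exists>\<gamma>\<in>S1. \<forall>i. \<bar>len \<gamma>' i - (len b i + len \<gamma> i)\<bar> \<le> err"
    using product_set_exists[OF B S1(1,2)] by (elim exE conjE)
  have "card B ^ Suc k * card S = card B * (card B ^ k * card S)" by simp
  also have "\<dots> \<le> card B * ((m * card A) ^ k * card S1)" using S1(3) by (rule mult_le_mono2)
  also have "\<dots> = (m * card A) ^ k * (card B * card S1)" by simp
  also have "\<dots> \<le> (m * card A) ^ k * (m * card A * card S2)" using S2(3) by (rule mult_le_mono2)
  finally have "card B ^ Suc k * card S \<le> (m * card A) ^ Suc k * card S2" by (simp add: algebra_simps)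
  moreover have "\<exists>\<gamma>\<in>S. \<forall>i. \<bar>len \<gamma>' i - (len \<gamma> i + real (Suc k) * v i)\<bar> \<le> real (Suc k) * (err + e)"
    if g: "\<gamma>' \<in> S2" for \<gamma>'
  proof -
    obtain b \<gamma>1 where b: "b \<in> B" "\<gamma>1 \<in> S1" "\<forall>i. \<bar>len \<gamma>' i - (len b i + len \<gamma>1 i)\<bar> \<le> err"
      using S2(4)[rule_format, OF g] by (elim bexE)
    obtain \<gamma> where \<gamma>: "\<gamma> \<in> S" "\<forall>i. \<bar>len \<gamma>1 i - (len \<gamma> i + real k * v i)\<bar> \<le> real k * (err + e)"
      using S1(4)[rule_format, OF b(2)] by (elim bexE)
    have "\<bar>len \<gamma>' i - (len \<gamma> i + real (Suc k) * v i)\<bar> \<le> real (Suc k) * (err + e)" for i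
      using b(3)[rule_format, of i] \<gamma>(2)[rule_format, of i] v[rule_format, OF b(1), of i]
      unfolding of_nat_Suc distrib_right mult_1_left by linarith
    then show ?thesis using \<gamma>(1) by blast
  qed
  ultimately show ?case using S2(1,2) by (intro exI[of _ S2]) simp
qed

lemma delta_eq: "delta X \<Gamma> p = critical_exponent disp \<Gamma>"
  by (simp add: delta_def disp_def[abs_def])

text \<open>A set with \<open>card A + 1\<close> elements of multiplicity one beats the loss
  \<open>card A\<close> of each product: the \<open>k\<close>-fold products number at least the
  \<open>k\<close>-th power of \<open>(card A + 1) / card A\<close>, with displacement linear in
  \<open>k\<close>.\<close>

theorem delta_positive: "0 < delta X \<Gamma> p"
proof -
  obtain B where B: "finite B" "card B = Suc (card A)" "B \<subseteq> \<Gamma>" "\<forall>\<gamma>\<in>\<Gamma>. card {b\<in>B. near R b \<gamma>} \<le> 1"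
    using separated[of "Suc (card A)"] by (elim exE conjE)
  have S: "finite {\<one>\<^bsub>G\<^esub>}" "{\<one>\<^bsub>G\<^esub>} \<subseteq> \<Gamma>" using \<Gamma>_closed(3) by simp_all
  \<comment> \<open>Lengths are compared with the vector 0, so the error \<open>e\<close> absorbs
    them entirely; only linear growth matters here.\<close>
  define e where "e = (\<Sum>b\<in>B. disp b)"
  have "\<bar>len b i - 0\<bar> \<le> e" if "b \<in> B" for b i
    using len_le_disp[of b i] member_le_sum[OF that, of disp] B(1) by (simp add: e_def)
  then have e: "\<forall>b\<in>B. \<forall>i. \<bar>len b i - 0\<bar> \<le> e" by blast
  have e0: "0 \<le> e" unfolding e_def by (intro sum_nonneg) simp
  have one: "len \<one>\<^bsub>G\<^esub> i = 0" for i
    using isometry_group_one_apply[OF base_in[of i]] by (simp add: len_def)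
  define L where "L = real CARD('i) * (err + e) + 1"
  have L: "0 < L" using e0 err_nonneg by (simp add: L_def add_nonneg_pos)
  define \<beta> where "\<beta> = ln (real (Suc (card A)) / real (card A))"
  have \<beta>: "0 < \<beta>" unfolding \<beta>_def using A_nonempty by (intro ln_gt_zero) simp
  have "\<not> (\<lambda>g. exp (- (\<beta> / (2 * L)) * disp g)) summable_on \<Gamma>"
  proof (rule not_summable_of_growth[where L = L and \<beta> = \<beta>])
    show "0 \<le> \<beta> / (2 * L)" "\<beta> / (2 * L) * L < \<beta>" using \<beta> L by (auto simp: field_simps)
    fix k :: nat
    obtain S' where S': "finite S'" "S' \<subseteq> \<Gamma>" "card B ^ k * card {\<one>\<^bsub>G\<^esub>} \<le> (1 * card A) ^ k * card S'"
      "\<forall>\<gamma>'\<in>S'. \<exists>\<gamma>\<in>{\<one>\<^bsub>G\<^esub>}. \<forall>i. \<bar>len \<gamma>' i - (len \<gamma> i + real k * 0)\<bar> \<le> real k * (err + e)"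
      using iterated_product_set_exists[OF B(1,3,4) e S, of k] by (elim exE conjE)
    have "disp \<gamma> \<le> real k * L" if g: "\<gamma> \<in> S'" for \<gamma>
    proof -
      have "\<bar>len \<gamma> i - 0 $ i\<bar> \<le> real k * (err + e)" for i using S'(4)[rule_format, OF g] one by simp
      then have "disp \<gamma> \<le> norm (0 :: real^'i) + real CARD('i) * (real k * (err + e))" by (rule disp_le_of_len)
      also have "\<dots> \<le> real k * L" by (simp add: L_def algebra_simps)
      finally show ?thesis .
    qed
    moreover have "exp (real k * \<beta>) \<le> real (card S')"
    proof -
      have "exp (real k * \<beta>) = (real (Suc (card A)) / real (card A)) ^ k"
        unfolding \<beta>_def exp_of_nat_mult using A_nonempty by (subst exp_ln) auto
      also have "\<dots> = real (card B ^ k) / real (card A ^ k)" by (simp add: B(2) power_divide)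
      also have "\<dots> \<le> real (card S')"
      proof -
        have "real (card B ^ k) \<le> real (card A ^ k * card S')" using S'(3) by (intro of_nat_mono) simp
        then show ?thesis using A_nonempty by (subst pos_divide_le_eq) (auto simp: mult.commute)
      qed
      finally show ?thesis .
    qed
    ultimately show "\<exists>S. finite S \<and> S \<subseteq> \<Gamma> \<and> (\<forall>g\<in>S. disp g \<le> real k * L) \<and> exp (real k * \<beta>) \<le> real (card S)"
      using S'(1,2) by (intro exI[of _ S']) blast
  qed
  then have "ereal (\<beta> / (2 * L)) \<le> delta X \<Gamma> p"
    unfolding delta_eq by (rule critical_exponent_ge_of_not_summable[rotated]) simp
  moreover have "0 < ereal (\<beta> / (2 * L))" using \<beta> L by simp
  ultimately show ?thesis by (rule less_le_trans[rotated])
qed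

end

section \<open>Exponents of directions\<close>

lemma eventually_power_le_exp:
  fixes c \<epsilon> :: real
  assumes "0 < c" "0 < \<epsilon>"
  shows "\<forall>\<^sub>F k in sequentially. (real k + 2) ^ r * c \<le> exp (\<epsilon> * real k)"
proof -
  define g where "g k = \<epsilon> * (real k + 2)" for k :: nat
  define b where "b = \<epsilon> ^ r / (c * exp (2 * \<epsilon>))"
  have b: "0 < b" using assms by (simp add: b_def)
  have "filterlim (\<lambda>k. real k + 2) at_top sequentially"
    by (rule filterlim_at_top_mono[OF filterlim_real_sequentially]) simp
  then have "filterlim g at_top sequentially"
    unfolding g_def by (rule filterlim_tendsto_pos_mult_at_top[OF tendsto_const assms(2)])
  then have "((\<lambda>k. g k ^ r / exp (g k)) \<longlongrightarrow> 0) sequentially"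
    by (rule filterlim_compose[OF tendsto_power_div_exp_0])
  then have "\<forall>\<^sub>F k in sequentially. g k ^ r / exp (g k) < b" using b by (rule order_tendstoD(2))
  then show ?thesis
  proof eventually_elim
    case (elim k)
    then have "g k ^ r \<le> b * exp (g k)" by (simp add: pos_divide_less_eq)
    also have "exp (g k) = exp (\<epsilon> * real k) * exp (2 * \<epsilon>)" by (simp add: g_def algebra_simps flip: exp_add)
    also have "b * \<dots> = \<epsilon> ^ r * (exp (\<epsilon> * real k) / c)" using assms by (simp add: b_def)
    finally have "\<epsilon> ^ r * (real k + 2) ^ r \<le> \<epsilon> ^ r * (exp (\<epsilon> * real k) / c)"
      by (simp add: g_def power_mult_distrib)
    then have "(real k + 2) ^ r \<le> exp (\<epsilon> * real k) / c" using assms by (simp del: times_divide_eq_right)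
    then show ?case using assms by (simp add: pos_le_divide_eq)
  qed
qed

lemma power_quotient_le:
  fixes x M b c c' :: real
  assumes "x * M \<le> b" "0 \<le> x" "0 < M" "0 \<le> c" "b ^ k * c \<le> M ^ k * c'"
  shows "x ^ k * c \<le> c'"
proof -
  have "M ^ k * (x ^ k * c) = (x * M) ^ k * c" by (simp add: power_mult_distrib)
  also have "\<dots> \<le> b ^ k * c" using assms by (intro mult_right_mono power_mono) auto
  also have "\<dots> \<le> M ^ k * c'" by (rule assms)
  finally show ?thesis using assms(3) by simp
qed

context extension_data
begin

lemma delta_dir_eps_eq:
  "delta_dir_eps X \<Gamma> p \<theta> \<epsilon> = critical_exponent disp (elements_in_direction X \<Gamma> p \<theta> \<epsilon>)"
  by (simp add: delta_dir_eps_def disp_def[abs_def])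

lemma elements_in_direction_subset: "elements_in_direction X \<Gamma> p \<theta> \<epsilon> \<subseteq> \<Gamma>"
  by (auto simp: elements_in_direction_def)

lemma delta_dir_le_eps: "0 < \<epsilon> \<Longrightarrow> delta_dir X \<Gamma> p \<theta> \<le> delta_dir_eps X \<Gamma> p \<theta> \<epsilon>"
  unfolding delta_dir_eq_INF by (rule INF_lower) simp

lemma delta_dir_le_delta: "delta_dir X \<Gamma> p \<theta> \<le> delta X \<Gamma> p"
proof -
  have "delta_dir_eps X \<Gamma> p \<theta> 1 \<le> delta X \<Gamma> p"
  proof (rule ccontr)
    assume "\<not> ?thesis"
    then have "delta X \<Gamma> p < delta_dir_eps X \<Gamma> p \<theta> 1" by simp
    then obtain s where s: "delta X \<Gamma> p < ereal s" "ereal s < delta_dir_eps X \<Gamma> p \<theta> 1"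
      using ereal_dense2 by blast
    have "(\<lambda>g. exp (- s * disp g)) summable_on \<Gamma>"
      using critical_exponent_less_imp_summable[of \<Gamma> disp s] s(1) unfolding delta_eq by simp
    then have "(\<lambda>g. exp (- s * disp g)) summable_on elements_in_direction X \<Gamma> p \<theta> 1"
      by (rule summable_on_subset_banach) (rule elements_in_direction_subset)
    then have "delta_dir_eps X \<Gamma> p \<theta> 1 \<le> ereal s"
      unfolding delta_dir_eps_eq by (rule critical_exponent_le_of_summable[rotated]) simp
    then show False using s(2) by simp
  qed
  then show ?thesis using delta_dir_le_eps[of 1 \<theta>] by (simp add: order_trans)
qed

lemma len_eq_disp_direction: "len \<gamma> i = disp \<gamma> * direction X p (act \<gamma> p) $ i"
proof (cases "disp \<gamma> = 0")
  case True
  then show ?thesis using len_le_disp[of \<gamma> i] len_nonneg[of \<gamma> i] by simp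
next
  case False
  have "direction X p (act \<gamma> p) $ i = (1 / disp \<gamma>) * len \<gamma> i"
    by (simp add: direction_def disp_def len_def act_def)
  then show ?thesis using False by simp
qed

lemma direction_in_directions:
  assumes "\<gamma> \<in> \<Gamma>" "act \<gamma> p \<noteq> p"
  shows "direction X p (act \<gamma> p) \<in> directions"
proof -
  have "act \<gamma> p \<in> mspace (product_metric X)"
    using assms(1) by (auto simp: mspace_product_metric act_def)
  then have pos: "disp \<gamma> \<noteq> 0" using assms(2) base by (simp add: disp_def)
  then have d0: "0 < disp \<gamma>" using disp_nonneg[of \<gamma>] by linarith
  have "direction X p (act \<gamma> p) = (1 / disp \<gamma>) *\<^sub>R (\<chi> i. len \<gamma> i)"
    by (simp add: direction_def disp_def len_def[abs_def] act_def)
  then show ?thesis using d0 by (simp add: directions_def flip: disp_eq_norm)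
qed

text \<open>If each direction had a cone of exponent below that of the group, finitely many of these
  cones would cover \<open>directions\<close>, and the full series would converge at some exponent
  below its critical one.\<close>

theorem maximal_direction_exists: "\<exists>\<theta>\<in>directions. delta_dir X \<Gamma> p \<theta> = delta X \<Gamma> p"
proof (rule ccontr)
  assume "\<not> ?thesis"
  then have less: "delta_dir X \<Gamma> p \<theta> < delta X \<Gamma> p" if "\<theta> \<in> directions" for \<theta>
    using that delta_dir_le_delta[of \<theta>] by (simp add: order_less_le)
  have "\<forall>\<theta>\<in>directions. \<exists>\<epsilon>. 0 < \<epsilon> \<and> delta_dir_eps X \<Gamma> p \<theta> \<epsilon> < delta X \<Gamma> p"
    using less unfolding delta_dir_eq_INF INF_less_iff by auto
  from bchoice[OF this] obtain \<epsilon> where eps: "\<forall>\<theta>\<in>directions. 0 < \<epsilon> \<theta> \<and> delta_dir_eps X \<Gamma> p \<theta> (\<epsilon> \<theta>) < delta X \<Gamma> p" ..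
  have "directions = (\<Inter>i. {\<theta>::real^'i. 0 \<le> \<theta> $ i}) \<inter> sphere 0 1"
    by (auto simp: directions_def)
  moreover have "closed {\<theta>::real^'i. 0 \<le> \<theta> $ i}" for i
    by (intro closed_Collect_le continuous_intros)
  ultimately have "compact (directions :: (real^'i) set)"
    by (metis closed_INT closed_Int_compact compact_sphere)
  moreover have "directions \<subseteq> (\<Union>\<theta>\<in>directions. ball \<theta> (\<epsilon> \<theta>))" using eps by auto
  ultimately obtain T where T: "T \<subseteq> directions" "finite T" "directions \<subseteq> (\<Union>\<theta>\<in>T. ball \<theta> (\<epsilon> \<theta>))"
    using compactE_image[of directions directions "\<lambda>\<theta>. ball \<theta> (\<epsilon> \<theta>)"] by (metis open_ball)
  \<comment> \<open>The inserted 0 keeps the maximum defined if \<open>T\<close> is empty; it is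
    below the exponent of the group by \<open>delta_positive\<close>.\<close>
  define m where "m = Max (insert 0 ((\<lambda>\<theta>. delta_dir_eps X \<Gamma> p \<theta> (\<epsilon> \<theta>)) ` T))"
  have m_less: "m < delta X \<Gamma> p"
    unfolding m_def using T(1,2) eps delta_positive by (subst Max_less_iff) auto
  then obtain s where s: "m < ereal s" "ereal s < delta X \<Gamma> p" using ereal_dense2 by blast
  let ?E = "\<lambda>\<theta>. elements_in_direction X \<Gamma> p \<theta> (\<epsilon> \<theta>)"
  have piece: "(\<lambda>g. exp (- s * disp g)) summable_on ?E \<theta>" if "\<theta> \<in> T" for \<theta>
  proof -
    have "delta_dir_eps X \<Gamma> p \<theta> (\<epsilon> \<theta>) \<le> m" unfolding m_def using that T(2) by (intro Max_ge) auto
    then have "critical_exponent disp (?E \<theta>) < ereal s" using s(1) unfolding delta_dir_eps_eq by (rule le_less_trans)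
    then show ?thesis by (rule critical_exponent_less_imp_summable[rotated]) simp
  qed
  have Un: "(\<lambda>g. exp (- s * disp g)) summable_on (A \<union> B)"
    if "(\<lambda>g. exp (- s * disp g)) summable_on A" "(\<lambda>g. exp (- s * disp g)) summable_on B" for A B
  proof -
    have "(\<lambda>g. exp (- s * disp g)) summable_on (B - A)"
      using that(2) by (rule summable_on_subset_banach) blast
    then have "(\<lambda>g. exp (- s * disp g)) summable_on (A \<union> (B - A))"
      using that(1) by (intro summable_on_Un_disjoint) auto
    then show ?thesis by simp
  qed
  have union: "(\<lambda>g. exp (- s * disp g)) summable_on (\<Union>\<theta>\<in>T'. ?E \<theta>)" if "T' \<subseteq> T" for T'
    using finite_subset[OF that T(2)] that
  proof (induction T')
    case empty then show ?case by simp
  next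
    case (insert \<theta> T') then show ?case using Un piece by simp
  qed
  \<comment> \<open>Elements fixing \<open>p\<close> lie in no cone; there are only finitely many of
    them.\<close>
  have "(\<lambda>g. exp (- s * disp g)) summable_on {\<gamma>\<in>\<Gamma>. disp \<gamma> \<le> 0}"
    by (rule summable_on_finite[OF finite_bounded_disp])
  then have "(\<lambda>g. exp (- s * disp g)) summable_on ({\<gamma>\<in>\<Gamma>. disp \<gamma> \<le> 0} \<union> (\<Union>\<theta>\<in>T. ?E \<theta>))"
    by (rule Un) (rule union, rule order_refl)
  moreover have "\<Gamma> \<subseteq> {\<gamma>\<in>\<Gamma>. disp \<gamma> \<le> 0} \<union> (\<Union>\<theta>\<in>T. ?E \<theta>)"
  proof
    fix \<gamma> assume g: "\<gamma> \<in> \<Gamma>"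
    show "\<gamma> \<in> {\<gamma>\<in>\<Gamma>. disp \<gamma> \<le> 0} \<union> (\<Union>\<theta>\<in>T. ?E \<theta>)"
    proof (cases "act \<gamma> p = p")
      case True
      then have "disp \<gamma> = 0" using base by (simp add: disp_def)
      then show ?thesis using g by simp
    next
      case False
      have "direction X p (act \<gamma> p) \<in> (\<Union>\<theta>\<in>T. ball \<theta> (\<epsilon> \<theta>))"
        using direction_in_directions[OF g False] T(3) by blast
      then obtain \<theta> where "\<theta> \<in> T" "direction X p (act \<gamma> p) \<in> ball \<theta> (\<epsilon> \<theta>)" by (rule UN_E)
      then have "\<theta> \<in> T" "\<gamma> \<in> ?E \<theta>"
        using g False by (auto simp: elements_in_direction_def dist_norm norm_minus_commute)
      then show ?thesis by blast
    qed
  qed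
  ultimately have "(\<lambda>g. exp (- s * disp g)) summable_on \<Gamma>" by (rule summable_on_subset_banach)
  then have "delta X \<Gamma> p \<le> ereal s"
    unfolding delta_eq by (rule critical_exponent_le_of_summable[rotated]) simp
  then show False using s(2) by simp
qed

definition mult :: nat where "mult = card {\<gamma>\<in>\<Gamma>. \<forall>i. len \<gamma> i \<le> 1 + 4 * R}"

lemma mult_pos: "0 < mult"
proof -
  have "len \<one>\<^bsub>G\<^esub> i = 0" for i
    using isometry_group_one_apply[OF base_in[of i]] by (simp add: len_def)
  then have "\<one>\<^bsub>G\<^esub> \<in> {\<gamma>\<in>\<Gamma>. \<forall>i. len \<gamma> i \<le> 1 + 4 * R}" using \<Gamma>_closed(3) R by simp
  then show ?thesis unfolding mult_def card_gt_0_iff using finite_bounded_len by blast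
qed

text \<open>A far shell of the cone is cut into unit boxes by rounding the lengths down. Their
  number is polynomial in \<open>k\<close>, so one box keeps the exponential count. Within it
  lengths differ by at most 1, as \<open>card_near_le\<close> requires, and they are close to
  \<open>k * \<theta>\<close>.\<close>

lemma cone_box_exists:
  assumes t: "0 \<le> t" "ereal t < delta_dir_eps X \<Gamma> p \<theta> \<epsilon>" and \<theta>: "\<theta> \<in> directions" and \<epsilon>: "0 < \<epsilon>"
  shows "\<exists>k B. K \<le> k \<and> finite B \<and> B \<subseteq> \<Gamma> \<and> (\<forall>\<gamma>\<in>\<Gamma>. card {b\<in>B. near R b \<gamma>} \<le> mult) \<and>
    (\<forall>b\<in>B. \<forall>i. \<bar>len b i - real k * \<theta> $ i\<bar> \<le> \<epsilon> * (real k + 1) + 1) \<and>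
    exp (t * real k) \<le> real (card B) * (real k + 2) ^ CARD('i)"
proof -
  let ?E = "elements_in_direction X \<Gamma> p \<theta> \<epsilon>"
  obtain s where s: "ereal t < ereal s" "ereal s < critical_exponent disp ?E"
    using ereal_dense2[OF t(2)] unfolding delta_dir_eps_eq by blast
  have ns: "\<not> (\<lambda>g. exp (- s * disp g)) summable_on ?E"
  proof
    assume "(\<lambda>g. exp (- s * disp g)) summable_on ?E"
    then have "critical_exponent disp ?E \<le> ereal s" by (rule critical_exponent_le_of_summable[rotated]) simp
    then show False using s(2) by simp
  qed
  have fin: "finite {g\<in>?E. disp g \<le> r}" for r
    by (rule finite_subset[OF _ finite_bounded_disp[of r]]) (use elements_in_direction_subset in blast)
  have ts: "t < s" using s(1) by simp
  obtain k where k: "K \<le> k" "exp (t * real k) \<le> real (card {g\<in>?E. nat \<lfloor>disp g\<rfloor> = k})"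
    using large_shell_exists[of ?E disp t s K, OF disp_nonneg fin t(1) ts ns] by blast
  define S where "S = {g\<in>?E. nat \<lfloor>disp g\<rfloor> = k}"
  have disp_S: "real k \<le> disp g" "disp g < real k + 1" if "g \<in> S" for g
  proof -
    have "\<lfloor>disp g\<rfloor> = int k" using that disp_nonneg[of g] by (auto simp: S_def)
    then show "real k \<le> disp g" "disp g < real k + 1" by linarith+
  qed
  have finS: "finite S"
    by (rule finite_subset[OF _ fin[of "real k + 1"]]) (use disp_S in \<open>auto simp: S_def less_imp_le\<close>)
  define h where "h g = (\<lambda>i. nat \<lfloor>len g i\<rfloor>)" for g
  let ?Y = "PiE UNIV (\<lambda>_::'i. {..<k+2})"
  have hY: "h ` S \<subseteq> ?Y"
  proof
    fix y assume "y \<in> h ` S"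
    then obtain g where g: "y = h g" "g \<in> S" by (rule imageE)
    have "nat \<lfloor>len g i\<rfloor> < k + 2" for i
    proof -
      have "len g i < real k + 1" using len_le_disp[of g i] disp_S(2)[OF g(2)] by linarith
      then show ?thesis by linarith
    qed
    then show "y \<in> ?Y" by (simp add: g(1) h_def PiE_iff)
  qed
  have cardY: "card ?Y = (k + 2) ^ CARD('i)" by (simp add: card_PiE)
  have finY: "finite ?Y" by (intro finite_PiE) auto
  obtain y where y: "exp (t * real k) \<le> real (card {g\<in>S. h g = y}) * real (card ?Y)"
    using large_fibre_exists[OF finS finY hY, of "exp (t * real k)"] k(2) by (auto simp: S_def)
  define B where "B = {g\<in>S. h g = y}"
  have B: "finite B" "B \<subseteq> \<Gamma>"
  proof -
    show "finite B" unfolding B_def using finS by simp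
    show "B \<subseteq> \<Gamma>" using elements_in_direction_subset by (auto simp: B_def S_def)
  qed
  have box: "\<bar>len b i - len b' i\<bar> \<le> 1" if "b \<in> B" "b' \<in> B" for b b' i
  proof -
    have "nat \<lfloor>len b i\<rfloor> = nat \<lfloor>len b' i\<rfloor>" using that by (auto simp: B_def h_def fun_eq_iff)
    moreover have "0 \<le> \<lfloor>len b i\<rfloor>" for b by simp
    ultimately have "\<lfloor>len b i\<rfloor> = \<lfloor>len b' i\<rfloor>" using eq_nat_nat_iff by blast
    then show ?thesis by linarith
  qed
  have "card {b\<in>B. near R b \<gamma>} \<le> mult" if "\<gamma> \<in> \<Gamma>" for \<gamma>
    unfolding mult_def by (rule card_near_le[OF B box that])
  moreover have "\<bar>len b i - real k * \<theta> $ i\<bar> \<le> \<epsilon> * (real k + 1) + 1" if "b \<in> B" for b i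
  proof -
    have bS: "b \<in> S" using that by (simp add: B_def)
    let ?u = "direction X p (act b p)"
    have "norm (?u - \<theta>) < \<epsilon>" using bS by (simp add: S_def elements_in_direction_def)
    then have 1: "\<bar>(?u - \<theta>) $ i\<bar> \<le> \<epsilon>" using component_le_norm_cart[of "?u - \<theta>" i] by linarith
    have 2: "\<bar>\<theta> $ i\<bar> \<le> 1" using component_le_norm_cart[of \<theta> i] \<theta> by (simp add: directions_def)
    \<comment> \<open>The first summand is the deviation of the direction, the second the deviation
      of the displacement from \<open>k\<close>, which is at most 1.\<close>
    have "len b i - real k * \<theta> $ i = disp b * (?u - \<theta>) $ i + (disp b - real k) * \<theta> $ i"
      by (simp add: len_eq_disp_direction algebra_simps)
    also have "\<bar>\<dots>\<bar> \<le> \<bar>disp b * (?u - \<theta>) $ i\<bar> + \<bar>(disp b - real k) * \<theta> $ i\<bar>" by (rule abs_triangle_ineq)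
    also have "\<dots> \<le> (real k + 1) * \<epsilon> + 1 * 1"
      unfolding abs_mult using 1 2 disp_S[OF bS] \<epsilon> by (intro add_mono mult_mono) auto
    finally show ?thesis by (simp add: mult.commute)
  qed
  moreover have "exp (t * real k) \<le> real (card B) * (real k + 2) ^ CARD('i)"
    using y[unfolded cardY, folded B_def] by (simp add: add.commute)
  ultimately show ?thesis using k(1) B by (intro exI[of _ k] exI[of _ B]) blast
qed

text \<open>Products of \<open>n k\<^sub>2\<close> elements of size about \<open>k\<^sub>1\<close> in direction \<open>\<theta>\<^sub>1\<close> and \<open>n k\<^sub>1\<close> elements of size about
  \<open>k\<^sub>2\<close> in direction \<open>\<theta>\<^sub>2\<close> have displacement about \<open>n k\<^sub>1 k\<^sub>2 \<parallel>\<theta>\<^sub>1 + \<theta>\<^sub>2\<parallel>\<close>, and there are about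
  \<open>exp (2 \<delta> n k\<^sub>1 k\<^sub>2)\<close> of them.\<close>

theorem maximal_direction_unique:
  assumes \<theta>: "\<theta>\<^sub>1 \<in> directions" "\<theta>\<^sub>2 \<in> directions"
    and eq: "delta_dir X \<Gamma> p \<theta>\<^sub>1 = delta X \<Gamma> p" "delta_dir X \<Gamma> p \<theta>\<^sub>2 = delta X \<Gamma> p"
    and fin: "delta X \<Gamma> p \<noteq> \<infinity>"
  shows "\<theta>\<^sub>1 = \<theta>\<^sub>2"
proof (rule ccontr)
  assume ne: "\<theta>\<^sub>1 \<noteq> \<theta>\<^sub>2"
  obtain \<delta> where \<delta>: "delta X \<Gamma> p = ereal \<delta>" "0 < \<delta>"
    using fin delta_positive by (cases "delta X \<Gamma> p") auto
  \<comment> \<open>By the parallelogram identity two distinct unit vectors have a sum of norm less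
    than 2; this strict inequality is the whole gain.\<close>
  define w where "w = norm (\<theta>\<^sub>1 + \<theta>\<^sub>2)"
  have w: "0 \<le> w" "w < 2"
  proof -
    have "(norm (\<theta>\<^sub>1 + \<theta>\<^sub>2))\<^sup>2 + (norm (\<theta>\<^sub>1 - \<theta>\<^sub>2))\<^sup>2 = 2 * (norm \<theta>\<^sub>1)\<^sup>2 + 2 * (norm \<theta>\<^sub>2)\<^sup>2"
      by (simp add: power2_norm_eq_inner inner_add_left inner_add_right inner_diff_left inner_diff_right inner_commute)
    also have "\<dots> = 4" using \<theta> by (simp add: directions_def)
    finally have "(norm (\<theta>\<^sub>1 + \<theta>\<^sub>2))\<^sup>2 + (norm (\<theta>\<^sub>1 - \<theta>\<^sub>2))\<^sup>2 = 4" .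
    moreover have "0 < (norm (\<theta>\<^sub>1 - \<theta>\<^sub>2))\<^sup>2" using ne by simp
    ultimately have "(norm (\<theta>\<^sub>1 + \<theta>\<^sub>2))\<^sup>2 < 4" by linarith
    then have "w\<^sup>2 < 2\<^sup>2" by (simp add: w_def)
    then show "w < 2" by (rule power2_less_imp_less) simp
    show "0 \<le> w" by (simp add: w_def)
  qed
  define r where "r = real CARD('i)"
  have r: "1 \<le> r" by (simp add: r_def)
  \<comment> \<open>Small enough for \<open>gap\<close>, which is equivalent to
    \<open>4 * \<epsilon> * (r * \<delta> + 1) < \<delta> * (2 - w)\<close>; the bound
    \<open>\<delta> / 2\<close> keeps \<open>t\<close> nonnegative.\<close>
  define \<epsilon> where "\<epsilon> = min 1 (min (\<delta> / 2) (\<delta> * (2 - w) / (8 * (r * \<delta> + 1))))"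
  have rd: "0 < r * \<delta> + 1" using r \<delta>(2) by (simp add: add_pos_pos)
  have \<epsilon>: "0 < \<epsilon>" "\<epsilon> \<le> 1" "\<epsilon> \<le> \<delta> / 2" "\<epsilon> \<le> \<delta> * (2 - w) / (8 * (r * \<delta> + 1))"
  proof -
    show "0 < \<epsilon>" using w rd \<delta>(2) by (simp add: \<epsilon>_def)
    show "\<epsilon> \<le> 1" unfolding \<epsilon>_def by (rule min.cobounded1)
    show "\<epsilon> \<le> \<delta> / 2" unfolding \<epsilon>_def by (rule min.coboundedI2[OF min.cobounded1])
    show "\<epsilon> \<le> \<delta> * (2 - w) / (8 * (r * \<delta> + 1))"
      unfolding \<epsilon>_def by (rule min.coboundedI2[OF min.cobounded2])
  qed
  have gap: "\<delta> * (w + 4 * r * \<epsilon>) < 2 * (\<delta> - 2 * \<epsilon>)"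
  proof -
    have "\<epsilon> * (8 * (r * \<delta> + 1)) \<le> \<delta> * (2 - w)" using \<epsilon>(4) rd by (simp add: pos_le_divide_eq)
    moreover have "0 < \<epsilon> * (r * \<delta> + 1)" using \<epsilon>(1) rd by simp
    ultimately have "4 * (\<epsilon> * (r * \<delta> + 1)) < \<delta> * (2 - w)" by linarith
    then show ?thesis by (simp add: algebra_simps)
  qed
  define t where "t = \<delta> - \<epsilon>"
  have t: "0 \<le> t" "t < \<delta>" using \<epsilon> \<delta>(2) by (auto simp: t_def)
  have t_less: "ereal t < delta_dir_eps X \<Gamma> p \<theta>\<^sub>1 \<epsilon>" "ereal t < delta_dir_eps X \<Gamma> p \<theta>\<^sub>2 \<epsilon>"
    using delta_dir_le_eps[OF \<epsilon>(1), of \<theta>\<^sub>1] delta_dir_le_eps[OF \<epsilon>(1), of \<theta>\<^sub>2] t(2) \<delta>(1) eq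
    by (metis ereal_less_eq(3) less_ereal.simps(1) order_less_le_trans)+
  define Q where "Q = mult * card A"
  have Q: "0 < real Q" using mult_pos A_nonempty by (simp add: Q_def)
  \<comment> \<open>For large \<open>k\<close> the error \<open>\<epsilon> * k\<close> in length
    absorbs \<open>err + 2\<close>, and a factor \<open>exp (\<epsilon> * k)\<close> absorbs the
    number of boxes and the loss \<open>Q\<close> of one product.\<close>
  have "\<forall>\<^sub>F k in sequentially. err + 2 \<le> real k * \<epsilon>" by (rule eventually_nat_mult_ge[OF \<epsilon>(1)])
  moreover have "\<forall>\<^sub>F k in sequentially. (real k + 2) ^ CARD('i) * real Q \<le> exp (\<epsilon> * real k)"
    by (rule eventually_power_le_exp[OF Q \<epsilon>(1)])
  ultimately have "\<forall>\<^sub>F k in sequentially. err + 2 \<le> real k * \<epsilon> \<and> (real k + 2) ^ CARD('i) * real Q \<le> exp (\<epsilon> * real k)"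
    by (rule eventually_conj)
  then obtain K where K: "\<forall>k\<ge>K. err + 2 \<le> real k * \<epsilon> \<and> (real k + 2) ^ CARD('i) * real Q \<le> exp (\<epsilon> * real k)"
    unfolding eventually_sequentially ..
  \<comment> \<open>Subtracting \<open>err\<close> makes the error per factor in
    \<open>iterated_product_set_exists\<close> exactly \<open>2 * \<epsilon> * k\<close>.\<close>
  have box: "\<exists>k B. 1 \<le> k \<and> finite B \<and> B \<subseteq> \<Gamma> \<and> (\<forall>\<gamma>\<in>\<Gamma>. card {b\<in>B. near R b \<gamma>} \<le> mult) \<and>
      (\<forall>b\<in>B. \<forall>i. \<bar>len b i - real k * \<theta> $ i\<bar> \<le> 2 * \<epsilon> * real k - err) \<and>
      exp ((t - \<epsilon>) * real k) * real Q \<le> real (card B)"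
    if \<theta>: "\<theta> \<in> directions" and less: "ereal t < delta_dir_eps X \<Gamma> p \<theta> \<epsilon>" for \<theta>
  proof -
    obtain k B where B: "max 1 K \<le> k" "finite B" "B \<subseteq> \<Gamma>" "\<forall>\<gamma>\<in>\<Gamma>. card {b\<in>B. near R b \<gamma>} \<le> mult"
      "\<forall>b\<in>B. \<forall>i. \<bar>len b i - real k * \<theta> $ i\<bar> \<le> \<epsilon> * (real k + 1) + 1"
      "exp (t * real k) \<le> real (card B) * (real k + 2) ^ CARD('i)"
      using cone_box_exists[OF t(1) less \<theta> \<epsilon>(1), of "max 1 K"] by (elim exE conjE)
    have k: "1 \<le> k" "err + 2 \<le> real k * \<epsilon>" "(real k + 2) ^ CARD('i) * real Q \<le> exp (\<epsilon> * real k)"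
      using B(1) K by auto
    have "\<epsilon> * (real k + 1) + 1 \<le> 2 * \<epsilon> * real k - err" using k(2) \<epsilon>(2) by (simp add: algebra_simps)
    then have "\<forall>b\<in>B. \<forall>i. \<bar>len b i - real k * \<theta> $ i\<bar> \<le> 2 * \<epsilon> * real k - err" using B(5) by (meson order_trans)
    moreover have "exp ((t - \<epsilon>) * real k) * real Q \<le> real (card B)"
    proof -
      have "exp ((t - \<epsilon>) * real k) * real Q * exp (\<epsilon> * real k) = exp (t * real k) * real Q"
        by (simp add: algebra_simps flip: exp_add)
      also have "\<dots> \<le> real (card B) * (real k + 2) ^ CARD('i) * real Q"
        using B(6) by (intro mult_right_mono) auto
      also have "\<dots> = real (card B) * ((real k + 2) ^ CARD('i) * real Q)" by simp
      also have "\<dots> \<le> real (card B) * exp (\<epsilon> * real k)" using k(3) by (intro mult_left_mono) auto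
      finally show ?thesis by simp
    qed
    ultimately show ?thesis using k(1) B(2-4) by (intro exI[of _ k] exI[of _ B] conjI)
  qed
  obtain k1 B1 where B1: "1 \<le> k1" "finite B1" "B1 \<subseteq> \<Gamma>" "\<forall>\<gamma>\<in>\<Gamma>. card {b\<in>B1. near R b \<gamma>} \<le> mult"
      "\<forall>b\<in>B1. \<forall>i. \<bar>len b i - real k1 * \<theta>\<^sub>1 $ i\<bar> \<le> 2 * \<epsilon> * real k1 - err"
      "exp ((t - \<epsilon>) * real k1) * real Q \<le> real (card B1)"
    using box[OF \<theta>(1) t_less(1)] by (elim exE conjE)
  obtain k2 B2 where B2: "1 \<le> k2" "finite B2" "B2 \<subseteq> \<Gamma>" "\<forall>\<gamma>\<in>\<Gamma>. card {b\<in>B2. near R b \<gamma>} \<le> mult"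
      "\<forall>b\<in>B2. \<forall>i. \<bar>len b i - real k2 * \<theta>\<^sub>2 $ i\<bar> \<le> 2 * \<epsilon> * real k2 - err"
      "exp ((t - \<epsilon>) * real k2) * real Q \<le> real (card B2)"
    using box[OF \<theta>(2) t_less(2)] by (elim exE conjE)
  define T where "T = real k1 * real k2"
  have T: "0 < T" using B1(1) B2(1) by (simp add: T_def)
  define w' where "w' = w + 4 * r * \<epsilon>"
  have w': "0 < w'" using w(1) r \<epsilon>(1) by (simp add: w'_def add_nonneg_pos)
  \<comment> \<open>The products grow at the rate on the right; the series therefore still diverges
    at some \<open>s\<close> beyond \<open>\<delta>\<close>.\<close>
  have "\<delta> < 2 * (\<delta> - 2 * \<epsilon>) / w'" using gap w' by (simp add: w'_def pos_less_divide_eq)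
  then obtain s where s: "\<delta> < s" "s < 2 * (\<delta> - 2 * \<epsilon>) / w'" using dense by blast
  have one: "len \<one>\<^bsub>G\<^esub> i = 0" for i
    using isometry_group_one_apply[OF base_in[of i]] by (simp add: len_def)
  have S0: "finite {\<one>\<^bsub>G\<^esub>}" "{\<one>\<^bsub>G\<^esub>} \<subseteq> \<Gamma>" using \<Gamma>_closed(3) by simp_all
  have "\<not> (\<lambda>g. exp (- s * disp g)) summable_on \<Gamma>"
  proof (rule not_summable_of_growth[where L = "T * w'" and \<beta> = "2 * (t - \<epsilon>) * T"])
    show "0 \<le> s" using s(1) \<delta>(2) by simp
    have "s * w' < 2 * (t - \<epsilon>)" using s(2) w' by (simp add: pos_less_divide_eq t_def)
    then show "s * (T * w') < 2 * (t - \<epsilon>) * T" using T by (simp add: mult.left_commute mult.commute)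
    fix n :: nat
    obtain S1 where S1: "finite S1" "S1 \<subseteq> \<Gamma>" "card B2 ^ (n * k1) * card {\<one>\<^bsub>G\<^esub>} \<le> (mult * card A) ^ (n * k1) * card S1"
        "\<forall>\<gamma>'\<in>S1. \<exists>\<gamma>\<in>{\<one>\<^bsub>G\<^esub>}. \<forall>i. \<bar>len \<gamma>' i - (len \<gamma> i + real (n * k1) * (real k2 * \<theta>\<^sub>2 $ i))\<bar> \<le> real (n * k1) * (err + (2 * \<epsilon> * real k2 - err))"
      using iterated_product_set_exists[OF B2(2,3,4,5) S0, of "n * k1"] by (elim exE conjE)
    obtain S2 where S2: "finite S2" "S2 \<subseteq> \<Gamma>" "card B1 ^ (n * k2) * card S1 \<le> (mult * card A) ^ (n * k2) * card S2"
        "\<forall>\<gamma>'\<in>S2. \<exists>\<gamma>\<in>S1. \<forall>i. \<bar>len \<gamma>' i - (len \<gamma> i + real (n * k2) * (real k1 * \<theta>\<^sub>1 $ i))\<bar> \<le> real (n * k2) * (err + (2 * \<epsilon> * real k1 - err))"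
      using iterated_product_set_exists[OF B1(2,3,4,5) S1(1,2), of "n * k2"] by (elim exE conjE)
    define N where "N = real n * T"
    have N: "0 \<le> N" using T by (simp add: N_def)
    have "disp \<gamma>' \<le> real n * (T * w')" if g: "\<gamma>' \<in> S2" for \<gamma>'
    proof -
      obtain \<gamma> where \<gamma>: "\<gamma> \<in> S1" "\<forall>i. \<bar>len \<gamma>' i - (len \<gamma> i + real (n * k2) * (real k1 * \<theta>\<^sub>1 $ i))\<bar> \<le> real (n * k2) * (err + (2 * \<epsilon> * real k1 - err))"
        using S2(4)[rule_format, OF g] by (elim bexE)
      have "\<bar>len \<gamma>' i - (N *\<^sub>R (\<theta>\<^sub>1 + \<theta>\<^sub>2)) $ i\<bar> \<le> 4 * \<epsilon> * N" for i
      proof -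
        have "\<bar>len \<gamma>' i - (len \<gamma> i + N * \<theta>\<^sub>1 $ i)\<bar> \<le> 2 * \<epsilon> * N"
          using \<gamma>(2)[rule_format, of i] by (simp add: N_def T_def ac_simps)
        moreover have "\<bar>len \<gamma> i - N * \<theta>\<^sub>2 $ i\<bar> \<le> 2 * \<epsilon> * N"
          using S1(4)[rule_format, OF \<gamma>(1)] one by (simp add: N_def T_def ac_simps)
        ultimately show ?thesis by (simp add: distrib_left)
      qed
      then have "disp \<gamma>' \<le> norm (N *\<^sub>R (\<theta>\<^sub>1 + \<theta>\<^sub>2)) + real CARD('i) * (4 * \<epsilon> * N)" by (rule disp_le_of_len)
      also have "norm (N *\<^sub>R (\<theta>\<^sub>1 + \<theta>\<^sub>2)) = N * w" unfolding norm_scaleR w_def using N by simp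
      also have "N * w + real CARD('i) * (4 * \<epsilon> * N) = real n * (T * w')" by (simp add: w'_def r_def N_def algebra_simps)
      finally show ?thesis .
    qed
    moreover have "exp (real n * (2 * (t - \<epsilon>) * T)) \<le> real (card S2)"
    proof -
      have "exp ((t - \<epsilon>) * real k2) ^ (n * k1) * 1 \<le> real (card S1)"
      proof (rule power_quotient_le[OF B2(6) _ Q])
        have "real (card B2 ^ (n * k1)) \<le> real (Q ^ (n * k1) * card S1)"
          using S1(3) unfolding Q_def by (intro of_nat_mono) simp
        then show "real (card B2) ^ (n * k1) * 1 \<le> real Q ^ (n * k1) * real (card S1)" by simp
      qed auto
      then have "exp ((t - \<epsilon>) * real k1) ^ (n * k2) * (exp ((t - \<epsilon>) * real k2) ^ (n * k1) * 1)
          \<le> exp ((t - \<epsilon>) * real k1) ^ (n * k2) * real (card S1)"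
        by (intro mult_left_mono) auto
      also have "\<dots> \<le> real (card S2)"
      proof (rule power_quotient_le[OF B1(6) _ Q])
        have "real (card B1 ^ (n * k2) * card S1) \<le> real (Q ^ (n * k2) * card S2)"
          using S2(3) unfolding Q_def by (rule of_nat_mono)
        then show "real (card B1) ^ (n * k2) * real (card S1) \<le> real Q ^ (n * k2) * real (card S2)" by simp
      qed auto
      also have "exp ((t - \<epsilon>) * real k1) ^ (n * k2) * (exp ((t - \<epsilon>) * real k2) ^ (n * k1) * 1)
          = exp (real n * (2 * (t - \<epsilon>) * T))"
        unfolding exp_of_nat_mult[symmetric] mult_1_right exp_add[symmetric]
        by (simp add: T_def algebra_simps)
      finally show ?thesis .
    qed
    ultimately show "\<exists>S. finite S \<and> S \<subseteq> \<Gamma> \<and> (\<forall>g\<in>S. disp g \<le> real n * (T * w')) \<and>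
        exp (real n * (2 * (t - \<epsilon>) * T)) \<le> real (card S)"
      using S2(1,2) by (intro exI[of _ S2]) blast
  qed
  then have "ereal s \<le> delta X \<Gamma> p"
    unfolding delta_eq by (rule critical_exponent_ge_of_not_summable[rotated]) simp
  then show False using s(1) \<delta>(1) by simp
qed

end

theorem mainTheorem6:
  fixes X :: "'i::finite \<Rightarrow> 'a metric"
    and \<Gamma> :: "('i \<Rightarrow> 'a \<Rightarrow> 'a) set"
    and p :: "'i \<Rightarrow> 'a"
  assumes "\<And>i. hadamard_space (X i)"
    and "\<And>i. locally_compact_space (mtopology_of (X i))"
    and "subgroup \<Gamma> (product_group UNIV (\<lambda>i. isometry_group (X i)))"
    and "properly_discontinuous X \<Gamma>"
    and "\<exists>g\<in>\<Gamma>. \<exists>h\<in>\<Gamma>. independent_regular_axial X g h"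
    and "p \<in> mspace (product_metric X)"
  shows "0 < delta X \<Gamma> p \<and>
    (\<exists>\<theta>\<in>directions. delta_dir X \<Gamma> p \<theta> = delta X \<Gamma> p) \<and>
    (delta X \<Gamma> p \<noteq> \<infinity> \<longrightarrow> (\<exists>!\<theta>. \<theta> \<in> directions \<and> delta_dir X \<Gamma> p \<theta> = delta X \<Gamma> p))"
proof -
  interpret product_action X \<Gamma> p by (intro product_action.intro assms(1-4,6))
  obtain F S l C where "independent_family X \<Gamma> p F S l C"
    using independent_family_exists[OF assms(5)] by blast
  then interpret independent_family X \<Gamma> p F S l C .
  obtain A R where AR: "finite A" "A \<subseteq> \<Gamma>" "0 \<le> R"
      "\<forall>\<gamma>\<^sub>1\<in>\<Gamma>. \<forall>\<gamma>\<^sub>2\<in>\<Gamma>. \<exists>f\<in>A. near R \<gamma>\<^sub>1 (\<gamma>\<^sub>1 \<otimes>\<^bsub>G\<^esub> (f \<otimes>\<^bsub>G\<^esub> \<gamma>\<^sub>2))"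
    using extension by (elim exE conjE)
  interpret extension_data X \<Gamma> p A R
  proof
    show "\<exists>f\<in>A. near R \<gamma>\<^sub>1 (\<gamma>\<^sub>1 \<otimes>\<^bsub>G\<^esub> (f \<otimes>\<^bsub>G\<^esub> \<gamma>\<^sub>2))" if "\<gamma>\<^sub>1 \<in> \<Gamma>" "\<gamma>\<^sub>2 \<in> \<Gamma>" for \<gamma>\<^sub>1 \<gamma>\<^sub>2
      using AR(4) that by blast
    \<comment> \<open>The constant \<open>R\<close> comes from \<open>extension\<close>; the
      separated sets are built afterwards for this \<open>R\<close>.\<close>
    show "\<exists>B. finite B \<and> card B = n \<and> B \<subseteq> \<Gamma> \<and> (\<forall>\<gamma>\<in>\<Gamma>. card {b\<in>B. near R b \<gamma>} \<le> 1)" for n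
      by (rule separated_set_exists[OF AR(3)])
  qed (use AR in auto)
  show ?thesis
    using delta_positive maximal_direction_exists maximal_direction_unique by blast
qed

end
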